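(* Let $N\ge 2$ and let $(D,\eta,\rho_1,\ldots,\rho_N)$ be an $N$-player Cox process Hotelling game. Suppose that $D$ is compact, that $D$ admits a transitive group of metric-preserving automorphisms (i.e. a group of bijective isometries of $(D,d)$ acting transitively on $D$), and that $\eta$ is invariant under this group. For $1\le j\le N$ let $\bar\rho_j\in\mathcal C(\rho_j)$ denote the constant function $\rho_j/\eta(D)$. Then $(\bar\rho_1,\ldots,\bar\rho_N)$ is the unique Nash equilibrium of this game. (Uniqueness is among all Nash equilibria in independently randomized strategies: if $(f_1(M_1),\ldots,f_N(M_N))$ is a Nash equilibrium, then $f_j(M_j)=\bar\rho_j$ with probability $1$ for every $j$.)
   Context: $D$ is a complete separable metric space with fixed metric $d$ and Borel $\sigma$-field $\mathcal B$. The base measure $\eta$ is a finite positive measure on $(D,\mathcal B)$ that is diffuse (every $B\in\mathcal B$ with $\eta(B)>0$ contains a Borel set $C$ with $0<\eta(C)<\eta(B)$) and non-conflicting. For a point process $\Phi$ on $D$ and a point $x$ in its support, the open Voronoi cell is $W_\Phi(x)=\{z\in D: d(x,z)<d(x',z)\text{ for all points }x'\neq x\text{ in the support of }\Phi\}$; $\eta$ is non-conflicting if, for the Poisson process on $D$ with intensity measure $\eta$, conditioned on there being at least one point, the union of the open Voronoi cells has full measure $\eta(D)$ with probability $1$. For $\rho>0$, $\mathcal C(\rho)=\{f:D\to\mathbb R_+ \text{ measurable}: \int_D f\,d\eta=\rho\}$, where $f$ is identified with the measure $f\eta$ (so functions equal $\eta$-a.e. are identified), and $\mathcal C(\rho)$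 carries the topology of weak convergence of measures and its Borel $\sigma$-field. Cox process Hotelling game $(D,\eta,\rho_1,\ldots,\rho_N)$, with $\rho_j>0$: player $i$'s pure actions are the elements $f_i\in\mathcal C(\rho_i)$. Given $(f_1,\ldots,f_N)$, let $\Phi_1,\ldots,\Phi_N$ be independent Poisson point processes on $D$ with intensity measures $f_i\eta$, and $\Phi=\sum_i\Phi_i$. The value of player $i$ is $V_i(f_1,\ldots,f_N)=\mathbb E\left[\sum_{x\in\Phi_i}\eta(W_\Phi(x))\right]$ (an empty sum is $0$). A vector of independently randomized strategies is $(f_1(M_1),\ldots,f_N(M_N))$, where $M_1,\ldots,M_N$ are independent random variables and $f_j(M_j)$ is a $\mathcal C(\rho_j)$-valued random element. It is a Nash equilibrium if for all $1\le i\le N$ and all $g_i\in\mathcal C(\rho_i)$, $\mathbb E[V_i(f_1(M_1),\ldots,f_N(M_N))]\ge \mathbb E[V_i(g_i,(f_j(M_j),j\ne i))]$. Deterministic strategies are the special case of constant random elements. *)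

theory Defs
  imports "HOL-Probability.Probability"
begin

text \<open>A Poisson process with finite intensity measure has finitely many points almost surely, so
  the state space of point configurations is taken to be the finite multisets, with the
  $\sigma$-algebra generated by the counting maps of Borel sets.\<close>

definition points_in :: "'a set \<Rightarrow> 'a multiset \<Rightarrow> nat" where
  "points_in B \<phi> = size (filter_mset (\<lambda>x. x \<in> B) \<phi>)"

definition configurations :: "'a::topological_space multiset measure" where
  "configurations = sigma UNIV {{\<phi>. points_in B \<phi> = n} | B n. B \<in> sets borel}"

definition poisson_process ::
    "'w measure \<Rightarrow> ('w \<Rightarrow> 'a::topological_space multiset) \<Rightarrow> 'a measure \<Rightarrow> bool" where
  "poisson_process P \<Phi> \<mu> \<longleftrightarrow>
     prob_space P \<and> \<Phi> \<in> P \<rightarrow>\<^sub>M configurations \<and>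
     (\<forall>B\<in>sets borel. \<forall>n. measure P {\<omega> \<in> space P. points_in B (\<Phi> \<omega>) = n}
         = exp (- measure \<mu> B) * measure \<mu> B ^ n / fact n) \<and>
     (\<forall>k. \<forall>B :: nat \<Rightarrow> 'a set.
         (\<forall>i<k. B i \<in> sets borel) \<longrightarrow> disjoint_family_on B {..<k} \<longrightarrow>
         prob_space.indep_vars P (\<lambda>_. count_space UNIV) (\<lambda>i \<omega>. points_in (B i) (\<Phi> \<omega>)) {..<k})"

text \<open>The law of the Poisson process: the probability measure on configurations under which the
  identity is a Poisson process. For a finite Borel measure \<open>\<mu>\<close> on a Polish space it exists (a
  Poisson number of independent points with distribution proportional to \<open>\<mu>\<close>) and it is unique,
  because the counts on finitely many disjoint Borel sets determine it.\<close>

definition poisson_law :: "'a::topological_space measure \<Rightarrow> 'a multiset measure" where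
  "poisson_law \<mu> = (THE Q. sets Q = sets configurations \<and> poisson_process Q (\<lambda>\<phi>. \<phi>) \<mu>)"

definition voronoi_cell :: "'a::metric_space multiset \<Rightarrow> 'a \<Rightarrow> 'a set" where
  "voronoi_cell \<phi> x = {z. \<forall>x'\<in>set_mset \<phi>. x' \<noteq> x \<longrightarrow> dist x z < dist x' z}"

definition diffuse :: "'a measure \<Rightarrow> bool" where
  "diffuse \<eta> \<longleftrightarrow>
     (\<forall>B\<in>sets \<eta>. 0 < emeasure \<eta> B \<longrightarrow>
        (\<exists>C\<in>sets \<eta>. C \<subseteq> B \<and> 0 < emeasure \<eta> C \<and> emeasure \<eta> C < emeasure \<eta> B))"

text \<open>\<open>uniform_measure Q A\<close> is the probability \<open>Q\<close> conditioned on the event \<open>A\<close>.\<close>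

definition non_conflicting :: "'a::metric_space measure \<Rightarrow> bool" where
  "non_conflicting \<eta> \<longleftrightarrow>
     (AE \<phi> in uniform_measure (poisson_law \<eta>) {\<phi>. \<phi> \<noteq> {#}}.
        emeasure \<eta> (\<Union>x\<in>set_mset \<phi>. voronoi_cell \<phi> x) = emeasure \<eta> UNIV)"

definition cox_hotelling_game ::
    "'a::polish_space measure \<Rightarrow> nat \<Rightarrow> (nat \<Rightarrow> real) \<Rightarrow> bool" where
  "cox_hotelling_game \<eta> N \<rho> \<longleftrightarrow>
     finite_measure \<eta> \<and> sets \<eta> = sets borel \<and> 0 < emeasure \<eta> UNIV \<and>
     diffuse \<eta> \<and> non_conflicting \<eta> \<and> (\<forall>j\<in>{1..N}. 0 < \<rho> j)"

text \<open>A pure action is a measure with a density of total mass \<open>r\<close> with respect to \<open>\<eta>\<close>; as a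
  measure it does not distinguish densities that are equal \<open>\<eta>\<close>-almost everywhere.\<close>

definition actions :: "'a measure \<Rightarrow> real \<Rightarrow> 'a measure set" where
  "actions \<eta> r =
     {density \<eta> (\<lambda>x. ennreal (f x)) | f :: 'a \<Rightarrow> real.
        f \<in> borel_measurable \<eta> \<and> (\<forall>x. 0 \<le> f x) \<and> (\<integral>\<^sup>+x. ennreal (f x) \<partial>\<eta>) = ennreal r}"

definition uniform_action :: "'a measure \<Rightarrow> real \<Rightarrow> 'a measure" where
  "uniform_action \<eta> r = density \<eta> (\<lambda>_. ennreal (r / measure \<eta> UNIV))"

text \<open>Weak convergence on the finite Borel measures: the coarsest topology for which integration
  of every bounded continuous function is continuous.\<close>

definition weak_topology :: "'a::topological_space measure topology" where
  "weak_topology = topology_generated_by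
     {{\<mu>. finite_measure \<mu> \<and> sets \<mu> = sets borel \<and> (\<integral>x. g x \<partial>\<mu>) \<in> U} | (g :: 'a \<Rightarrow> real) U.
        continuous_on UNIV g \<and> bounded (range g) \<and> open U}"

definition borel_of :: "'b topology \<Rightarrow> 'b measure" where
  "borel_of X = sigma (topspace X) {U. openin X U}"

definition action_space :: "'a::topological_space measure \<Rightarrow> real \<Rightarrow> 'a measure measure" where
  "action_space \<eta> r = borel_of (subtopology weak_topology (actions \<eta> r))"

text \<open>Given the actions \<open>f\<close>, the processes of the players are independent Poisson processes with
  intensities \<open>f 1, \<dots>, f N\<close>, that is, the coordinates under the product of the Poisson laws.\<close>

definition game_value ::
    "'a::metric_space measure \<Rightarrow> nat \<Rightarrow> (nat \<Rightarrow> 'a measure) \<Rightarrow> nat \<Rightarrow> ennreal" where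
  "game_value \<eta> N f i =
     (\<integral>\<^sup>+\<phi>. (\<Sum>x\<in>#\<phi> i. emeasure \<eta> (voronoi_cell (\<Sum>j\<in>{1..N}. \<phi> j) x))
        \<partial>(\<Pi>\<^sub>M j\<in>{1..N}. poisson_law (f j)))"

definition independently_randomized ::
    "'a::topological_space measure \<Rightarrow> nat \<Rightarrow> (nat \<Rightarrow> real) \<Rightarrow> 'w measure \<Rightarrow> (nat \<Rightarrow> 'm measure) \<Rightarrow>
     (nat \<Rightarrow> 'w \<Rightarrow> 'm) \<Rightarrow> (nat \<Rightarrow> 'm \<Rightarrow> 'a measure) \<Rightarrow> bool" where
  "independently_randomized \<eta> N \<rho> P S M f \<longleftrightarrow>
     prob_space P \<and> prob_space.indep_vars P S M {1..N} \<and>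
     (\<forall>j\<in>{1..N}. f j \<in> S j \<rightarrow>\<^sub>M action_space \<eta> (\<rho> j))"

definition nash_equilibrium ::
    "'a::metric_space measure \<Rightarrow> nat \<Rightarrow> (nat \<Rightarrow> real) \<Rightarrow> 'w measure \<Rightarrow> (nat \<Rightarrow> 'm measure) \<Rightarrow>
     (nat \<Rightarrow> 'w \<Rightarrow> 'm) \<Rightarrow> (nat \<Rightarrow> 'm \<Rightarrow> 'a measure) \<Rightarrow> bool" where
  "nash_equilibrium \<eta> N \<rho> P S M f \<longleftrightarrow>
     independently_randomized \<eta> N \<rho> P S M f \<and>
     (\<forall>i\<in>{1..N}. \<forall>g\<in>actions \<eta> (\<rho> i).
        (\<integral>\<^sup>+\<omega>. game_value \<eta> N ((\<lambda>j. f j (M j \<omega>))(i := g)) i \<partial>P)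
          \<le> (\<integral>\<^sup>+\<omega>. game_value \<eta> N (\<lambda>j. f j (M j \<omega>)) i \<partial>P))"

definition isometry_group :: "('a::metric_space \<Rightarrow> 'a) set \<Rightarrow> bool" where
  "isometry_group G \<longleftrightarrow>
     id \<in> G \<and> (\<forall>g\<in>G. \<forall>h\<in>G. g \<circ> h \<in> G) \<and> (\<forall>g\<in>G. inv g \<in> G) \<and>
     (\<forall>g\<in>G. bij g \<and> (\<forall>x y. dist (g x) (g y) = dist x y))"

definition acts_transitively :: "('a \<Rightarrow> 'a) set \<Rightarrow> bool" where
  "acts_transitively G \<longleftrightarrow> (\<forall>x y. \<exists>g\<in>G. g x = y)"

definition invariant_under :: "'a measure \<Rightarrow> ('a \<Rightarrow> 'a) set \<Rightarrow> bool" where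
  "invariant_under \<eta> G \<longleftrightarrow> (\<forall>g\<in>G. g \<in> \<eta> \<rightarrow>\<^sub>M \<eta> \<and> distr \<eta> \<eta> g = \<eta>)"

end

theory Submission
  imports Defs
begin

text \<open>Write $m = \eta(D)$, $R = \rho_1 + \dots + \rho_N$ and $v_i = \rho_i m (1 - e^{-R}) / R$. Everything
follows from two facts about the values.

First, the values of the players sum to at most $m (1 - e^{-R}) = v_1 + \dots + v_N$, whatever they
play: intensities without atoms give almost surely a configuration without multiple points, the open
Voronoi cells of distinct points are disjoint, and there is a point at all only with probability
$1 - e^{-R}$ (\<open>sum_game_value_le\<close>).

Second, a player \<open>i\<close> who plays the constant density guarantees $v_i$, and gets strictly more
unless the sum $F$ of the other players' actions is a multiple of $\eta$. Transitivity enters here: all balls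
of a given radius have the same measure, and because spheres are null the radius can be
replaced by the parameter $t \in [0,1]$ for which the ball, of radius \<open>rad t\<close>, has measure $t m$. A location
$z$ is won by player \<open>i\<close> at distance \<open>rad t\<close> with density $\rho_i e^{-\rho_i t - F(B(z, rad\ t))}$, so
\[ V_i \ge \int_D \int_0^1 \rho_i e^{-\rho_i t} e^{-F(B(z, rad\ t))}\, dt\, \eta(dz) \]
(\<open>game_value_ge\<close>). By invariance the mean over $z$ of $F(B(z, rad\ t))$ is $(R - \rho_i) t$, so Jensen's
inequality bounds the integral from below by $v_i$. Keeping the remainder of the tangent line of the
exponential gives $V_i \ge v_i + \mathit{excess}$ with an explicit nonnegative term
(\<open>game_value_ge_excess\<close>). It vanishes only if almost all balls have $F$-measure proportional to
their $\eta$-measure, and averaging over small balls then shows that $F$ is proportional to $\eta$ on all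
Borel sets (\<open>uniform_of_cball_measures\<close>).

If the opponents of a deviating player stay with the constant densities, they keep their $v_j$, so the
deviator is left with at most $v_i$: the constant densities are an equilibrium. Conversely, in any
equilibrium player \<open>i\<close> earns at least what the constant density would earn, that is $v_i$ plus the expected
excess. Summing over \<open>i\<close>, the expected excesses all vanish, so almost surely each of the sums of $N - 1$
actions is proportional to $\eta$, and therefore each action is (\<open>uniform_of_no_excess\<close>).

Spheres are null because $\eta$ is non-conflicting: a Poisson configuration consists with positive
probability of two points, and invariance would turn a sphere of positive measure into a
positive chance that these two points tie on a set of positive measure.\<close>

section \<open>Counting points of configurations\<close>

lemma points_in_empty [simp]: "points_in B {#} = 0"
  by (simp add: points_in_def)

lemma points_in_add_mset [simp]:
  "points_in B (add_mset x \<phi>) = (if x \<in> B then 1 else 0) + points_in B \<phi>"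
  by (simp add: points_in_def)

lemma space_configurations [simp]: "space configurations = UNIV"
  by (simp add: configurations_def space_measure_of_conv)

lemma sets_configurations:
  "sets configurations = sigma_sets UNIV {{\<phi>. points_in B \<phi> = n} | B n. B \<in> sets borel}"
  by (simp add: configurations_def)

lemma measurable_points_in [measurable]:
  assumes "B \<in> sets borel"
  shows "points_in B \<in> configurations \<rightarrow>\<^sub>M count_space UNIV"
  using assms by (auto simp: measurable_count_space_eq_countable sets_configurations vimage_def
      intro!: sigma_sets.Basic)

lemma measurable_into_configurations:
  assumes "\<And>B. B \<in> sets borel \<Longrightarrow> (\<lambda>\<omega>. points_in B (X \<omega>)) \<in> M \<rightarrow>\<^sub>M count_space UNIV"
  shows "X \<in> M \<rightarrow>\<^sub>M configurations"
proof (rule measurable_sigma_sets[OF sets_configurations])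
  fix A assume "A \<in> {{\<phi>. points_in B \<phi> = n} | B n. B \<in> sets (borel :: 'a measure)}"
  then obtain B n where A: "A = {\<phi>. points_in B \<phi> = n}" and B: "B \<in> sets borel" by blast
  have "(\<lambda>\<omega>. points_in B (X \<omega>)) -` {n} \<inter> space M \<in> sets M"
    by (rule measurable_sets[OF assms[OF B]]) simp
  also have "(\<lambda>\<omega>. points_in B (X \<omega>)) -` {n} \<inter> space M = X -` A \<inter> space M"
    by (auto simp: A)
  finally show "X -` A \<inter> space M \<in> sets M" .
qed auto

lemma points_in_mset: "points_in B (mset xs) = count_list (map (\<lambda>x. x \<in> B) xs) True"
  by (induction xs) auto

section \<open>Existence and uniqueness of the Poisson law\<close>

text \<open>The multinomial distribution, for an infinite sequence of independent points whose colours are read off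
the first $n$ entries. Conditioning on the first point reduces $v$ at its colour by one; the
contributions of the colours add up because $\sum_i v_i = n + 1$.\<close>

lemma (in prob_space) prob_stream_colour_counts:
  fixes c :: "'a \<Rightarrow> nat"
  assumes fin: "finite I" and cI: "\<And>x. x \<in> space M \<Longrightarrow> c x \<in> I"
    and [measurable]: "c \<in> M \<rightarrow>\<^sub>M count_space UNIV"
  shows "measure (stream_space M)
           {\<omega> \<in> space (stream_space M). \<forall>i\<in>I. count_list (stake n (smap c \<omega>)) i = v i}
         = (if (\<Sum>i\<in>I. v i) = n
            then fact n * (\<Prod>i\<in>I. prob {x \<in> space M. c x = i} ^ v i / fact (v i)) else 0)"
proof (induction n arbitrary: v)
  case 0
  interpret S: prob_space "stream_space M" by (rule prob_space_stream_space)
  show ?case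
  proof (cases "\<forall>i\<in>I. v i = 0")
    case True
    then show ?thesis using S.prob_space fin by simp
  next
    case False
    then have "{\<omega> \<in> space (stream_space M). \<forall>i\<in>I. count_list (stake 0 (smap c \<omega>)) i = v i} = {}"
      by auto
    moreover have "(\<Sum>i\<in>I. v i) \<noteq> 0" using False fin by auto
    ultimately show ?thesis by (simp only: measure_empty if_False)
  qed
next
  case (Suc n)
  interpret S: prob_space "stream_space M" by (rule prob_space_stream_space)
  let ?p = "\<lambda>i. prob {x \<in> space M. c x = i}"
  let ?E = "\<lambda>n v. {\<omega> \<in> space (stream_space M). \<forall>i\<in>I. count_list (stake n (smap c \<omega>)) i = v i}"
  have E[measurable]: "?E n v \<in> sets (stream_space M)" for n and v :: "nat \<Rightarrow> nat"
    using fin by measurable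
  \<comment> \<open>The probability of completing the counts if the first point has colour \<open>i\<close>.\<close>
  define G where "G i = (if v i > 0 then measure (stream_space M) (?E n (v(i := v i - 1))) else 0)" for i
  have G0: "G i \<ge> 0" for i by (simp add: G_def)
  have "ennreal (measure (stream_space M) (?E (Suc n) v))
     = (\<integral>\<^sup>+t. measure (stream_space M)
          {\<omega> \<in> space (stream_space M). \<forall>i\<in>I. count_list (stake (Suc n) (smap c (t ## \<omega>))) i = v i} \<partial>M)"
    by (rule prob_stream_space) (rule E)
  also have "\<dots> = (\<integral>\<^sup>+t. (\<Sum>i\<in>I. ennreal (G i) * indicator {x \<in> space M. c x = i} t) \<partial>M)"
  proof (rule nn_integral_cong)
    fix t assume t: "t \<in> space M"
    have "(\<Sum>i\<in>I. ennreal (G i) * indicator {x \<in> space M. c x = i} t) = (\<Sum>i\<in>I. if i = c t then ennreal (G i) else 0)"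
      using t by (intro sum.cong) (auto simp: indicator_def)
    also have "\<dots> = G (c t)" using fin cI[OF t] by simp
    also have "G (c t) = measure (stream_space M)
          {\<omega> \<in> space (stream_space M). \<forall>i\<in>I. count_list (stake (Suc n) (smap c (t ## \<omega>))) i = v i}"
    proof (cases "v (c t) > 0")
      case True
      then show ?thesis unfolding G_def using cI[OF t]
        by (auto intro!: arg_cong[where f = "measure _"])
    next
      case False
      then have "{\<omega> \<in> space (stream_space M). \<forall>i\<in>I. count_list (stake (Suc n) (smap c (t ## \<omega>))) i = v i} = {}"
        using cI[OF t] by (auto intro!: bexI[of _ "c t"])
      then show ?thesis using False by (simp only: G_def measure_empty if_False)
    qed
    finally show "ennreal (measure (stream_space M)
          {\<omega> \<in> space (stream_space M). \<forall>i\<in>I. count_list (stake (Suc n) (smap c (t ## \<omega>))) i = v i})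
      = (\<Sum>i\<in>I. ennreal (G i) * indicator {x \<in> space M. c x = i} t)" by simp
  qed
  also have "\<dots> = (\<Sum>i\<in>I. ennreal (G i) * emeasure M {x \<in> space M. c x = i})"
    by (subst nn_integral_sum) (simp_all add: nn_integral_cmult_indicator)
  also have "\<dots> = ennreal (\<Sum>i\<in>I. G i * ?p i)"
    by (simp add: emeasure_eq_measure ennreal_mult[symmetric] G0 sum_nonneg)
  finally have "measure (stream_space M) (?E (Suc n) v) = (\<Sum>i\<in>I. G i * ?p i)"
    by (subst (asm) ennreal_inj) (auto intro!: sum_nonneg mult_nonneg_nonneg G0)
  also have "\<dots> = (\<Sum>i\<in>I. if (\<Sum>j\<in>I. v j) = Suc n
      then fact n * (\<Prod>j\<in>I. ?p j ^ v j / fact (v j)) * v i else 0)"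
  proof (rule sum.cong[OF refl])
    fix i assume i: "i \<in> I"
    show "G i * ?p i = (if (\<Sum>j\<in>I. v j) = Suc n
      then fact n * (\<Prod>j\<in>I. ?p j ^ v j / fact (v j)) * v i else 0)"
    proof (cases "v i > 0")
      case False then show ?thesis by (simp add: G_def)
    next
      case True
      let ?v = "v(i := v i - 1)"
      have s: "(\<Sum>j\<in>I. v j) = Suc (\<Sum>j\<in>I. ?v j)"
        using True by (simp add: sum.remove[OF fin i])
      have p: "(\<Prod>j\<in>I. ?p j ^ ?v j / fact (?v j)) * ?p i = (\<Prod>j\<in>I. ?p j ^ v j / fact (v j)) * v i"
      proof -
        obtain k where k: "v i = Suc k" using True gr0_implies_Suc by blast
        have "?p i ^ k / fact k * ?p i = ?p i ^ Suc k / fact (Suc k) * real (Suc k)"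
          by (simp add: field_simps del: of_nat_Suc)
        then show ?thesis
          by (simp add: prod.remove[OF fin i] k) (simp add: field_simps)?
      qed
      show ?thesis using True s p unfolding G_def Suc.IH by simp
    qed
  qed
  also have "\<dots> = (if (\<Sum>j\<in>I. v j) = Suc n
      then fact (Suc n) * (\<Prod>j\<in>I. ?p j ^ v j / fact (v j)) else 0)"
    by (auto simp: sum_distrib_left[symmetric] of_nat_sum[symmetric] simp del: of_nat_sum)
  finally show ?case .
qed

text \<open>A Poisson number of independent points distributed according to the normalized intensity.\<close>

definition poisson_sample :: "'a::topological_space measure \<Rightarrow> 'a multiset measure" where
  "poisson_sample \<mu> =
     distr (measure_pmf (poisson_pmf (measure \<mu> UNIV)) \<Otimes>\<^sub>M stream_space (uniform_measure \<mu> UNIV))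
       configurations (\<lambda>(n, \<omega>). mset (stake n \<omega>))"

lemma measurable_mset_stake:
  fixes X :: "'a::topological_space measure"
  assumes "sets X = sets borel"
  shows "(\<lambda>(n, \<omega>). mset (stake n \<omega>)) \<in> measure_pmf p \<Otimes>\<^sub>M stream_space X \<rightarrow>\<^sub>M configurations"
proof (rule measurable_into_configurations)
  fix B :: "'a set" assume "B \<in> sets borel"
  then have [measurable]: "B \<in> sets X" using assms by simp
  have [measurable]: "(\<lambda>x. x \<in> B) \<in> X \<rightarrow>\<^sub>M count_space UNIV" by simp
  have "(\<lambda>(n, \<omega>). points_in B (mset (stake n \<omega>)))
      = (\<lambda>(n, \<omega>). count_list (stake n (smap (\<lambda>x. x \<in> B) \<omega>)) True)"
    by (auto simp: fun_eq_iff points_in_mset)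
  also have "\<dots> \<in> measure_pmf p \<Otimes>\<^sub>M stream_space X \<rightarrow>\<^sub>M count_space UNIV"
    unfolding measurable_cong_sets[OF sets_pair_measure_cong[OF sets_measure_pmf_count_space refl] refl]
  proof (rule measurable_pair_measure_countable1)
    fix n
    show "(\<lambda>\<omega>. case (n, \<omega>) of (n, \<omega>) \<Rightarrow> count_list (stake n (smap (\<lambda>x. x \<in> B) \<omega>)) True)
        \<in> stream_space X \<rightarrow>\<^sub>M count_space UNIV"
      unfolding prod.case by measurable
  qed simp_all
  finally show "(\<lambda>\<omega>. points_in B (case \<omega> of (n, \<omega>) \<Rightarrow> mset (stake n \<omega>)))
      \<in> measure_pmf p \<Otimes>\<^sub>M stream_space X \<rightarrow>\<^sub>M count_space UNIV"
    by (simp add: case_prod_unfold)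
qed

lemma count_list_colours:
  assumes "\<And>x. c x = j \<longleftrightarrow> x \<in> B"
  shows "count_list (stake n (smap c \<omega>)) j = points_in B (mset (stake n \<omega>))"
proof -
  have "count_list (map c xs) j = points_in B (mset xs)" for xs
    using assms by (induction xs) auto
  then show ?thesis by simp
qed

text \<open>Given the number $n$ of points, the counts are multinomial once the complement of the sets $B_j$ is added as one more colour;
summing over $n$ amounts to summing the exponential series over the number of points in the complement.\<close>

lemma measure_poisson_sample_counts:
  fixes \<mu> :: "'a::topological_space measure" and B :: "nat \<Rightarrow> 'a set"
  assumes fm: "finite_measure \<mu>" and sets: "sets \<mu> = sets borel" and pos: "0 < measure \<mu> UNIV"
    and fin: "finite J" and B: "\<And>j. j \<in> J \<Longrightarrow> B j \<in> sets borel" and disj: "disjoint_family_on B J"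
  shows "measure (poisson_sample \<mu>) {\<phi>. \<forall>j\<in>J. points_in (B j) \<phi> = v j}
         = (\<Prod>j\<in>J. exp (- measure \<mu> (B j)) * measure \<mu> (B j) ^ v j / fact (v j))"
proof -
  interpret \<mu>: finite_measure \<mu> by fact
  have sp: "space \<mu> = UNIV" using sets_eq_imp_space_eq[OF sets] by simp
  define a where "a = measure \<mu> UNIV"
  have a: "a > 0" using pos by (simp add: a_def)
  define X where "X = uniform_measure \<mu> UNIV"
  have em: "emeasure \<mu> UNIV \<noteq> 0" "emeasure \<mu> UNIV \<noteq> \<infinity>"
    using pos by (auto simp: measure_def)
  interpret X: prob_space X unfolding X_def by (rule prob_space_uniform_measure) (use em in auto)
  interpret S: prob_space "stream_space X" by (rule X.prob_space_stream_space)
  have sX[measurable_cong]: "sets X = sets borel" by (simp add: X_def sets)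
  have spX: "space X = UNIV" by (simp add: X_def sp)
  have Xm: "measure X A = measure \<mu> A / a" if "A \<in> sets borel" for A
    unfolding X_def a_def using that em by (subst measure_uniform_measure) (auto simp: sets)
  \<comment> \<open>The colour of the points outside all the \<open>B j\<close>.\<close>
  obtain k where k: "k \<notin> J" using fin ex_new_if_finite by auto
  define c where "c x = (if \<exists>j\<in>J. x \<in> B j then THE j. j \<in> J \<and> x \<in> B j else k)" for x
  have cB: "c x = j \<longleftrightarrow> x \<in> B j" if "j \<in> J" for x j
  proof -
    have *: "c x = i" if "i \<in> J" "x \<in> B i" for i
    proof -
      have "(THE j. j \<in> J \<and> x \<in> B j) = i"
        using that disj by (intro the_equality) (auto simp: disjoint_family_on_def)
      then show ?thesis using that by (auto simp: c_def)
    qed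
    show ?thesis
    proof
      assume "x \<in> B j" then show "c x = j" using * that by blast
    next
      assume cx: "c x = j"
      then have "\<exists>i\<in>J. x \<in> B i" using that k by (auto simp: c_def split: if_splits)
      then show "x \<in> B j" using * cx by blast
    qed
  qed
  have ck: "c x = k \<longleftrightarrow> x \<notin> (\<Union>j\<in>J. B j)" for x
    using k cB by (force simp: c_def)
  have cI: "c x \<in> insert k J" for x
    using cB[of _ x] ck[of x] by blast
  define Bk where "Bk = UNIV - (\<Union>j\<in>J. B j)"
  have Bk: "Bk \<in> sets borel" unfolding Bk_def using fin B by (intro sets.Diff sets.finite_UN) auto
  have cm[measurable]: "c \<in> X \<rightarrow>\<^sub>M count_space UNIV"
  proof -
    have "c -` {i} \<in> sets borel" for i
    proof (cases "i \<in> insert k J")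
      case True
      then have "c -` {i} = (if i = k then Bk else B i)"
        using cB ck by (auto simp: Bk_def)
      then show ?thesis using Bk B True by auto
    next
      case False
      then have "c -` {i} = {}" using cI by force
      then show ?thesis by simp
    qed
    then show ?thesis by (auto simp: measurable_count_space_eq_countable spX sX)
  qed
  define s where "s = (\<Sum>j\<in>J. v j)"
  define C where "C = exp (- a) * (\<Prod>j\<in>J. measure \<mu> (B j) ^ v j / fact (v j))"
  have C0: "C \<ge> 0" by (simp add: C_def prod_nonneg)
  define E where "E n = {\<omega> \<in> space (stream_space X). \<forall>j\<in>J. count_list (stake n (smap c \<omega>)) j = v j}" for n
  have E_sets: "E n \<in> sets (stream_space X)" for n unfolding E_def using fin by measurable
  have total: "(\<Sum>i\<in>insert k J. count_list (stake n (smap c \<omega>)) i) = n" for n \<omega>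
    using fin cI by (subst sum_count_set) auto
  have E_meas: "pmf (poisson_pmf a) n * measure (stream_space X) (E n)
      = (if n < s then 0 else C * (measure \<mu> Bk ^ (n - s) / fact (n - s)))" for n
  proof (cases "n < s")
    case True
    have "E n = {}"
    proof -
      have "False" if "\<omega> \<in> E n" for \<omega>
      proof -
        have "(\<Sum>j\<in>J. count_list (stake n (smap c \<omega>)) j) = s"
          using that by (simp add: E_def s_def)
        then show False using total[of n \<omega>] True fin k by simp
      qed
      then show ?thesis by blast
    qed
    then show ?thesis using True by simp
  next
    case False
    let ?v = "v(k := n - s)"
    have sv: "(\<Sum>j\<in>J. ?v j) = s" using k by (auto simp: s_def intro!: sum.cong)
    have "(\<forall>j\<in>J. f j = v j) \<longleftrightarrow> (\<forall>i\<in>insert k J. f i = ?v i)"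
      if tot: "(\<Sum>i\<in>insert k J. f i) = n" for f :: "nat \<Rightarrow> nat"
    proof
      assume h: "\<forall>j\<in>J. f j = v j"
      then have "(\<Sum>j\<in>J. f j) = s" by (simp add: s_def)
      then have "f k = n - s" using tot fin k by simp
      then show "\<forall>i\<in>insert k J. f i = ?v i" using h k by simp
    next
      assume h: "\<forall>i\<in>insert k J. f i = ?v i"
      show "\<forall>j\<in>J. f j = v j"
      proof
        fix j assume "j \<in> J"
        with h k show "f j = v j" by (metis fun_upd_other insertCI)
      qed
    qed
    from this[OF total]
    have En: "E n = {\<omega> \<in> space (stream_space X). \<forall>i\<in>insert k J. count_list (stake n (smap c \<omega>)) i = ?v i}"
      unfolding E_def by simp
    have "measure (stream_space X) (E n)
       = (if (\<Sum>i\<in>insert k J. ?v i) = n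
          then fact n * (\<Prod>i\<in>insert k J. X.prob {x \<in> space X. c x = i} ^ ?v i / fact (?v i)) else 0)"
      unfolding En by (rule X.prob_stream_colour_counts) (use fin cI in auto)
    also have "(\<Sum>i\<in>insert k J. ?v i) = n" using False fin k sv by simp
    also have "(\<Prod>i\<in>insert k J. X.prob {x \<in> space X. c x = i} ^ ?v i / fact (?v i))
       = (measure \<mu> Bk / a) ^ (n - s) / fact (n - s) * (\<Prod>j\<in>J. (measure \<mu> (B j) / a) ^ v j / fact (v j))"
    proof -
      have "X.prob {x \<in> space X. c x = k} = measure \<mu> Bk / a"
        using Xm[OF Bk] by (simp add: spX ck Bk_def set_diff_eq)
      moreover have "X.prob {x \<in> space X. c x = j} = measure \<mu> (B j) / a" if "j \<in> J" for j
        using Xm[OF B[OF that]] by (simp add: spX cB that)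
      moreover have "?v j = v j" if "j \<in> J" for j using k that by auto
      ultimately show ?thesis using fin k by simp
    qed
    also have "(\<Prod>j\<in>J. (measure \<mu> (B j) / a) ^ v j / fact (v j))
       = (\<Prod>j\<in>J. measure \<mu> (B j) ^ v j / fact (v j)) / a ^ s"
      by (simp add: s_def power_sum power_divide prod_dividef prod.distrib field_simps)
    finally have "measure (stream_space X) (E n) = fact n * ((measure \<mu> Bk / a) ^ (n - s) / fact (n - s) *
        ((\<Prod>j\<in>J. measure \<mu> (B j) ^ v j / fact (v j)) / a ^ s))" by simp
    moreover have "a ^ n = a ^ (n - s) * a ^ s" using False by (simp add: power_add[symmetric])
    ultimately show ?thesis using False a
      by (simp add: pmf_poisson[OF a] C_def power_divide field_simps)
  qed
  let ?P = "measure_pmf (poisson_pmf a) \<Otimes>\<^sub>M stream_space X"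
  let ?A = "{\<phi>. \<forall>j\<in>J. points_in (B j) \<phi> = v j}"
  have A: "?A \<in> sets configurations"
  proof -
    have [measurable]: "points_in (B j) \<in> configurations \<rightarrow>\<^sub>M count_space UNIV" if "j \<in> J" for j
      using B[OF that] by measurable
    have "{\<phi> \<in> space configurations. \<forall>j\<in>J. points_in (B j) \<phi> = v j} \<in> sets configurations"
      using fin by measurable
    then show ?thesis by simp
  qed
  have cl: "count_list (stake n (smap c \<omega>)) j = points_in (B j) (mset (stake n \<omega>))" if "j \<in> J" for n \<omega> j
    by (rule count_list_colours) (rule cB[OF that])
  have "emeasure (poisson_sample \<mu>) ?A = emeasure ?P ((\<lambda>(n, \<omega>). mset (stake n \<omega>)) -` ?A \<inter> space ?P)"
    unfolding poisson_sample_def a_def[symmetric] X_def[symmetric]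
    by (rule emeasure_distr[OF measurable_mset_stake[OF sX] A])
  also have "\<dots> = (\<integral>\<^sup>+n. emeasure (stream_space X) (E n) \<partial>measure_pmf (poisson_pmf a))"
  proof (subst S.emeasure_pair_measure_alt)
    show "(\<lambda>(n, \<omega>). mset (stake n \<omega>)) -` ?A \<inter> space ?P \<in> sets ?P"
      by (rule measurable_sets[OF measurable_mset_stake[OF sX] A])
  next
    have E_pts: "E n = {\<omega> \<in> space (stream_space X). \<forall>j\<in>J. points_in (B j) (mset (stake n \<omega>)) = v j}" for n
      unfolding E_def by (intro Collect_cong conj_cong ball_cong refl) (simp only: cl)
    have "Pair n -` ((\<lambda>(n, \<omega>). mset (stake n \<omega>)) -` ?A \<inter> space ?P) = E n" for n
      unfolding E_pts by (auto simp: space_pair_measure)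
    then show "(\<integral>\<^sup>+n. emeasure (stream_space X) (Pair n -` ((\<lambda>(n, \<omega>). mset (stake n \<omega>)) -` ?A \<inter> space ?P))
          \<partial>measure_pmf (poisson_pmf a))
        = (\<integral>\<^sup>+n. emeasure (stream_space X) (E n) \<partial>measure_pmf (poisson_pmf a))"
      by (simp only:)
  qed
  also have "\<dots> = (\<Sum>n. ennreal (pmf (poisson_pmf a) n * measure (stream_space X) (E n)))"
    by (simp add: nn_integral_measure_pmf nn_integral_count_space_nat ennreal_mult S.emeasure_eq_measure)
  also have "\<dots> = ennreal (C * exp (measure \<mu> Bk))"
  proof (rule suminf_ennreal_eq)
    let ?f = "\<lambda>n. pmf (poisson_pmf a) n * measure (stream_space X) (E n)"
    show "\<And>n. 0 \<le> ?f n" by simp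
    have "(\<lambda>n. measure \<mu> Bk ^ n / fact n) sums exp (measure \<mu> Bk)"
      using exp_converges[of "measure \<mu> Bk"] by (simp add: divide_inverse mult.commute)
    then have "(\<lambda>n. C * (measure \<mu> Bk ^ n / fact n)) sums (C * exp (measure \<mu> Bk))"
      by (rule sums_mult)
    then have "(\<lambda>n. ?f (n + s)) sums (C * exp (measure \<mu> Bk))"
      by (simp add: E_meas del: pmf_poisson)
    then show "?f sums (C * exp (measure \<mu> Bk))"
      using sums_zero_iff_shift[of s ?f "C * exp (measure \<mu> Bk)"] by (auto simp: E_meas)
  qed
  finally have 1: "measure (poisson_sample \<mu>) ?A = C * exp (measure \<mu> Bk)"
    using C0 by (simp add: measure_def)
  have "measure \<mu> Bk = a - (\<Sum>j\<in>J. measure \<mu> (B j))"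
  proof -
    have "measure \<mu> Bk = measure \<mu> (space \<mu>) - measure \<mu> (\<Union>j\<in>J. B j)"
      unfolding Bk_def sp[symmetric] using fin B by (intro \<mu>.finite_measure_compl) (auto simp: sets)
    then show ?thesis
      using \<mu>.finite_measure_finite_Union[OF fin _ disj] B by (auto simp: sets a_def sp image_subset_iff)
  qed
  then have "exp (- a) * exp (measure \<mu> Bk) = exp (\<Sum>j\<in>J. - measure \<mu> (B j))"
    by (simp add: exp_add[symmetric] sum_negf)
  also have "\<dots> = (\<Prod>j\<in>J. exp (- measure \<mu> (B j)))" by (simp add: exp_sum fin)
  finally have e: "exp (- a) * exp (measure \<mu> Bk) = (\<Prod>j\<in>J. exp (- measure \<mu> (B j)))" .
  have "C * exp (measure \<mu> Bk)
      = (exp (- a) * exp (measure \<mu> Bk)) * (\<Prod>j\<in>J. measure \<mu> (B j) ^ v j / fact (v j))"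
    by (simp only: C_def mult_ac)
  also have "\<dots> = (\<Prod>j\<in>J. exp (- measure \<mu> (B j)) * (measure \<mu> (B j) ^ v j / fact (v j)))"
    by (simp only: e prod.distrib)
  finally show ?thesis by (simp add: 1)
qed

lemma sets_poisson_sample [simp]: "sets (poisson_sample \<mu>) = sets configurations"
  by (simp add: poisson_sample_def)

lemma space_poisson_sample [simp]: "space (poisson_sample \<mu>) = UNIV"
  by (simp add: poisson_sample_def)

lemma prob_space_poisson_sample:
  fixes \<mu> :: "'a::topological_space measure"
  assumes "finite_measure \<mu>" and sets: "sets \<mu> = sets borel" and pos: "0 < measure \<mu> UNIV"
  shows "prob_space (poisson_sample \<mu>)"
proof -
  interpret X: prob_space "uniform_measure \<mu> UNIV"
    by (rule prob_space_uniform_measure) (use pos in \<open>auto simp: measure_def\<close>)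
  interpret S: prob_space "stream_space (uniform_measure \<mu> UNIV)" by (rule X.prob_space_stream_space)
  interpret P: pair_prob_space "measure_pmf (poisson_pmf (measure \<mu> UNIV))" "stream_space (uniform_measure \<mu> UNIV)" ..
  show ?thesis unfolding poisson_sample_def
    by (rule P.prob_space_distr) (rule measurable_mset_stake, simp add: sets)
qed

text \<open>The joint law of the counts on disjoint sets factorizes, and the level sets of a count, together with the empty
set, are an intersection-stable generator of its $\sigma$-algebra.\<close>

lemma poisson_process_poisson_sample:
  fixes \<mu> :: "'a::topological_space measure"
  assumes fm: "finite_measure \<mu>" and sets: "sets \<mu> = sets borel" and pos: "0 < measure \<mu> UNIV"
  shows "poisson_process (poisson_sample \<mu>) (\<lambda>\<phi>. \<phi>) \<mu>"
proof -
  interpret Q: prob_space "poisson_sample \<mu>" by (rule prob_space_poisson_sample[OF assms])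
  note counts = measure_poisson_sample_counts[OF assms]
  have meas: "{\<phi>. points_in B \<phi> \<in> A} \<in> Q.events" if "B \<in> sets borel" for B :: "'a set" and A
    using measurable_sets[OF measurable_points_in[OF that], of A] by (simp add: vimage_def)
  have single: "measure (poisson_sample \<mu>) {\<phi>. points_in B \<phi> = n}
      = exp (- measure \<mu> B) * measure \<mu> B ^ n / fact n" if "B \<in> sets borel" for B n
    using counts[of "{0}" "\<lambda>_. B" "\<lambda>_. n"] that by (simp add: disjoint_family_on_def)
  have indep: "Q.indep_vars (\<lambda>_. count_space UNIV) (\<lambda>i \<phi>. points_in (B i) \<phi>) {..<k}"
    if B: "\<forall>i<k. B i \<in> sets borel" and disj: "disjoint_family_on B {..<k}" for k :: nat and B :: "nat \<Rightarrow> 'a set"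
  proof -
    let ?F = "\<lambda>i. insert {} (range (\<lambda>n. {\<phi>. points_in (B i) \<phi> = n}))"
    have F: "Q.indep_sets ?F {..<k}"
      unfolding Q.indep_sets_def
    proof (intro conjI ballI allI impI)
      fix i assume "i \<in> {..<k}"
      then show "?F i \<subseteq> Q.events" using meas[of "B i" "{_}"] B by auto
    next
      fix J E assume J: "J \<subseteq> {..<k}" "J \<noteq> {}" "finite J" and E: "E \<in> Pi J ?F"
      show "Q.prob (\<Inter>j\<in>J. E j) = (\<Prod>j\<in>J. Q.prob (E j))"
      proof (cases "\<exists>j\<in>J. E j = {}")
        case True
        then obtain j where j: "j \<in> J" "E j = {}" by blast
        then have "(\<Inter>j\<in>J. E j) = {}" by blast
        moreover have "(\<Prod>j\<in>J. Q.prob (E j)) = 0"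
          by (rule prod_zero[OF J(3)]) (use j in \<open>auto intro!: bexI[of _ j]\<close>)
        ultimately show ?thesis by simp
      next
        case False
        have "\<exists>n. E j = {\<phi>. points_in (B j) \<phi> = n}" if "j \<in> J" for j
          using Pi_mem[OF E that] False that by auto
        then have "\<forall>j\<in>J. \<exists>n. E j = {\<phi>. points_in (B j) \<phi> = n}" by blast
        from bchoice[OF this] obtain v
          where v: "\<And>j. j \<in> J \<Longrightarrow> E j = {\<phi>. points_in (B j) \<phi> = v j}" by blast
        have BJ: "B j \<in> sets borel" if "j \<in> J" for j using J(1) B that by auto
        have dJ: "disjoint_family_on B J" using disj J(1) by (auto simp: disjoint_family_on_def)
        have "(\<Inter>j\<in>J. E j) = {\<phi>. \<forall>j\<in>J. points_in (B j) \<phi> = v j}" using v by auto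
        then show ?thesis using counts[OF J(3) BJ dJ, of v] v single[OF BJ] by simp
      qed
    qed
    have stable: "Int_stable (?F i)" for i
    proof (rule Int_stableI)
      fix a b assume "a \<in> ?F i" "b \<in> ?F i"
      moreover have "{\<phi>. points_in (B i) \<phi> = n} \<inter> {\<phi>. points_in (B i) \<phi> = m}
          = (if n = m then {\<phi>. points_in (B i) \<phi> = n} else {})" for n m by auto
      ultimately show "a \<inter> b \<in> ?F i" by (elim insertE imageE) simp_all
    qed
    have sub: "sigma_sets UNIV {points_in (B i) -` A |A. True} \<subseteq> sigma_sets UNIV (?F i)" for i
    proof (rule sigma_sets_mono, clarify)
      fix A
      have "points_in (B i) -` A = (\<Union>n\<in>A. {\<phi>. points_in (B i) \<phi> = n})" by auto
      also have "\<dots> \<in> sigma_sets UNIV (?F i)"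
        by (rule sigma_sets_UNION) (auto intro: sigma_sets.Basic)
      finally show "points_in (B i) -` A \<in> sigma_sets UNIV (?F i)" .
    qed
    have "Q.indep_sets (\<lambda>i. sigma_sets (space (poisson_sample \<mu>)) (?F i)) {..<k}"
      by (rule Q.indep_sets_sigma[OF F stable])
    then have "Q.indep_sets (\<lambda>i. sigma_sets UNIV {points_in (B i) -` A |A. True}) {..<k}"
      by (rule Q.indep_sets_mono_sets) (simp only: space_poisson_sample, rule sub)
    moreover have "points_in (B i) \<in> poisson_sample \<mu> \<rightarrow>\<^sub>M count_space UNIV" if "i \<in> {..<k}" for i
    proof -
      have "B i \<in> sets borel" using B that by simp
      from measurable_points_in[OF this] show ?thesis
        by (simp add: measurable_cong_sets[OF sets_poisson_sample refl])
    qed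
    ultimately show ?thesis by (simp add: Q.indep_vars_def)
  qed
  show ?thesis unfolding poisson_process_def
    using single indep Q.prob_space_axioms by (simp add: measurable_ident_sets)
qed

text \<open>The atoms of the algebra generated by $B_0, \dots, B_{k-1}$ are indexed by the sets $e_l$ of those $i$ for which
the atom lies in $B_i$. They reduce counts on overlapping sets to counts on disjoint ones, the only ones whose joint law is
prescribed by the definition of a Poisson process.\<close>

lemma points_in_atoms:
  fixes B :: "nat \<Rightarrow> 'a set" and K :: nat
  assumes e: "bij_betw e {..<K} (Pow {..<k})" and i: "i < k"
  shows "points_in (B i) \<phi>
    = (\<Sum>l | l < K \<and> i \<in> e l. points_in {x. \<forall>i<k. x \<in> B i \<longleftrightarrow> i \<in> e l} \<phi>)"
proof (induction \<phi>)
  case empty show ?case by simp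
next
  case (add x \<phi>)
  let ?c = "{i. i < k \<and> x \<in> B i}"
  let ?A = "\<lambda>l. {x. \<forall>i<k. x \<in> B i \<longleftrightarrow> i \<in> e l}"
  have "?c \<in> e ` {..<K}" unfolding bij_betw_imp_surj_on[OF e] by auto
  then obtain l0 where l0: "l0 < K" "e l0 = ?c" by auto
  have eq: "x \<in> ?A l \<longleftrightarrow> l = l0" if "l < K" for l
  proof
    assume h: "x \<in> ?A l"
    have "e l \<subseteq> {..<k}" using bij_betw_imp_surj_on[OF e] that by blast
    then have "e l = ?c" using h by blast
    then have "e l = e l0" by (simp only: l0(2))
    then show "l = l0"
      using inj_onD[OF bij_betw_imp_inj_on[OF e], of l l0] l0(1) that by simp
  next
    assume "l = l0"
    then show "x \<in> ?A l" by (simp only: l0(2) mem_Collect_eq) blast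
  qed
  let ?L = "{l. l < K \<and> i \<in> e l}"
  have "(\<Sum>l\<in>?L. points_in (?A l) (add_mset x \<phi>))
      = (\<Sum>l\<in>?L. (if l = l0 then 1 else 0) + points_in (?A l) \<phi>)"
  proof (rule sum.cong[OF refl])
    fix l assume "l \<in> ?L"
    then have "l < K" by simp
    then show "points_in (?A l) (add_mset x \<phi>) = (if l = l0 then 1 else 0) + points_in (?A l) \<phi>"
      by (simp only: points_in_add_mset eq)
  qed
  also have "\<dots> = (\<Sum>l\<in>?L. if l = l0 then 1 else 0) + points_in (B i) \<phi>"
    by (simp only: sum.distrib add.IH)
  also have "(\<Sum>l\<in>?L. if l = l0 then 1 else 0 :: nat) = (if l0 \<in> ?L then 1 else 0)"
    by (rule sum.delta) simp
  also have "l0 \<in> ?L \<longleftrightarrow> x \<in> B i" using l0(1) i by (simp only: l0(2) mem_Collect_eq) blast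
  finally show ?case by (simp only: points_in_add_mset)
qed

lemma poisson_process_counts_unique:
  fixes Q :: "'a::topological_space multiset measure" and B :: "nat \<Rightarrow> 'a set"
  assumes Q: "sets Q = sets configurations" "poisson_process Q (\<lambda>\<phi>. \<phi>) \<mu>"
    and Q': "sets Q' = sets configurations" "poisson_process Q' (\<lambda>\<phi>. \<phi>) \<mu>"
    and B: "\<And>i. i < k \<Longrightarrow> B i \<in> sets borel"
  shows "emeasure Q {\<phi>. \<forall>i<k. points_in (B i) \<phi> = n i}
       = emeasure Q' {\<phi>. \<forall>i<k. points_in (B i) \<phi> = n i}"
proof -
  define K where "K = card (Pow {..<k})"
  obtain e where e: "bij_betw e {..<K} (Pow {..<k})"
    unfolding K_def using ex_bij_betw_nat_finite[of "Pow {..<k}"] by (auto simp: atLeast0LessThan)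
  have K: "{..<K} \<noteq> {}" by (simp add: K_def card_Pow lessThan_empty_iff)
  define A where "A l = {x. \<forall>i<k. x \<in> B i \<longleftrightarrow> i \<in> e l}" for l
  have A: "A l \<in> sets borel" for l
  proof -
    let ?D = "\<lambda>i. if i < k then (if i \<in> e l then B i else - B i) else UNIV"
    have "?D i \<in> sets borel" for i using B[of i] by (cases "i < k") (simp_all add: borel_comp)
    then have "(\<Inter>i. ?D i) \<in> sets borel" by (intro sets.countable_INT'') simp_all
    also have "(\<Inter>i. ?D i) = A l"
      unfolding A_def by (intro set_eqI iffI) (force split: if_splits)+
    finally show ?thesis .
  qed
  have disj: "disjoint_family_on A {..<K}"
  proof -
    have "l = l'" if "l < K" "l' < K" "x \<in> A l" "x \<in> A l'" for l l' x
    proof -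
      have "e l \<subseteq> {..<k}" "e l' \<subseteq> {..<k}" using bij_betw_imp_surj_on[OF e] that by blast+
      then have "e l = e l'" using that(3,4) unfolding A_def by blast
      then show ?thesis
        using inj_onD[OF bij_betw_imp_inj_on[OF e], of l l'] that(1,2) by simp
    qed
    then show ?thesis unfolding disjoint_family_on_def lessThan_iff by blast
  qed
  let ?X = "\<lambda>\<phi>. \<lambda>l\<in>{..<K}. points_in (A l) \<phi>"
  let ?C = "\<Pi>\<^sub>M l\<in>{..<K}. count_space (UNIV :: nat set)"
  have law: "distr P ?C ?X = (\<Pi>\<^sub>M l\<in>{..<K}. distr P (count_space UNIV) (points_in (A l)))"
    and single: "distr P (count_space UNIV) (points_in (A l)) = density (count_space UNIV)
        (\<lambda>n. ennreal (exp (- measure \<mu> (A l)) * measure \<mu> (A l) ^ n / fact n))"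
    and meas: "?X \<in> P \<rightarrow>\<^sub>M ?C"
    if P: "sets P = sets configurations" "poisson_process P (\<lambda>\<phi>. \<phi>) \<mu>" for P l
  proof -
    interpret P: prob_space P using P(2) by (simp add: poisson_process_def)
    have sp: "space P = UNIV" using sets_eq_imp_space_eq[OF P(1)] by simp
    have rv: "points_in (A l) \<in> P \<rightarrow>\<^sub>M count_space UNIV" for l
      using measurable_points_in[OF A] by (simp add: measurable_cong_sets[OF P(1) refl])
    have "P.indep_vars (\<lambda>_. count_space UNIV) (\<lambda>l \<phi>. points_in (A l) \<phi>) {..<K}"
      using P(2) A disj by (simp add: poisson_process_def)
    then show "distr P ?C ?X = (\<Pi>\<^sub>M l\<in>{..<K}. distr P (count_space UNIV) (points_in (A l)))"
      using rv K by (subst (asm) P.indep_vars_iff_distr_eq_PiM') auto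
    show "distr P (count_space UNIV) (points_in (A l)) = density (count_space UNIV)
        (\<lambda>n. ennreal (exp (- measure \<mu> (A l)) * measure \<mu> (A l) ^ n / fact n))"
    proof (rule measure_eqI_countable[where A = UNIV])
      fix m
      have "emeasure (distr P (count_space UNIV) (points_in (A l))) {m}
          = P.prob {\<phi>. points_in (A l) \<phi> = m}"
        using rv by (simp add: emeasure_distr sp vimage_def P.emeasure_eq_measure)
      also have "\<dots> = exp (- measure \<mu> (A l)) * measure \<mu> (A l) ^ m / fact m"
        using P(2) A sp by (simp add: poisson_process_def)
      finally show "emeasure (distr P (count_space UNIV) (points_in (A l))) {m} = emeasure (density (count_space UNIV)
        (\<lambda>n. ennreal (exp (- measure \<mu> (A l)) * measure \<mu> (A l) ^ n / fact n))) {m}"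
        by (simp add: emeasure_density nn_integral_count_space_indicator[symmetric])
    qed auto
    show "?X \<in> P \<rightarrow>\<^sub>M ?C" by (intro measurable_restrict rv)
  qed
  define W where "W = {w \<in> space ?C. \<forall>i\<in>{..<k}. (\<Sum>l | l < K \<and> i \<in> e l. real (w l)) = real (n i)}"
  have W: "W \<in> sets ?C"
    unfolding W_def
  proof (rule sets.sets_Collect_finite_All)
    fix i
    have "(\<lambda>w. real (w l)) \<in> borel_measurable ?C" if "l < K" for l
      using that by (intro measurable_compose[OF measurable_component_singleton]) auto
    then have "(\<lambda>w. \<Sum>l | l < K \<and> i \<in> e l. real (w l)) \<in> borel_measurable ?C"
      by (intro borel_measurable_sum) simp
    from measurable_sets[OF this, of "{real (n i)}"]
    show "{w \<in> space ?C. (\<Sum>l | l < K \<and> i \<in> e l. real (w l)) = real (n i)} \<in> sets ?C"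
      by (simp add: vimage_def Int_def conj_commute)
  qed simp
  have "{\<phi>. \<forall>i<k. points_in (B i) \<phi> = n i} = ?X -` W \<inter> space P"
    if "sets P = sets configurations" for P
  proof -
    have sp: "space P = UNIV" using sets_eq_imp_space_eq[OF that] by simp
    have "?X \<phi> \<in> W \<longleftrightarrow> (\<forall>i<k. points_in (B i) \<phi> = n i)" for \<phi>
    proof -
      have sum: "(\<Sum>l | l < K \<and> i \<in> e l. real (?X \<phi> l)) = real (points_in (B i) \<phi>)" if "i \<in> {..<k}" for i
      proof -
        have "i < k" using that by simp
        then show ?thesis
          unfolding points_in_atoms[OF e \<open>i < k\<close>] A_def of_nat_sum by (intro sum.cong) simp_all
      qed
      have "?X \<phi> \<in> space ?C" by (simp add: space_PiM)
      then have "?X \<phi> \<in> W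
          \<longleftrightarrow> (\<forall>i\<in>{..<k}. (\<Sum>l | l < K \<and> i \<in> e l. real (?X \<phi> l)) = real (n i))"
        by (simp only: W_def mem_Collect_eq simp_thms)
      also have "\<dots> \<longleftrightarrow> (\<forall>i\<in>{..<k}. real (points_in (B i) \<phi>) = real (n i))"
        by (rule ball_cong[OF refl]) (simp only: sum)
      finally show ?thesis by (simp only: of_nat_eq_iff Ball_def lessThan_iff)
    qed
    then show ?thesis unfolding sp by (simp only: vimage_def Int_UNIV_right)
  qed
  note ev = this
  let ?D = "\<Pi>\<^sub>M l\<in>{..<K}. density (count_space UNIV)
        (\<lambda>n. ennreal (exp (- measure \<mu> (A l)) * measure \<mu> (A l) ^ n / fact n))"
  have count_law: "emeasure P {\<phi>. \<forall>i<k. points_in (B i) \<phi> = n i} = emeasure ?D W"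
    if P: "sets P = sets configurations" "poisson_process P (\<lambda>\<phi>. \<phi>) \<mu>" for P
  proof -
    have "emeasure P {\<phi>. \<forall>i<k. points_in (B i) \<phi> = n i} = emeasure (distr P ?C ?X) W"
      unfolding ev[OF P(1)] by (rule emeasure_distr[OF meas[OF P] W, symmetric])
    also have "distr P ?C ?X = ?D"
      unfolding law[OF P] by (intro PiM_cong refl single[OF P])
    finally show ?thesis .
  qed
  show ?thesis by (rule trans[OF count_law[OF Q] count_law[OF Q', symmetric]])
qed

text \<open>Events that prescribe the counts on finitely many sets form an intersection-stable generator.\<close>

lemma poisson_process_law_unique:
  fixes Q :: "'a::topological_space multiset measure"
  assumes Q: "sets Q = sets configurations" "poisson_process Q (\<lambda>\<phi>. \<phi>) \<mu>"
    and Q': "sets Q' = sets configurations" "poisson_process Q' (\<lambda>\<phi>. \<phi>) \<mu>"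
  shows "Q = Q'"
proof -
  interpret Q: prob_space Q using Q(2) by (simp add: poisson_process_def)
  define cyl :: "nat \<Rightarrow> (nat \<Rightarrow> 'a set) \<Rightarrow> (nat \<Rightarrow> nat) \<Rightarrow> 'a multiset set"
    where "cyl k B n = {\<phi>. \<forall>i<k. points_in (B i) \<phi> = n i}" for k B n
  define E where "E = {cyl k B n | k B n. \<forall>i<k. B i \<in> sets borel}"
  have EI: "cyl k B n \<in> E" if "\<And>i. i < k \<Longrightarrow> B i \<in> sets borel" for k B n
    using that unfolding E_def by blast
  have EE: thesis if "X \<in> E" "\<And>k B n. X = cyl k B n \<Longrightarrow> (\<And>i. i < k \<Longrightarrow> B i \<in> sets borel) \<Longrightarrow> thesis"
    for X thesis
    using that unfolding E_def by blast
  have univ: "UNIV \<in> E"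
    using EI[of 0] by (simp add: cyl_def)
  have gen: "sets configurations = sigma_sets UNIV E"
  proof (rule equalityI)
    show "sets configurations \<subseteq> sigma_sets UNIV E"
      unfolding sets_configurations
    proof (rule sigma_sets_mono, rule subsetI)
      fix X assume "X \<in> {{\<phi>. points_in B \<phi> = n} | B n. B \<in> sets (borel :: 'a measure)}"
      then obtain B :: "'a set" and n where X: "X = {\<phi>. points_in B \<phi> = n}" "B \<in> sets borel" by blast
      have "X = cyl 1 (\<lambda>_. B) (\<lambda>_. n)" by (simp add: X(1) cyl_def)
      then have "X \<in> E" using EI[of 1 "\<lambda>_. B"] X(2) by (simp only:)
      then show "X \<in> sigma_sets UNIV E" by (rule sigma_sets.Basic)
    qed
    have "X \<in> sets configurations" if "X \<in> E" for X
      using that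
    proof (rule EE)
      fix k n and B :: "nat \<Rightarrow> 'a set"
      assume X: "X = cyl k B n" and B: "\<And>i. i < k \<Longrightarrow> B i \<in> sets borel"
      have "{\<phi> \<in> space configurations. \<forall>i\<in>{..<k}. points_in (B i) \<phi> = n i} \<in> sets configurations"
      proof (rule sets.sets_Collect_finite_All)
        fix i assume "i \<in> {..<k}"
        then have "B i \<in> sets borel" using B by simp
        from measurable_sets[OF measurable_points_in[OF this], of "{n i}"]
        show "{\<phi> \<in> space configurations. points_in (B i) \<phi> = n i} \<in> sets configurations"
          by (simp add: vimage_def)
      qed simp
      then show "X \<in> sets configurations" by (simp add: X cyl_def Ball_def)
    qed
    then show "sigma_sets UNIV E \<subseteq> sets configurations"
      using sets.sigma_sets_subset[of E configurations] by auto
  qed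
  have "Int_stable E"
  proof (rule Int_stableI)
    fix X Y assume "X \<in> E" "Y \<in> E"
    from \<open>X \<in> E\<close> obtain k n and B :: "nat \<Rightarrow> 'a set"
      where X: "X = cyl k B n" "\<And>i. i < k \<Longrightarrow> B i \<in> sets borel" by (rule EE) blast
    from \<open>Y \<in> E\<close> obtain k' n' and B' :: "nat \<Rightarrow> 'a set"
      where Y: "Y = cyl k' B' n'" "\<And>i. i < k' \<Longrightarrow> B' i \<in> sets borel" by (rule EE) blast
    let ?B = "\<lambda>i. if i < k then B i else B' (i - k)" and ?n = "\<lambda>i. if i < k then n i else n' (i - k)"
    have split: "(\<forall>i<k + k'. P i) \<longleftrightarrow> (\<forall>i<k. P i) \<and> (\<forall>i<k'. P (k + i))" for P
    proof (intro iffI conjI allI impI)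
      fix i assume P: "(\<forall>i<k. P i) \<and> (\<forall>i<k'. P (k + i))" and i: "i < k + k'"
      show "P i"
      proof (cases "i < k")
        case False
        then have "i - k < k'" "k + (i - k) = i" using i by simp_all
        then show ?thesis using P by metis
      qed (use P in simp)
    qed simp_all
    have "X \<inter> Y = cyl (k + k') ?B ?n"
      unfolding X Y cyl_def split by (simp add: Collect_conj_eq)
    moreover have "?B i \<in> sets borel" if "i < k + k'" for i
      using X(2)[of i] Y(2)[of "i - k"] that by (cases "i < k") simp_all
    ultimately show "X \<inter> Y \<in> E" using EI[of "k + k'" ?B ?n] by (simp only:)
  qed
  then show ?thesis
  proof (rule measure_eqI_generator_eq[where \<Omega> = UNIV and A = "\<lambda>_::nat. UNIV"])
    fix X assume "X \<in> E"
    then show "emeasure Q X = emeasure Q' X"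
    proof (rule EE)
      fix k n and B :: "nat \<Rightarrow> 'a set"
      assume "X = cyl k B n" and B: "\<And>i. i < k \<Longrightarrow> B i \<in> sets borel"
      then show "emeasure Q X = emeasure Q' X"
        using poisson_process_counts_unique[OF Q Q' B] by (simp only: cyl_def)
    qed
  next
    show "sets Q = sigma_sets UNIV E" using Q(1) gen by (rule trans)
    show "sets Q' = sigma_sets UNIV E" using Q'(1) gen by (rule trans)
    show "range (\<lambda>_. UNIV) \<subseteq> E" using univ by blast
    show "E \<subseteq> Pow UNIV" by simp
    show "(\<Union>i::nat. UNIV :: 'a multiset set) = UNIV" by simp
    show "\<And>i. emeasure Q UNIV \<noteq> \<infinity>" by simp
  qed
qed

lemma poisson_law_eq_sample:
  fixes \<mu> :: "'a::topological_space measure"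
  assumes "finite_measure \<mu>" "sets \<mu> = sets borel" "0 < measure \<mu> UNIV"
  shows "poisson_law \<mu> = poisson_sample \<mu>"
  unfolding poisson_law_def
proof (rule the_equality)
  note sample = sets_poisson_sample poisson_process_poisson_sample[OF assms]
  then show "sets (poisson_sample \<mu>) = sets configurations \<and> poisson_process (poisson_sample \<mu>) (\<lambda>\<phi>. \<phi>) \<mu>"
    by blast
  fix Q assume "sets Q = sets configurations \<and> poisson_process Q (\<lambda>\<phi>. \<phi>) \<mu>"
  then show "Q = poisson_sample \<mu>" using poisson_process_law_unique sample by blast
qed

section \<open>Measurable dependence on configurations and actions\<close>

text \<open>A family of finite measures that is measurable on each Borel set measures the sections of a product set
measurably. Stated for additive set functions, so as to cover both the counts of a configuration and
the values of a random action.\<close>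

lemma borel_measurable_set_function_section:
  fixes k :: "'w \<Rightarrow> 'a::topological_space set \<Rightarrow> real"
  assumes meas: "\<And>B. B \<in> sets borel \<Longrightarrow> (\<lambda>\<omega>. k \<omega> B) \<in> borel_measurable \<Omega>"
    and compl: "\<And>\<omega> B. \<omega> \<in> space \<Omega> \<Longrightarrow> B \<in> sets borel \<Longrightarrow> k \<omega> (- B) = k \<omega> UNIV - k \<omega> B"
    and sums: "\<And>\<omega> (A :: nat \<Rightarrow> 'a set). \<omega> \<in> space \<Omega> \<Longrightarrow> range A \<subseteq> sets borel \<Longrightarrow> disjoint_family A
        \<Longrightarrow> (\<lambda>n. k \<omega> (A n)) sums k \<omega> (\<Union>n. A n)"
    and C: "C \<in> sets (borel \<Otimes>\<^sub>M N)"
  shows "(\<lambda>(\<omega>, y). k \<omega> {x. (x, y) \<in> C}) \<in> borel_measurable (\<Omega> \<Otimes>\<^sub>M N)"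
proof -
  have k_empty: "k \<omega> {} = 0" if "\<omega> \<in> space \<Omega>" for \<omega>
    using compl[OF that, of UNIV] by simp
  have sec: "{x. (x, y) \<in> C} \<in> sets borel" if "C \<in> sets (borel \<Otimes>\<^sub>M N)" for C y
    using sets_Pair2[OF that, of y] by (simp add: vimage_def)
  show ?thesis
    using Int_stable_pair_measure_generator pair_measure_closed C
    unfolding sets_pair_measure
  proof (induct rule: sigma_sets_induct_disjoint)
    case (basic A)
    then obtain a b where A: "A = a \<times> b" "a \<in> sets borel" "b \<in> sets N" by blast
    have "(\<lambda>(\<omega>, y). k \<omega> a * indicator b y) \<in> borel_measurable (\<Omega> \<Otimes>\<^sub>M N)"
    proof -
      have [measurable]: "(\<lambda>\<omega>. k \<omega> a) \<in> borel_measurable \<Omega>" using meas A by simp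
      have [measurable]: "b \<in> sets N" using A by simp
      show ?thesis by measurable
    qed
    then show ?case
      by (rule measurable_cong[THEN iffD1, rotated])
         (auto simp: space_pair_measure A k_empty indicator_def)
  next
    case empty
    have "(\<lambda>_. 0) \<in> borel_measurable (\<Omega> \<Otimes>\<^sub>M N)" by simp
    then show ?case
      by (rule measurable_cong[THEN iffD1, rotated]) (auto simp: space_pair_measure k_empty)
  next
    case (compl A)
    have A: "A \<in> sets (borel \<Otimes>\<^sub>M N)" using compl(1) by (simp add: sets_pair_measure)
    have "(\<lambda>p. k (fst p) UNIV - (\<lambda>(\<omega>, y). k \<omega> {x. (x, y) \<in> A}) p) \<in> borel_measurable (\<Omega> \<Otimes>\<^sub>M N)"
      using meas[of UNIV] by (intro borel_measurable_diff compl(2) measurable_compose[OF measurable_fst]) simp_all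
    then show ?case
    proof (rule measurable_cong[THEN iffD1, rotated])
      fix p assume p: "p \<in> space (\<Omega> \<Otimes>\<^sub>M N)"
      obtain \<omega> y where py: "p = (\<omega>, y)" by (cases p)
      have w: "\<omega> \<in> space \<Omega>" "y \<in> space N" using p by (simp_all add: py space_pair_measure)
      have "{x. (x, y) \<in> space borel \<times> space N - A} = - {x. (x, y) \<in> A}"
        using w by auto
      then show "k (fst p) UNIV - (\<lambda>(\<omega>, y). k \<omega> {x. (x, y) \<in> A}) p
          = (\<lambda>(\<omega>, y). k \<omega> {x. (x, y) \<in> space borel \<times> space N - A}) p"
        using assms(2)[OF w(1) sec[OF A]] by (simp add: py)
    qed
  next
    case (union A)
    have A: "A n \<in> sets (borel \<Otimes>\<^sub>M N)" for n using union(2) by (auto simp: sets_pair_measure)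
    show ?case
    proof (rule borel_measurable_LIMSEQ_real)
      show "(\<lambda>p. \<Sum>i<n. (\<lambda>(\<omega>, y). k \<omega> {x. (x, y) \<in> A i}) p) \<in> borel_measurable (\<Omega> \<Otimes>\<^sub>M N)" for n
        by (intro borel_measurable_sum union(3))
      fix p assume p: "p \<in> space (\<Omega> \<Otimes>\<^sub>M N)"
      obtain \<omega> y where py: "p = (\<omega>, y)" by (cases p)
      have w: "\<omega> \<in> space \<Omega>" using p by (simp add: py space_pair_measure)
      have "(\<lambda>n. k \<omega> {x. (x, y) \<in> A n}) sums k \<omega> (\<Union>n. {x. (x, y) \<in> A n})"
      proof (rule sums[OF w])
        show "range (\<lambda>n. {x. (x, y) \<in> A n}) \<subseteq> sets borel" using sec[OF A] by auto
        show "disjoint_family (\<lambda>n. {x. (x, y) \<in> A n})"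
          using union(1) unfolding disjoint_family_on_def by blast
      qed
      also have "(\<Union>n. {x. (x, y) \<in> A n}) = {x. (x, y) \<in> (\<Union>n. A n)}" by auto
      finally show "(\<lambda>n. \<Sum>i<n. (\<lambda>(\<omega>, y). k \<omega> {x. (x, y) \<in> A i}) p)
          \<longlonglongrightarrow> (\<lambda>(\<omega>, y). k \<omega> {x. (x, y) \<in> (\<Union>n. A n)}) p"
        by (simp add: py sums_def)
    qed
  qed
qed

lemma points_in_Compl: "points_in (- B) \<phi> + points_in B \<phi> = points_in UNIV \<phi>"
  by (induction \<phi>) auto

lemma sums_points_in:
  assumes "disjoint_family (A :: nat \<Rightarrow> 'a set)"
  shows "(\<lambda>n. real (points_in (A n) \<phi>)) sums real (points_in (\<Union>n. A n) \<phi>)"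
proof (induction \<phi>)
  case (add x \<phi>)
  have "(\<lambda>n. if x \<in> A n then 1 else 0 :: real) sums (if x \<in> (\<Union>n. A n) then 1 else 0)"
  proof (cases "x \<in> (\<Union>n. A n)")
    case True
    then obtain m where m: "x \<in> A m" by blast
    have "x \<in> A n \<longleftrightarrow> n = m" for n
      using m assms unfolding disjoint_family_on_def by blast
    then show ?thesis using True sums_single[of m "\<lambda>_. 1 :: real"] by simp
  qed simp
  from sums_add[OF this add.IH] show ?case
    by (simp add: if_distrib[of real] if_distribR cong: if_cong)
qed simp

lemma measurable_points_in_section:
  fixes C :: "('a::topological_space \<times> 'b) set"
  assumes "C \<in> sets (borel \<Otimes>\<^sub>M N)"
  shows "(\<lambda>(\<phi>, y). real (points_in {x. (x, y) \<in> C} \<phi>)) \<in> borel_measurable (configurations \<Otimes>\<^sub>M N)"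
proof (rule borel_measurable_set_function_section[OF _ _ _ assms])
  fix \<phi> :: "'a multiset" and B :: "'a set"
  have "real (points_in (- B) \<phi> + points_in B \<phi>) = real (points_in UNIV \<phi>)"
    by (simp only: points_in_Compl)
  then show "real (points_in (- B) \<phi>) = real (points_in UNIV \<phi>) - real (points_in B \<phi>)" by simp
next
  fix B :: "'a set" assume "B \<in> sets borel"
  from measurable_points_in[OF this] show "(\<lambda>\<phi>. real (points_in B \<phi>)) \<in> borel_measurable configurations"
    by (rule measurable_compose) simp
qed (rule sums_points_in)

lemma space_action_space:
  assumes "\<mu> \<in> space (action_space \<eta> r)"
  shows "\<mu> \<in> actions \<eta> r" "finite_measure \<mu>" "sets \<mu> = sets borel"
proof -
  have "\<mu> \<in> actions \<eta> r \<inter> topspace weak_topology"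
    using assms by (simp add: action_space_def borel_of_def space_measure_of_conv Int_commute)
  then show "\<mu> \<in> actions \<eta> r" "finite_measure \<mu>" "sets \<mu> = sets borel"
    by (auto simp: weak_topology_def)
qed

lemma borel_measurable_integral_action:
  fixes g :: "'a::topological_space \<Rightarrow> real"
  assumes g: "continuous_on UNIV g" "bounded (range g)"
  shows "(\<lambda>\<mu>. \<integral>x. g x \<partial>\<mu>) \<in> borel_measurable (action_space \<eta> r)"
proof (rule borel_measurableI)
  fix U :: "real set" assume U: "open U"
  let ?X = "subtopology weak_topology (actions \<eta> r)"
  let ?V = "{\<mu>. finite_measure \<mu> \<and> sets \<mu> = sets borel \<and> (\<integral>x. g x \<partial>\<mu>) \<in> U}"
  have sp: "space (action_space \<eta> r) = topspace ?X" by (simp add: action_space_def borel_of_def space_measure_of_conv)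
  have "{U. openin ?X U} \<subseteq> Pow (topspace ?X)" using openin_subset by blast
  then have sets_action_space: "sets (action_space \<eta> r) = sigma_sets (topspace ?X) {U. openin ?X U}"
    unfolding action_space_def borel_of_def by (rule sets_measure_of)
  have "openin weak_topology ?V"
    unfolding weak_topology_def by (rule topology_generated_by_Basis) (use g U in blast)
  then have "openin ?X (?V \<inter> actions \<eta> r)" by (auto simp: openin_subtopology)
  also have "?V \<inter> actions \<eta> r = (\<lambda>\<mu>. \<integral>x. g x \<partial>\<mu>) -` U \<inter> space (action_space \<eta> r)"
  proof (intro set_eqI iffI)
    fix \<mu> assume \<mu>: "\<mu> \<in> ?V \<inter> actions \<eta> r"
    then have "\<mu> \<in> topspace weak_topology" using \<open>openin weak_topology ?V\<close> openin_subset by fastforce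
    then show "\<mu> \<in> (\<lambda>\<mu>. \<integral>x. g x \<partial>\<mu>) -` U \<inter> space (action_space \<eta> r)"
      using \<mu> by (simp add: sp)
  next
    fix \<mu> assume "\<mu> \<in> (\<lambda>\<mu>. \<integral>x. g x \<partial>\<mu>) -` U \<inter> space (action_space \<eta> r)"
    then show "\<mu> \<in> ?V \<inter> actions \<eta> r" using space_action_space[of \<mu> \<eta> r] by simp
  qed
  finally show "(\<lambda>\<mu>. \<integral>x. g x \<partial>\<mu>) -` U \<inter> space (action_space \<eta> r) \<in> sets (action_space \<eta> r)"
    unfolding sets_action_space by (rule sigma_sets.Basic[OF CollectI])
qed

text \<open>The integrands are continuous and decrease to the indicator of $C$, so the measure of a closed set is a limit of functionals
that generate the weak topology.\<close>

lemma measure_closed_LIMSEQ: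
  fixes C :: "'a::metric_space set"
  assumes C: "closed C" "C \<noteq> {}" and "finite_measure \<mu>" and sets: "sets \<mu> = sets borel"
  shows "(\<lambda>n. \<integral>x. max 0 (1 - real n * infdist x C) \<partial>\<mu>) \<longlonglongrightarrow> measure \<mu> C"
proof -
  interpret finite_measure \<mu> by fact
  have sp: "space \<mu> = UNIV" using sets_eq_imp_space_eq[OF sets] by simp
  have [measurable]: "(\<lambda>x. infdist x C) \<in> borel_measurable \<mu>"
    unfolding measurable_cong_sets[OF sets refl]
    by (intro borel_measurable_continuous_onI continuous_intros)
  have [measurable]: "C \<in> sets \<mu>" using C by (simp add: sets borel_closed)
  have "(\<lambda>n. \<integral>x. max 0 (1 - real n * infdist x C) \<partial>\<mu>) \<longlonglongrightarrow> (\<integral>x. indicator C x \<partial>\<mu>)"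
  proof (rule integral_dominated_convergence[where w = "\<lambda>_. 1"])
    show "AE x in \<mu>. (\<lambda>n. max 0 (1 - real n * infdist x C)) \<longlonglongrightarrow> indicator C x"
    proof (rule AE_I2)
      fix x
      show "(\<lambda>n. max 0 (1 - real n * infdist x C)) \<longlonglongrightarrow> indicator C x"
      proof (cases "x \<in> C")
        case True then show ?thesis by simp
      next
        case False
        then have pos: "infdist x C > 0"
          using C infdist_nonneg[of x C] in_closed_iff_infdist_zero[OF C, of x] by linarith
        obtain n0 where n0: "1 < real n0 * infdist x C" using reals_Archimedean3[OF pos] by blast
        have "eventually (\<lambda>n. max 0 (1 - real n * infdist x C) = 0) sequentially"
          using eventually_ge_at_top[of n0]
        proof eventually_elim
          case (elim n)
          have "real n0 * infdist x C \<le> real n * infdist x C" using elim pos by simp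
          then show ?case using n0 by simp
        qed
        then show ?thesis using False by (simp add: tendsto_eventually)
      qed
    qed
    show "\<And>n. AE x in \<mu>. norm (max 0 (1 - real n * infdist x C)) \<le> 1"
      by (rule AE_I2) (simp add: infdist_nonneg)
  qed simp_all
  then show ?thesis by (simp add: sp)
qed

lemma borel_measurable_measure_action:
  fixes B :: "'a::metric_space set"
  assumes "B \<in> sets borel"
  shows "(\<lambda>\<mu>. measure \<mu> B) \<in> borel_measurable (action_space \<eta> r)"
proof -
  have closed: "(\<lambda>\<mu>. measure \<mu> C) \<in> borel_measurable (action_space \<eta> r)" if C: "closed C" for C :: "'a set"
  proof (cases "C = {}")
    case False
    show ?thesis
    proof (rule borel_measurable_LIMSEQ_real)
      show "(\<lambda>\<mu>. \<integral>x. max 0 (1 - real n * infdist x C) \<partial>\<mu>) \<in> borel_measurable (action_space \<eta> r)" for n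
      proof (rule borel_measurable_integral_action)
        show "continuous_on UNIV (\<lambda>x. max 0 (1 - real n * infdist x C))"
          by (intro continuous_intros)
        have "norm (max 0 (1 - real n * infdist x C)) \<le> 1" for x
        proof -
          have "0 \<le> real n * infdist x C" by (simp add: infdist_nonneg)
          then show ?thesis by simp
        qed
        then show "bounded (range (\<lambda>x. max 0 (1 - real n * infdist x C)))"
          by (intro boundedI[of _ 1]) (elim rangeE, simp only:)
      qed
    qed (rule measure_closed_LIMSEQ[OF C False], auto dest: space_action_space)
  qed simp
  have gen: "sets (borel :: 'a measure) = sigma_sets UNIV {C. closed C}"
  proof (rule equalityI)
    show "sets (borel :: 'a measure) \<subseteq> sigma_sets UNIV {C. closed C}"
      unfolding sets_borel
    proof (rule sigma_sets_mono, rule subsetI)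
      fix S :: "'a set" assume "S \<in> {S. open S}"
      then have "UNIV - (- S) \<in> sigma_sets UNIV {C. closed C}"
        by (intro sigma_sets.Compl sigma_sets.Basic) (simp add: closed_Compl)
      then show "S \<in> sigma_sets UNIV {C. closed C}" by (simp add: Compl_eq_Diff_UNIV[symmetric])
    qed
    have "{C :: 'a set. closed C} \<subseteq> sets borel" by auto
    then show "sigma_sets UNIV {C. closed C} \<subseteq> sets (borel :: 'a measure)"
      using sets.sigma_sets_subset[of "{C. closed C}" "borel :: 'a measure"] by simp
  qed
  have stable: "Int_stable {C :: 'a set. closed C}" by (auto simp: Int_stable_def)
  have sub: "{C :: 'a set. closed C} \<subseteq> Pow UNIV" by simp
  show ?thesis
    using stable sub assms unfolding gen
  proof (induct rule: sigma_sets_induct_disjoint)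
    case (basic A) then show ?case using closed by simp
  next
    case empty show ?case by simp
  next
    case (compl A)
    have A: "A \<in> sets borel" using compl(1) by (simp add: gen)
    have "(\<lambda>\<mu>. measure \<mu> UNIV - measure \<mu> A) \<in> borel_measurable (action_space \<eta> r)"
      using closed[of UNIV] compl(2) by simp
    then show ?case
    proof (rule measurable_cong[THEN iffD1, rotated])
      fix \<mu> assume "\<mu> \<in> space (action_space \<eta> r)"
      from space_action_space[OF this] show "measure \<mu> UNIV - measure \<mu> A = measure \<mu> (UNIV - A)"
        using A finite_measure.finite_measure_compl[of \<mu> A] sets_eq_imp_space_eq[of \<mu> borel] by simp
    qed
  next
    case (union A)
    have A: "range A \<subseteq> sets borel" using union(2) by (simp add: gen)
    show ?case
    proof (rule borel_measurable_LIMSEQ_real)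
      show "(\<lambda>\<mu>. \<Sum>i<n. measure \<mu> (A i)) \<in> borel_measurable (action_space \<eta> r)" for n
        by (intro borel_measurable_sum union(3))
      fix \<mu> assume "\<mu> \<in> space (action_space \<eta> r)"
      from space_action_space[OF this] show "(\<lambda>n. \<Sum>i<n. measure \<mu> (A i)) \<longlonglongrightarrow> measure \<mu> (\<Union>n. A n)"
        using finite_measure.finite_measure_UNION[of \<mu> A] A union(1) by (simp add: sums_def)
    qed
  qed
qed

section \<open>Sums of lower integrals\<close>

text \<open>The integral of an arbitrary function is a supremum over simple functions below it, and a countable family
of them attains it.\<close>

lemma measurable_below_nn_integral:
  obtains g where "g \<in> borel_measurable M" "g \<le> f" "(\<integral>\<^sup>+x. g x \<partial>M) = (\<integral>\<^sup>+x. f x \<partial>M)"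
proof -
  let ?S = "{g. simple_function M g \<and> g \<le> f}"
  have "(\<lambda>_. 0) \<in> ?S" by (simp add: le_fun_def)
  then have "integral\<^sup>S M ` ?S \<noteq> {}" by blast
  from ennreal_Sup_countable_SUP[OF this] obtain h :: "nat \<Rightarrow> ennreal"
    where h: "range h \<subseteq> integral\<^sup>S M ` ?S" "Sup (integral\<^sup>S M ` ?S) = (SUP n. h n)" by blast
  have "\<forall>n. \<exists>g. g \<in> ?S \<and> h n = integral\<^sup>S M g" using h(1) by blast
  from choice[OF this] obtain g where g: "\<And>n. g n \<in> ?S" "\<And>n. h n = integral\<^sup>S M (g n)" by blast
  let ?g = "\<lambda>x. SUP n. g n x"
  have gm: "g n \<in> borel_measurable M" for n using g(1)[of n] by (simp add: borel_measurable_simple_function)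
  have le: "?g \<le> f" using g(1) by (auto simp: le_fun_def intro!: SUP_least)
  have "(\<integral>\<^sup>+x. f x \<partial>M) = (SUP n. h n)" unfolding nn_integral_def using h(2) by simp
  also have "\<dots> \<le> (\<integral>\<^sup>+x. ?g x \<partial>M)"
  proof (rule SUP_least)
    fix n
    have "h n = (\<integral>\<^sup>+x. g n x \<partial>M)" using g(1)[of n] by (simp add: g(2) nn_integral_eq_simple_integral)
    also have "\<dots> \<le> (\<integral>\<^sup>+x. ?g x \<partial>M)" by (intro nn_integral_mono SUP_upper) simp
    finally show "h n \<le> (\<integral>\<^sup>+x. ?g x \<partial>M)" .
  qed
  finally have "(\<integral>\<^sup>+x. f x \<partial>M) \<le> (\<integral>\<^sup>+x. ?g x \<partial>M)" .
  moreover have "(\<integral>\<^sup>+x. ?g x \<partial>M) \<le> (\<integral>\<^sup>+x. f x \<partial>M)"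
    using le by (intro nn_integral_mono) (simp add: le_fun_def)
  ultimately have "(\<integral>\<^sup>+x. ?g x \<partial>M) = (\<integral>\<^sup>+x. f x \<partial>M)" by (rule antisym[rotated])
  moreover have "?g \<in> borel_measurable M" using gm by (intro borel_measurable_SUP) simp_all
  ultimately show thesis using that le by blast
qed

text \<open>Superadditivity is the half of additivity that holds for all integrands, measurable or not. It bounds the total value of
the players, whose integrands are Voronoi functionals of the configuration.\<close>

lemma sum_nn_integral_le:
  assumes "finite I"
  shows "(\<Sum>i\<in>I. \<integral>\<^sup>+x. f i x \<partial>M) \<le> (\<integral>\<^sup>+x. (\<Sum>i\<in>I. f i x) \<partial>M)"
proof -
  have "\<exists>g. g \<in> borel_measurable M \<and> g \<le> f i \<and> (\<integral>\<^sup>+x. g x \<partial>M) = (\<integral>\<^sup>+x. f i x \<partial>M)" for i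
    using measurable_below_nn_integral[of M "f i"] by blast
  then obtain g where g: "\<And>i. g i \<in> borel_measurable M" "\<And>i. g i \<le> f i"
    "\<And>i. (\<integral>\<^sup>+x. g i x \<partial>M) = (\<integral>\<^sup>+x. f i x \<partial>M)" by metis
  have "(\<Sum>i\<in>I. \<integral>\<^sup>+x. f i x \<partial>M) = (\<integral>\<^sup>+x. (\<Sum>i\<in>I. g i x) \<partial>M)"
    using g(1) by (simp add: nn_integral_sum g(3))
  also have "\<dots> \<le> (\<integral>\<^sup>+x. (\<Sum>i\<in>I. f i x) \<partial>M)"
    using g(2) by (intro nn_integral_mono sum_mono) (simp add: le_fun_def)
  finally show ?thesis .
qed

section \<open>Independent Poisson processes\<close>

text \<open>The mass is required to be positive because the law is constructed from the normalized intensity.\<close>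

definition intensity :: "'a::topological_space measure \<Rightarrow> bool" where
  "intensity \<mu> \<longleftrightarrow> finite_measure \<mu> \<and> sets \<mu> = sets borel \<and> 0 < measure \<mu> UNIV"

lemma space_intensity: "intensity \<mu> \<Longrightarrow> space \<mu> = UNIV"
  using sets_eq_imp_space_eq[of \<mu> borel] by (simp add: intensity_def)

lemma poisson_law_intensity:
  assumes "intensity \<mu>"
  shows "prob_space (poisson_law \<mu>)" "sets (poisson_law \<mu>) = sets configurations"
    "space (poisson_law \<mu>) = UNIV"
proof -
  have "poisson_law \<mu> = poisson_sample \<mu>"
    using assms by (intro poisson_law_eq_sample) (simp_all add: intensity_def)
  then show "prob_space (poisson_law \<mu>)" "sets (poisson_law \<mu>) = sets configurations"
    "space (poisson_law \<mu>) = UNIV"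
    using assms by (simp_all add: prob_space_poisson_sample intensity_def)
qed

lemma measure_poisson_law_void:
  assumes \<mu>: "intensity \<mu>" and "B \<in> sets borel"
  shows "measure (poisson_law \<mu>) {\<phi>. points_in B \<phi> = 0} = exp (- measure \<mu> B)"
  using measure_poisson_sample_counts[of \<mu> "{0}" "\<lambda>_. B" "\<lambda>_. 0"] assms
  by (simp add: poisson_law_eq_sample intensity_def disjoint_family_on_def)

lemma measure_poisson_law_one:
  assumes \<mu>: "intensity \<mu>" and "A \<in> sets borel" "B \<in> sets borel" "A \<inter> B = {}"
  shows "measure (poisson_law \<mu>) {\<phi>. points_in A \<phi> = 1 \<and> points_in B \<phi> = 0}
       = measure \<mu> A * exp (- measure \<mu> A) * exp (- measure \<mu> B)"
proof -
  let ?B = "\<lambda>j::nat. if j = 0 then A else B" and ?v = "\<lambda>j::nat. if j = 0 then 1 else 0 :: nat"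
  have "measure (poisson_law \<mu>) {\<phi>. \<forall>j\<in>{0,1}. points_in (?B j) \<phi> = ?v j}
     = (\<Prod>j\<in>{0,1}. exp (- measure \<mu> (?B j)) * measure \<mu> (?B j) ^ ?v j / fact (?v j))"
  proof -
    have "disjoint_family_on ?B {0,1}" using assms(4) by (auto simp: disjoint_family_on_def)
    moreover have "?B j \<in> sets borel" for j using assms(2,3) by simp
    ultimately show ?thesis
      using \<mu> measure_poisson_sample_counts[of \<mu> "{0,1}" ?B ?v]
      by (simp only: poisson_law_eq_sample intensity_def finite.intros)
  qed
  then show ?thesis by (simp add: mult_ac)
qed

lemma sets_points_in:
  assumes "B \<in> sets borel"
  shows "{\<phi>. points_in B \<phi> \<in> S} \<in> sets configurations"
  using measurable_sets[OF measurable_points_in[OF assms], of S] by (simp add: vimage_def)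

lemma prob_space_PiM_poisson:
  assumes "\<And>j. j \<in> I \<Longrightarrow> intensity (f j)"
  shows "prob_space (\<Pi>\<^sub>M j\<in>I. poisson_law (f j))"
  using assms by (intro prob_space_PiM poisson_law_intensity)

lemma space_PiM_poisson:
  assumes "\<And>j. j \<in> I \<Longrightarrow> intensity (f j)"
  shows "space (\<Pi>\<^sub>M j\<in>I. poisson_law (f j)) = I \<rightarrow>\<^sub>E UNIV"
  using assms by (simp add: space_PiM poisson_law_intensity cong: PiE_cong)

lemma measure_PiM_poisson_box:
  assumes fin: "finite I" and f: "\<And>j. j \<in> I \<Longrightarrow> intensity (f j)"
    and A: "\<And>j. j \<in> I \<Longrightarrow> A j \<in> sets configurations"
  shows "{\<phi> \<in> space (\<Pi>\<^sub>M j\<in>I. poisson_law (f j)). \<forall>j\<in>I. \<phi> j \<in> A j} \<in> sets (\<Pi>\<^sub>M j\<in>I. poisson_law (f j))"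
    and "measure (\<Pi>\<^sub>M j\<in>I. poisson_law (f j)) {\<phi> \<in> space (\<Pi>\<^sub>M j\<in>I. poisson_law (f j)). \<forall>j\<in>I. \<phi> j \<in> A j}
       = (\<Prod>j\<in>I. measure (poisson_law (f j)) (A j))"
proof -
  have box: "{\<phi> \<in> space (\<Pi>\<^sub>M j\<in>I. poisson_law (f j)). \<forall>j\<in>I. \<phi> j \<in> A j} = (\<Pi>\<^sub>E j\<in>I. A j)"
    using f by (subst space_PiM_poisson) (auto simp: PiE_iff dest: extensional_arb)
  have A': "A j \<in> sets (poisson_law (f j))" if "j \<in> I" for j
    using A f that by (simp add: poisson_law_intensity)
  show "{\<phi> \<in> space (\<Pi>\<^sub>M j\<in>I. poisson_law (f j)). \<forall>j\<in>I. \<phi> j \<in> A j} \<in> sets (\<Pi>\<^sub>M j\<in>I. poisson_law (f j))"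
    unfolding box using fin A' by (intro sets_PiM_I_finite)
  show "measure (\<Pi>\<^sub>M j\<in>I. poisson_law (f j)) {\<phi> \<in> space (\<Pi>\<^sub>M j\<in>I. poisson_law (f j)). \<forall>j\<in>I. \<phi> j \<in> A j}
       = (\<Prod>j\<in>I. measure (poisson_law (f j)) (A j))"
  proof (cases "I = {}")
    case True
    interpret L: prob_space "\<Pi>\<^sub>M j\<in>I. poisson_law (f j)" using f by (rule prob_space_PiM_poisson)
    show ?thesis using True L.prob_space by simp
  next
    case False
    then obtain i where i: "i \<in> I" by blast
    let ?M = "\<lambda>j. poisson_law (f (if j \<in> I then j else i))"
    interpret prob_space "?M j" for j using f i by (intro poisson_law_intensity) auto
    interpret product_prob_space ?M I by standard
    interpret finite_product_prob_space ?M I by standard (rule fin)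
    have "(\<Pi>\<^sub>M j\<in>I. poisson_law (f j)) = (\<Pi>\<^sub>M j\<in>I. ?M j)" by (intro PiM_cong) simp_all
    then show ?thesis unfolding box using prob_times[of A] A' by simp
  qed
qed

lemma points_in_sum: "finite I \<Longrightarrow> points_in B (\<Sum>j\<in>I. \<phi> j) = (\<Sum>j\<in>I. points_in B (\<phi> j))"
  by (induction I rule: finite_induct) (simp_all add: points_in_def)

text \<open>With $F$ the total intensity of $B$, the complement of the event splits into the case of no point at all
and the cases in which exactly one process has exactly one point. This has probability $e^{-F} (1 + F) \ge 1 - F^2$.\<close>

lemma prob_crowded_cell_le:
  fixes f :: "'i \<Rightarrow> 'a::topological_space measure"
  assumes fin: "finite I" and f: "\<And>j. j \<in> I \<Longrightarrow> intensity (f j)" and B: "B \<in> sets borel"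
  defines "L \<equiv> \<Pi>\<^sub>M j\<in>I. poisson_law (f j)"
  shows "{\<phi> \<in> space L. points_in B (\<Sum>j\<in>I. \<phi> j) \<ge> 2} \<in> sets L"
    and "measure L {\<phi> \<in> space L. points_in B (\<Sum>j\<in>I. \<phi> j) \<ge> 2} \<le> (\<Sum>j\<in>I. measure (f j) B)\<^sup>2"
proof -
  interpret L: prob_space L unfolding L_def using f by (rule prob_space_PiM_poisson)
  let ?F = "\<Sum>j\<in>I. measure (f j) B"
  let ?Z = "\<lambda>j. {\<phi>. points_in B \<phi> \<in> {0}}" and ?O = "{\<phi>. points_in B \<phi> \<in> {1}}"
  have Z: "{\<phi>. points_in B \<phi> \<in> S} \<in> sets configurations" for S by (rule sets_points_in[OF B])
  define E0 where "E0 = {\<phi> \<in> space L. \<forall>j\<in>I. \<phi> j \<in> {\<phi>. points_in B \<phi> \<in> {0}}}"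
  define E where "E i = {\<phi> \<in> space L. \<forall>j\<in>I. \<phi> j \<in> {\<phi>. points_in B \<phi> \<in> (if j = i then {1} else {0})}}" for i
  have mE0: "E0 \<in> sets L" "measure L E0 = exp (- ?F)"
    unfolding E0_def L_def using measure_PiM_poisson_box[of I f "\<lambda>_. {\<phi>. points_in B \<phi> \<in> {0}}", OF fin f Z]
    by (simp_all add: measure_poisson_law_void f B exp_sum fin sum_negf[symmetric])
  have mE: "E i \<in> sets L" "measure L (E i) = measure (f i) B * exp (- ?F)" if i: "i \<in> I" for i
  proof -
    note box = measure_PiM_poisson_box[of I f "\<lambda>j. {\<phi>. points_in B \<phi> \<in> (if j = i then {1} else {0})}", OF fin f Z]
    show "E i \<in> sets L" unfolding E_def L_def by (rule box)
    have one: "measure (poisson_law (f i)) {\<phi>. points_in B \<phi> = 1} = measure (f i) B * exp (- measure (f i) B)"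
      using measure_poisson_law_one[OF f[OF i] B, of "{}"] by (simp add: points_in_def)
    have "measure L (E i) = (\<Prod>j\<in>I. measure (poisson_law (f j)) {\<phi>. points_in B \<phi> \<in> (if j = i then {1} else {0})})"
      unfolding E_def L_def by (rule box)
    also have "\<dots> = measure (f i) B * exp (- measure (f i) B) * (\<Prod>j\<in>I - {i}. exp (- measure (f j) B))"
      using i one by (simp add: prod.remove[OF fin i] measure_poisson_law_void f B)
    also have "\<dots> = measure (f i) B * exp (- ?F)"
      by (simp add: sum.remove[OF fin i] exp_sum[symmetric] fin exp_add[symmetric] sum_negf)
    finally show "measure L (E i) = measure (f i) B * exp (- ?F)" .
  qed
  let ?G = "E0 \<union> (\<Union>i\<in>I. E i)"
  have G: "?G \<in> sets L" using mE0 mE fin by (intro sets.Un sets.finite_UN) auto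
  have mG: "measure L ?G = exp (- ?F) * (1 + ?F)"
  proof -
    have "measure L ?G = measure L E0 + measure L (\<Union>i\<in>I. E i)"
    proof (rule L.finite_measure_Union)
      have "E0 \<inter> E i = {}" if "i \<in> I" for i
      proof -
        have "points_in B (\<phi> i) = 0" if "\<phi> \<in> E0" for \<phi> using that \<open>i \<in> I\<close> unfolding E0_def by force
        moreover have "points_in B (\<phi> i) = 1" if "\<phi> \<in> E i" for \<phi> using that \<open>i \<in> I\<close> unfolding E_def by force
        ultimately show ?thesis by force
      qed
      then show "E0 \<inter> (\<Union>i\<in>I. E i) = {}" by blast
    qed (use mE0 mE fin in auto)
    also have "measure L (\<Union>i\<in>I. E i) = (\<Sum>i\<in>I. measure L (E i))"
    proof (rule L.finite_measure_finite_Union[OF fin])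
      show "disjoint_family_on E I"
      proof (unfold disjoint_family_on_def, intro ballI impI)
        fix i k assume ik: "i \<in> I" "k \<in> I" "i \<noteq> k"
        have "points_in B (\<phi> i) = 1" if "\<phi> \<in> E i" for \<phi> using that ik unfolding E_def by force
        moreover have "points_in B (\<phi> i) = 0" if "\<phi> \<in> E k" for \<phi> using that ik unfolding E_def by force
        ultimately show "E i \<inter> E k = {}" by force
      qed
    qed (use mE in auto)
    finally show ?thesis using mE0 mE by (simp add: sum_distrib_right[symmetric] algebra_simps)
  qed
  have bad: "{\<phi> \<in> space L. points_in B (\<Sum>j\<in>I. \<phi> j) \<ge> 2} = space L - ?G"
  proof (rule set_eqI)
    fix \<phi> :: "'i \<Rightarrow> 'a multiset"
    let ?n = "\<lambda>j. points_in B (\<phi> j)"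
    have "\<not> (\<Sum>j\<in>I. ?n j) \<ge> 2 \<longleftrightarrow> (\<forall>j\<in>I. ?n j = 0) \<or> (\<exists>i\<in>I. \<forall>j\<in>I. ?n j = (if j = i then 1 else 0))"
    proof
      assume "\<not> (\<Sum>j\<in>I. ?n j) \<ge> 2"
      then have "(\<Sum>j\<in>I. ?n j) = 0 \<or> (\<Sum>j\<in>I. ?n j) = 1" by linarith
      then show "(\<forall>j\<in>I. ?n j = 0) \<or> (\<exists>i\<in>I. \<forall>j\<in>I. ?n j = (if j = i then 1 else 0))"
      proof
        assume "(\<Sum>j\<in>I. ?n j) = 0" then show ?thesis using fin by simp
      next
        assume "(\<Sum>j\<in>I. ?n j) = 1"
        then obtain i where "i \<in> I" "?n i = 1" "\<forall>j\<in>I. j \<noteq> i \<longrightarrow> ?n j = 0"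
          using sum_eq_1_iff[OF fin, of ?n] by auto
        then have "\<forall>j\<in>I. ?n j = (if j = i then 1 else 0)" by simp
        then show ?thesis using \<open>i \<in> I\<close> by blast
      qed
    next
      assume "(\<forall>j\<in>I. ?n j = 0) \<or> (\<exists>i\<in>I. \<forall>j\<in>I. ?n j = (if j = i then 1 else 0))"
      then have "(\<Sum>j\<in>I. ?n j) \<le> 1"
      proof
        assume "\<exists>i\<in>I. \<forall>j\<in>I. ?n j = (if j = i then 1 else 0)"
        then obtain i where "i \<in> I" "\<forall>j\<in>I. ?n j = (if j = i then 1 else 0)" by blast
        then have "(\<Sum>j\<in>I. ?n j) = (\<Sum>j\<in>I. if j = i then 1 else 0)" by (intro sum.cong) simp_all
        then show ?thesis using fin by simp
      qed simp
      then show "\<not> (\<Sum>j\<in>I. ?n j) \<ge> 2" by linarith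
    qed
    moreover have "\<phi> \<in> ?G \<longleftrightarrow> \<phi> \<in> space L \<and> ((\<forall>j\<in>I. ?n j = 0) \<or> (\<exists>i\<in>I. \<forall>j\<in>I. ?n j = (if j = i then 1 else 0)))"
    proof -
      have "points_in B (\<phi> j) \<in> (if j = i then {1} else {0}) \<longleftrightarrow> ?n j = (if j = i then 1 else 0)" for i j
        by simp
      then show ?thesis unfolding Un_iff UN_iff E0_def E_def mem_Collect_eq singleton_iff by blast
    qed
    ultimately show "\<phi> \<in> {\<phi> \<in> space L. points_in B (\<Sum>j\<in>I. \<phi> j) \<ge> 2} \<longleftrightarrow> \<phi> \<in> space L - ?G"
      unfolding mem_Collect_eq points_in_sum[OF fin] by blast
  qed
  show "{\<phi> \<in> space L. points_in B (\<Sum>j\<in>I. \<phi> j) \<ge> 2} \<in> sets L"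
    unfolding bad using G by simp
  have F0: "?F \<ge> 0" by (simp add: sum_nonneg)
  have "measure L {\<phi> \<in> space L. points_in B (\<Sum>j\<in>I. \<phi> j) \<ge> 2} = 1 - exp (- ?F) * (1 + ?F)"
    unfolding bad using L.prob_compl[OF G] mG by simp
  also have "\<dots> \<le> 1 - (1 - ?F) * (1 + ?F)"
    using exp_ge_add_one_self[of "- ?F"] F0 by (intro diff_left_mono mult_right_mono) simp_all
  also have "\<dots> = ?F\<^sup>2" by (simp add: power2_eq_square algebra_simps)
  finally show "measure L {\<phi> \<in> space L. points_in B (\<Sum>j\<in>I. \<phi> j) \<ge> 2} \<le> ?F\<^sup>2" .
qed

section \<open>The total value\<close>

text \<open>Each point has a ball of small measure because it is not an atom; finitely many of these balls cover the space
and are then made disjoint.\<close>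

lemma small_cells:
  fixes f :: "'i \<Rightarrow> 'a::metric_space measure"
  assumes comp: "compact (UNIV :: 'a set)" and fin: "finite I" and f: "\<And>j. j \<in> I \<Longrightarrow> intensity (f j)"
    and diffuse: "\<And>j x. j \<in> I \<Longrightarrow> measure (f j) {x} = 0" and \<epsilon>: "\<epsilon> > 0"
  obtains D :: "nat \<Rightarrow> 'a set" and K where "\<And>n. D n \<in> sets borel" "disjoint_family D"
    "(\<Union>n<K. D n) = UNIV" "\<And>n. (\<Sum>j\<in>I. measure (f j) (D n)) \<le> \<epsilon>"
proof -
  let ?F = "\<lambda>B. \<Sum>j\<in>I. measure (f j) B"
  have "\<exists>r>0. ?F (ball x r) < \<epsilon>" for x
  proof -
    have "(\<lambda>n. measure (f j) (ball x (1 / real (Suc n)))) \<longlonglongrightarrow> 0" if j: "j \<in> I" for j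
    proof -
      interpret finite_measure "f j" using f[OF j] by (simp add: intensity_def)
      have "(\<lambda>n. measure (f j) (ball x (1 / real (Suc n)))) \<longlonglongrightarrow> measure (f j) (\<Inter>n. ball x (1 / real (Suc n)))"
      proof (rule finite_Lim_measure_decseq)
        show "range (\<lambda>n. ball x (1 / real (Suc n))) \<subseteq> sets (f j)"
        proof (rule image_subsetI)
          fix n
          have "sets (f j) = sets borel" using f[OF j] by (simp only: intensity_def)
          then show "ball x (1 / real (Suc n)) \<in> sets (f j)" by (simp only: borel_open open_ball)
        qed
        show "decseq (\<lambda>n. ball x (1 / real (Suc n)))"
        proof (rule antimonoI)
          fix m n :: nat assume "m \<le> n"
          then have "1 / real (Suc n) \<le> 1 / real (Suc m)" by (intro divide_left_mono) simp_all
          then show "ball x (1 / real (Suc n)) \<subseteq> ball x (1 / real (Suc m))" by (rule subset_ball)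
        qed
      qed
      also have "(\<Inter>n. ball x (1 / real (Suc n))) = {x}"
      proof (intro equalityI subsetI)
        fix y assume y: "y \<in> (\<Inter>n. ball x (1 / real (Suc n)))"
        have "dist x y \<le> 0"
        proof (rule ccontr)
          assume "\<not> dist x y \<le> 0"
          then have "0 < dist x y" by (simp only: not_le)
          from reals_Archimedean[OF this] obtain n where "inverse (real (Suc n)) < dist x y" by blast
          moreover have "y \<in> ball x (1 / real (Suc n))" using y by blast
          ultimately show False by (simp only: mem_ball inverse_eq_divide)
        qed
        then show "y \<in> {x}" by simp
      qed simp
      finally show ?thesis using diffuse[OF j] by simp
    qed
    then have "(\<lambda>n. ?F (ball x (1 / real (Suc n)))) \<longlonglongrightarrow> (\<Sum>j\<in>I. 0)"
      by (intro tendsto_sum)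
    then have "(\<lambda>n. ?F (ball x (1 / real (Suc n)))) \<longlonglongrightarrow> 0" by simp
    from order_tendstoD(2)[OF this \<epsilon>] obtain n where "?F (ball x (1 / real (Suc n))) < \<epsilon>"
      by (auto simp: eventually_sequentially)
    then show ?thesis by (intro exI[of _ "1 / real (Suc n)"]) simp
  qed
  then have "\<forall>x. \<exists>r. r > 0 \<and> ?F (ball x r) < \<epsilon>" by blast
  from choice[OF this] obtain r where r: "\<And>x. r x > 0" "\<And>x. ?F (ball x (r x)) < \<epsilon>" by blast
  have "UNIV \<subseteq> (\<Union>x\<in>UNIV. ball x (r x))"
  proof
    fix x :: 'a
    have "x \<in> ball x (r x)" using r(1) by simp
    then show "x \<in> (\<Union>x\<in>UNIV. ball x (r x))" by blast
  qed
  then obtain T where T: "finite T" "UNIV \<subseteq> (\<Union>x\<in>T. ball x (r x))"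
    by (rule compactE_image[OF comp, rotated]) simp_all
  obtain e and K :: nat where e: "T = e ` {i. i < K}"
    using finite_imp_nat_seg_image_inj_on[OF T(1)] by blast
  define A where "A n = (if n < K then ball (e n) (r (e n)) else {})" for n
  have A: "range A \<subseteq> sets borel" by (auto simp: A_def)
  show thesis
  proof (rule that[of "disjointed A" K])
    show "disjointed A n \<in> sets borel" for n
      using sets.range_disjointed_sets[OF A] by (rule range_subsetD)
    show "disjoint_family (disjointed A)" by (rule disjoint_family_disjointed)
    have "x \<in> (\<Union>n<K. disjointed A n)" for x
    proof -
      obtain n where "n < K" "x \<in> A n" 
      proof -
        obtain y where "y \<in> T" "x \<in> ball y (r y)" using T(2) by blast
        moreover then obtain n where "n < K" "y = e n" unfolding e by blast
        ultimately show thesis using that[of n] by (simp add: A_def)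
      qed
      then have "x \<in> (\<Union>n. disjointed A n)" unfolding UN_disjointed_eq by blast
      then obtain m where m: "x \<in> disjointed A m" by blast
      then have "x \<in> A m" by (rule subsetD[OF disjointed_subset])
      then have "m < K" unfolding A_def by (cases "m < K") simp_all
      then show ?thesis using m by blast
    qed
    then show "(\<Union>n<K. disjointed A n) = UNIV" by blast
    show "?F (disjointed A n) \<le> \<epsilon>" for n
    proof -
      have "?F (disjointed A n) \<le> ?F (A n)"
      proof (rule sum_mono)
        fix j assume j: "j \<in> I"
        interpret finite_measure "f j" using f[OF j] by (simp add: intensity_def)
        show "measure (f j) (disjointed A n) \<le> measure (f j) (A n)"
          using A f[OF j] by (intro finite_measure_mono disjointed_subset) (auto simp: intensity_def)
      qed
      also have "\<dots> \<le> \<epsilon>" using r(2)[of "e n"] \<epsilon> by (simp add: A_def)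
      finally show ?thesis .
    qed
  qed
qed

text \<open>A multiple point makes one cell of any partition contain two points. If all cells have measure at most $\epsilon$,
this has probability at most $\sum_n F(D_n)^2 \le \epsilon F(D)$.\<close>

lemma AE_poisson_simple:
  fixes f :: "'i \<Rightarrow> 'a::metric_space measure"
  assumes comp: "compact (UNIV :: 'a set)" and fin: "finite I" and f: "\<And>j. j \<in> I \<Longrightarrow> intensity (f j)"
    and diffuse: "\<And>j x. j \<in> I \<Longrightarrow> measure (f j) {x} = 0"
  shows "AE \<phi> in (\<Pi>\<^sub>M j\<in>I. poisson_law (f j)). \<forall>x. count (\<Sum>j\<in>I. \<phi> j) x \<le> 1"
proof -
  define L where "L = (\<Pi>\<^sub>M j\<in>I. poisson_law (f j))"
  interpret L: prob_space L unfolding L_def using f by (rule prob_space_PiM_poisson)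
  let ?F = "\<lambda>B. \<Sum>j\<in>I. measure (f j) B"
  define bad where "bad B = {\<phi> \<in> space L. points_in B (\<Sum>j\<in>I. \<phi> j) \<ge> 2}" for B
  have bad: "bad B \<in> sets L" "measure L (bad B) \<le> (?F B)\<^sup>2" if "B \<in> sets borel" for B
    unfolding bad_def L_def by (rule prob_crowded_cell_le[OF fin f that], assumption)+
  have F0: "?F B \<ge> 0" for B by (simp add: sum_nonneg)
  have cover: "\<exists>X\<in>sets L. {\<phi> \<in> space L. \<not> (\<forall>x. count (\<Sum>j\<in>I. \<phi> j) x \<le> 1)} \<subseteq> X \<and> measure L X \<le> \<epsilon> * ?F UNIV"
    if \<epsilon>: "\<epsilon> > 0" for \<epsilon>
  proof -
    obtain D :: "nat \<Rightarrow> 'a set" and K where D: "\<And>n. D n \<in> sets borel" "disjoint_family D"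
      "(\<Union>n<K. D n) = UNIV" "\<And>n. ?F (D n) \<le> \<epsilon>"
      by (rule small_cells[OF comp fin f diffuse \<epsilon>]) (assumption | rule that)+
    let ?X = "\<Union>n<K. bad (D n)"
    have X: "?X \<in> sets L" using bad(1) D(1) by (intro sets.finite_UN) auto
    have sub: "\<phi> \<in> ?X" if "\<phi> \<in> space L" "\<not> count (\<Sum>j\<in>I. \<phi> j) x \<le> 1" for \<phi> x
    proof -
      obtain n where n: "n < K" "x \<in> D n" using D(3) by blast
      have "count \<Phi> x \<le> points_in (D n) \<Phi>" for \<Phi>
      proof -
        have "count \<Phi> x = count (filter_mset (\<lambda>x. x \<in> D n) \<Phi>) x" using n(2) by simp
        also have "\<dots> \<le> points_in (D n) \<Phi>" unfolding points_in_def by (rule count_le_size)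
        finally show ?thesis .
      qed
      from this[of "\<Sum>j\<in>I. \<phi> j"] have "points_in (D n) (\<Sum>j\<in>I. \<phi> j) \<ge> 2" using that(2) by linarith
      then show ?thesis using n that(1) unfolding bad_def by blast
    qed
    have "measure L ?X \<le> (\<Sum>n<K. measure L (bad (D n)))"
      using bad(1) D(1) by (intro L.finite_measure_subadditive_finite) auto
    also have "\<dots> \<le> (\<Sum>n<K. \<epsilon> * ?F (D n))"
    proof (rule sum_mono)
      fix n
      have "measure L (bad (D n)) \<le> ?F (D n) * ?F (D n)" using bad(2)[OF D(1)] by (simp add: power2_eq_square)
      also have "\<dots> \<le> \<epsilon> * ?F (D n)" using D(4) F0 by (intro mult_right_mono)
      finally show "measure L (bad (D n)) \<le> \<epsilon> * ?F (D n)" .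
    qed
    also have "\<dots> = \<epsilon> * (\<Sum>j\<in>I. \<Sum>n<K. measure (f j) (D n))"
      by (subst sum.swap) (simp add: sum_distrib_left)
    also have "(\<Sum>j\<in>I. \<Sum>n<K. measure (f j) (D n)) = ?F UNIV"
    proof (rule sum.cong[OF refl])
      fix j assume j: "j \<in> I"
      interpret finite_measure "f j" using f[OF j] by (simp add: intensity_def)
      have "disjoint_family_on D {..<K}" using D(2) by (auto simp: disjoint_family_on_def)
      then have "measure (f j) (\<Union>n<K. D n) = (\<Sum>n<K. measure (f j) (D n))"
        using D(1) f[OF j] by (intro finite_measure_finite_Union) (auto simp: intensity_def)
      then show "(\<Sum>n<K. measure (f j) (D n)) = measure (f j) UNIV" by (simp only: D(3))
    qed
    finally have "measure L ?X \<le> \<epsilon> * ?F UNIV" .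
    then show ?thesis using X sub by blast
  qed
  have "\<forall>n. \<exists>X. X \<in> sets L \<and> {\<phi> \<in> space L. \<not> (\<forall>x. count (\<Sum>j\<in>I. \<phi> j) x \<le> 1)} \<subseteq> X
      \<and> measure L X \<le> inverse (real (Suc n)) * ?F UNIV"
  proof
    fix n
    have "inverse (real (Suc n)) > 0" by simp
    from cover[OF this] show "\<exists>X. X \<in> sets L \<and> {\<phi> \<in> space L. \<not> (\<forall>x. count (\<Sum>j\<in>I. \<phi> j) x \<le> 1)} \<subseteq> X
      \<and> measure L X \<le> inverse (real (Suc n)) * ?F UNIV" by blast
  qed
  from choice[OF this] obtain X where X: "\<And>n. X n \<in> sets L"
      "\<And>n. {\<phi> \<in> space L. \<not> (\<forall>x. count (\<Sum>j\<in>I. \<phi> j) x \<le> 1)} \<subseteq> X n"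
      "\<And>n. measure L (X n) \<le> inverse (real (Suc n)) * ?F UNIV" by blast
  have INT: "(\<Inter>n. X n) \<in> sets L" using X(1) by (intro sets.countable_INT) auto
  have le: "measure L (\<Inter>n. X n) \<le> inverse (real (Suc n)) * ?F UNIV" for n
  proof -
    have "measure L (\<Inter>n. X n) \<le> measure L (X n)" by (rule L.finite_measure_mono[OF _ X(1)]) blast
    then show ?thesis using X(3)[of n] by linarith
  qed
  have "(\<lambda>n. inverse (real (Suc n)) * ?F UNIV) \<longlonglongrightarrow> 0 * ?F UNIV"
    by (intro tendsto_mult LIMSEQ_inverse_real_of_nat tendsto_const)
  then have "measure L (\<Inter>n. X n) \<le> 0 * ?F UNIV"
    by (rule LIMSEQ_le_const) (use le in auto)
  then have "measure L (\<Inter>n. X n) = 0"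
    using measure_nonneg[of L "\<Inter>n. X n"] by (simp only: mult_zero_left antisym)
  then have "(\<Inter>n. X n) \<in> null_sets L" using INT by (simp add: null_sets_def L.emeasure_eq_measure)
  then show ?thesis unfolding L_def[symmetric]
    by (rule AE_I') (use X(2) in blast)
qed

lemma open_voronoi_cell: "open (voronoi_cell \<phi> x)"
proof -
  have "voronoi_cell \<phi> x = (\<Inter>x'\<in>set_mset \<phi> - {x}. {z. dist x z < dist x' z})"
    by (auto simp: voronoi_cell_def)
  also have "open \<dots>" by (intro open_INT open_Collect_less continuous_intros ballI) simp
  finally show ?thesis .
qed

lemma voronoi_cellD:
  "z \<in> voronoi_cell \<phi> x \<Longrightarrow> y \<in># \<phi> \<Longrightarrow> y \<noteq> x \<Longrightarrow> dist x z < dist y z"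
  by (simp add: voronoi_cell_def)

text \<open>The cells of distinct points are disjoint. Without multiple points no cell is counted twice.\<close>

lemma sum_voronoi_cells_le:
  fixes \<eta> :: "'a::metric_space measure"
  assumes sets: "sets \<eta> = sets borel" and fin: "finite I" and simple: "\<And>x. count (\<Sum>j\<in>I. \<phi> j) x \<le> 1"
  shows "(\<Sum>i\<in>I. \<Sum>x\<in>#\<phi> i. emeasure \<eta> (voronoi_cell (\<Sum>j\<in>I. \<phi> j) x))
    \<le> emeasure \<eta> UNIV * (if (\<Sum>j\<in>I. \<phi> j) = {#} then 0 else 1)"
proof -
  let ?\<Phi> = "\<Sum>j\<in>I. \<phi> j"
  let ?w = "\<lambda>x. emeasure \<eta> (voronoi_cell ?\<Phi> x)"
  have cell: "voronoi_cell ?\<Phi> x \<in> sets \<eta>" for x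
    using open_voronoi_cell[of ?\<Phi> x] by (simp add: sets)
  have "(\<Sum>i\<in>I. \<Sum>x\<in>#\<phi> i. ?w x) = (\<Sum>x\<in>#?\<Phi>. ?w x)"
  proof -
    have "(\<Sum>i\<in>J. \<Sum>x\<in>#\<phi> i. ?w x) = (\<Sum>x\<in>#(\<Sum>i\<in>J. \<phi> i). ?w x)" if "finite J" for J
      using that by (induction J rule: finite_induct) simp_all
    then show ?thesis using fin by blast
  qed
  also have "\<dots> = (\<Sum>x\<in>set_mset ?\<Phi>. ?w x)"
  proof -
    have "mset_set (set_mset ?\<Phi>) = ?\<Phi>"
    proof (rule multiset_eqI)
      fix x
      show "count (mset_set (set_mset ?\<Phi>)) x = count ?\<Phi> x"
      proof (cases "x \<in># ?\<Phi>")
        case True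
        then have "count ?\<Phi> x \<noteq> 0" by (simp only: count_eq_zero_iff not_not)
        then have "count ?\<Phi> x = 1" using simple[of x] by linarith
        then show ?thesis using True count_mset_set(1)[OF finite_set_mset True] by linarith
      next
        case False
        then have "count ?\<Phi> x = 0" by (simp only: count_eq_zero_iff not_False_eq_True)
        then show ?thesis using count_mset_set(3)[OF False] by linarith
      qed
    qed
    then show ?thesis by (simp only: sum_unfold_sum_mset)
  qed
  also have "\<dots> = emeasure \<eta> (\<Union>x\<in>set_mset ?\<Phi>. voronoi_cell ?\<Phi> x)"
  proof (rule sum_emeasure)
    show "disjoint_family_on (voronoi_cell ?\<Phi>) (set_mset ?\<Phi>)"
    proof (unfold disjoint_family_on_def, intro ballI impI equals0I)
      fix x y z assume xy: "x \<in> set_mset ?\<Phi>" "y \<in> set_mset ?\<Phi>" "x \<noteq> y"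
        and z: "z \<in> voronoi_cell ?\<Phi> x \<inter> voronoi_cell ?\<Phi> y"
      have "dist x z < dist y z" by (rule voronoi_cellD[OF IntD1[OF z] xy(2) xy(3)[symmetric]])
      moreover have "dist y z < dist x z" by (rule voronoi_cellD[OF IntD2[OF z] xy(1) xy(3)])
      ultimately show False by linarith
    qed
  qed (use cell in auto)
  also have "\<dots> \<le> emeasure \<eta> UNIV * (if ?\<Phi> = {#} then 0 else 1)"
  proof (cases "?\<Phi> = {#}")
    case False
    then show ?thesis by (simp add: emeasure_mono sets)
  qed simp
  finally show ?thesis .
qed

text \<open>The players share at most $\eta(D)$, and nothing if there is no point at all.\<close>

lemma sum_game_value_le:
  fixes \<eta> :: "'a::metric_space measure"
  assumes comp: "compact (UNIV :: 'a set)" and \<eta>: "finite_measure \<eta>" "sets \<eta> = sets borel"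
    and f: "\<And>j. j \<in> {1..N} \<Longrightarrow> intensity (f j)"
    and diffuse: "\<And>j x. j \<in> {1..N} \<Longrightarrow> measure (f j) {x} = 0"
  shows "(\<Sum>i\<in>{1..N}. game_value \<eta> N f i)
    \<le> ennreal (measure \<eta> UNIV * (1 - exp (- (\<Sum>j\<in>{1..N}. measure (f j) UNIV))))"
proof -
  let ?I = "{1..N}"
  define L where "L = (\<Pi>\<^sub>M j\<in>?I. poisson_law (f j))"
  interpret L: prob_space L unfolding L_def using f by (rule prob_space_PiM_poisson)
  interpret \<eta>: finite_measure \<eta> by fact
  let ?R = "\<Sum>j\<in>?I. measure (f j) UNIV"
  define E where "E = {\<phi> \<in> space L. \<forall>j\<in>?I. \<phi> j \<in> {\<phi>. points_in UNIV \<phi> \<in> {0}}}"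
  have Z: "{\<phi>. points_in UNIV \<phi> \<in> {0}} \<in> sets configurations" by (rule sets_points_in) simp
  note box = measure_PiM_poisson_box[of ?I f "\<lambda>_. {\<phi>. points_in UNIV \<phi> \<in> {0}}", OF _ f Z]
  have E: "E \<in> sets L" unfolding E_def L_def by (rule box) simp
  have mE: "measure L E = exp (- ?R)"
  proof -
    have "measure L E = (\<Prod>j\<in>?I. measure (poisson_law (f j)) {\<phi>. points_in UNIV \<phi> \<in> {0}})"
      unfolding E_def L_def by (rule box) simp
    also have "\<dots> = (\<Prod>j\<in>?I. exp (- measure (f j) UNIV))"
      using f by (intro prod.cong) (simp_all add: measure_poisson_law_void)
    also have "\<dots> = exp (- ?R)" by (simp add: exp_sum[symmetric] sum_negf)
    finally show ?thesis .
  qed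
  have E_iff: "\<phi> \<in> E \<longleftrightarrow> (\<Sum>j\<in>?I. \<phi> j) = {#}" if "\<phi> \<in> space L" for \<phi>
  proof -
    have size: "points_in UNIV \<psi> = size \<psi>" for \<psi> :: "'a multiset" by (simp add: points_in_def)
    have "(\<Sum>j\<in>?I. \<phi> j) = {#} \<longleftrightarrow> points_in UNIV (\<Sum>j\<in>?I. \<phi> j) = 0"
      by (simp only: size size_eq_0_iff_empty)
    also have "\<dots> \<longleftrightarrow> (\<Sum>j\<in>?I. points_in UNIV (\<phi> j)) = 0"
      by (simp only: points_in_sum finite_atLeastAtMost)
    also have "\<dots> \<longleftrightarrow> (\<forall>j\<in>?I. points_in UNIV (\<phi> j) = 0)" by (rule sum_eq_0_iff) simp
    finally show ?thesis using that by (simp add: E_def)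
  qed
  have "(\<Sum>i\<in>?I. game_value \<eta> N f i)
      \<le> (\<integral>\<^sup>+\<phi>. (\<Sum>i\<in>?I. \<Sum>x\<in>#\<phi> i. emeasure \<eta> (voronoi_cell (\<Sum>j\<in>?I. \<phi> j) x)) \<partial>L)"
    unfolding game_value_def L_def[symmetric] by (rule sum_nn_integral_le) simp
  also have "\<dots> \<le> (\<integral>\<^sup>+\<phi>. emeasure \<eta> UNIV * indicator (space L - E) \<phi> \<partial>L)"
  proof (rule nn_integral_mono_AE)
    have "AE \<phi> in L. \<forall>x. count (\<Sum>j\<in>?I. \<phi> j) x \<le> 1"
      unfolding L_def by (rule AE_poisson_simple[OF comp _ f diffuse]) simp_all
    with AE_space show "AE \<phi> in L. (\<Sum>i\<in>?I. \<Sum>x\<in>#\<phi> i. emeasure \<eta> (voronoi_cell (\<Sum>j\<in>?I. \<phi> j) x))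
        \<le> emeasure \<eta> UNIV * indicator (space L - E) \<phi>"
    proof eventually_elim
      case (elim \<phi>)
      have "indicator (space L - E) \<phi> = (if (\<Sum>j\<in>?I. \<phi> j) = {#} then 0 else 1 :: ennreal)"
        using E_iff[OF elim(1)] elim(1) by (simp add: indicator_def)
      then show ?case using sum_voronoi_cells_le[OF \<eta>(2), of ?I \<phi>] elim(2) by simp
    qed
  qed
  also have "\<dots> = emeasure \<eta> UNIV * emeasure L (space L - E)"
    using E by (simp add: nn_integral_cmult_indicator)
  also have "\<dots> = ennreal (measure \<eta> UNIV * (1 - exp (- ?R)))"
    using L.prob_compl[OF E] by (simp add: \<eta>.emeasure_eq_measure L.emeasure_eq_measure mE ennreal_mult'[symmetric] ennreal_mult)
  finally show ?thesis .
qed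

section \<open>Balls in a homogeneous space\<close>

text \<open>What the argument retains of the transitive group and of the hypotheses on $\eta$.\<close>

locale homogeneous_space = finite_measure \<eta> for \<eta> :: "'a::polish_space measure" +
  assumes sets_eq: "sets \<eta> = sets borel" and pos: "0 < measure \<eta> UNIV"
    and compact_space: "compact (UNIV :: 'a set)"
    and cball_eq: "measure \<eta> (cball x r) = measure \<eta> (cball y r)"
    and sphere_null: "measure \<eta> (sphere x r) = 0"
begin

abbreviation "m \<equiv> measure \<eta> UNIV"

text \<open>The centre is arbitrary, by \<open>measure_cball\<close>.\<close>
definition h :: "real \<Rightarrow> real" where "h r = measure \<eta> (cball undefined r)"

lemma measure_cball: "measure \<eta> (cball x r) = h r"
  unfolding h_def by (rule cball_eq)

lemma space_eq: "space \<eta> = UNIV"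
  using sets_eq_imp_space_eq[OF sets_eq] by simp

lemma borel_sets: "B \<in> sets borel \<Longrightarrow> B \<in> sets \<eta>"
  by (simp add: sets_eq)

lemma mono_h: "mono h"
  unfolding h_def by (intro monoI finite_measure_mono subset_cball borel_sets) simp_all

lemma h_zero: "h 0 = 0"
  using sphere_null[of undefined 0] by (simp add: h_def)

text \<open>\<open>h\<close> is the distribution function of the distance to a point; its jumps are the measures of spheres.\<close>

lemma isCont_h: "isCont h r"
proof -
  have dm: "dist (undefined :: 'a) \<in> \<eta> \<rightarrow>\<^sub>M borel"
    unfolding measurable_cong_sets[OF sets_eq refl]
    by (intro borel_measurable_continuous_onI continuous_intros)
  let ?M = "distr \<eta> borel (dist (undefined :: 'a))"
  interpret M: finite_borel_measure ?M
    by (intro finite_borel_measure.intro finite_measure_distr[OF dm] finite_borel_measure_axioms.intro) simp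
  have "cdf ?M r = h r" for r
    unfolding cdf_def h_def using dm
    by (subst measure_distr) (simp_all add: space_eq vimage_def cball_def)
  then have "cdf ?M = h" by (rule ext)
  moreover have "measure ?M {r} = 0"
    using dm sphere_null[of undefined r] by (subst measure_distr) (simp_all add: space_eq vimage_def sphere_def)
  ultimately show ?thesis using M.isCont_cdf[of r] by simp
qed

text \<open>Finitely many balls of radius $r$ cover the space, and they all have measure \<open>h r\<close>.\<close>

lemma h_pos:
  assumes "r > 0"
  shows "h r > 0"
proof (rule ccontr)
  assume "\<not> h r > 0"
  then have h0: "h r = 0" using measure_nonneg[of \<eta> "cball undefined r"] unfolding h_def by linarith
  have "UNIV \<subseteq> (\<Union>x\<in>(UNIV :: 'a set). ball x r)"
  proof
    fix x :: 'a
    have "x \<in> ball x r" using assms by simp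
    then show "x \<in> (\<Union>x\<in>UNIV. ball x r)" by blast
  qed
  then obtain T :: "'a set" where T: "finite T" "UNIV \<subseteq> (\<Union>x\<in>T. ball x r)"
    by (rule compactE_image[OF compact_space, rotated]) simp_all
  have "m \<le> measure \<eta> (\<Union>x\<in>T. cball x r)"
  proof (rule finite_measure_mono)
    show "UNIV \<subseteq> (\<Union>x\<in>T. cball x r)" using T(2) ball_subset_cball by blast
    show "(\<Union>x\<in>T. cball x r) \<in> sets \<eta>" using T(1) by (intro sets.finite_UN borel_sets) simp_all
  qed
  also have "\<dots> \<le> (\<Sum>x\<in>T. measure \<eta> (cball x r))"
    using T(1) by (intro finite_measure_subadditive_finite image_subsetI borel_sets) simp_all
  also have "\<dots> = 0" by (simp add: measure_cball h0)
  finally show False using pos by simp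
qed

lemma ex_radius:
  assumes "0 \<le> t" "t \<le> 1"
  shows "\<exists>r\<ge>0. h r = t * m"
proof -
  obtain R where R: "\<And>y. dist (undefined :: 'a) y \<le> R"
    using compact_imp_bounded[OF compact_space] bounded_any_center[of UNIV undefined] by blast
  have R0: "R \<ge> 0" using R[of undefined] by simp
  have hR: "h R = m" unfolding h_def using R by (intro arg_cong[where f = "measure \<eta>"]) auto
  have "\<exists>r\<ge>0. r \<le> R \<and> h r = t * m"
  proof (rule IVT')
    show "h 0 \<le> t * m" using assms pos by (simp add: h_zero)
    show "t * m \<le> h R" using mult_right_mono[OF assms(2), of m] pos by (simp add: hR)
    show "continuous_on {0..R} h" using isCont_h by (intro continuous_at_imp_continuous_on) blast
  qed (rule R0)
  then show ?thesis by blast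
qed

text \<open>A radius whose balls have the fraction $t$ of the total mass. Clamping $t$ to the unit interval makes \<open>rad\<close>
monotone, hence Borel, on the whole line.\<close>

definition rad :: "real \<Rightarrow> real" where
  "rad t = (SOME r. r \<ge> 0 \<and> h r = max 0 (min 1 t) * m)"

lemma rad: "rad t \<ge> 0" "h (rad t) = max 0 (min 1 t) * m"
proof -
  have "0 \<le> max 0 (min 1 t)" "max 0 (min 1 t) \<le> 1" by simp_all
  from ex_radius[OF this] have "\<exists>r. r \<ge> 0 \<and> h r = max 0 (min 1 t) * m" by blast
  then have "rad t \<ge> 0 \<and> h (rad t) = max 0 (min 1 t) * m" unfolding rad_def by (rule someI_ex)
  then show "rad t \<ge> 0" "h (rad t) = max 0 (min 1 t) * m" by blast+
qed

lemma h_rad: "0 \<le> t \<Longrightarrow> t \<le> 1 \<Longrightarrow> h (rad t) = t * m"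
  by (simp add: rad(2))

lemma less_of_h_less: "h r < h s \<Longrightarrow> r < s"
  using monoD[OF mono_h, of s r] by (meson not_le)

text \<open>\<open>h\<close> may be constant on intervals, so \<open>rad\<close> is a choice; it is monotone nevertheless, since different values of
\<open>h\<close> order the radii.\<close>

lemma mono_rad: "mono rad"
proof (rule monoI)
  fix s t :: real assume st: "s \<le> t"
  let ?c = "\<lambda>t. max 0 (min 1 t) :: real"
  have "?c s \<le> ?c t" using st by auto
  then consider "?c s = ?c t" | "?c s < ?c t" by linarith
  then show "rad s \<le> rad t"
  proof cases
    case 1 then show ?thesis by (simp only: rad_def)
  next
    case 2
    then have "h (rad s) < h (rad t)" using pos by (simp only: rad(2) mult_strict_right_mono)
    then show ?thesis using less_of_h_less by fastforce
  qed
qed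

lemma borel_measurable_measure_cball_rad:
  assumes \<kappa>: "\<And>\<omega>. \<omega> \<in> space \<Omega> \<Longrightarrow> finite_measure (\<kappa> \<omega>) \<and> sets (\<kappa> \<omega>) = sets (borel :: 'a measure)"
    and meas: "\<And>B. B \<in> sets borel \<Longrightarrow> (\<lambda>\<omega>. measure (\<kappa> \<omega>) B) \<in> borel_measurable \<Omega>"
  shows "(\<lambda>(\<omega>, z, t). measure (\<kappa> \<omega>) (cball z (rad t))) \<in> borel_measurable (\<Omega> \<Otimes>\<^sub>M (borel \<Otimes>\<^sub>M borel))"
proof -
  let ?C = "{p \<in> space (borel \<Otimes>\<^sub>M (borel \<Otimes>\<^sub>M borel)). dist (fst (snd p)) (fst p) \<le> rad (snd (snd p))}
      :: ('a \<times> 'a \<times> real) set"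
  have [measurable]: "rad \<in> borel_measurable borel" by (rule borel_measurable_mono[OF mono_rad])
  have C: "?C \<in> sets (borel \<Otimes>\<^sub>M (borel \<Otimes>\<^sub>M borel))" by measurable
  have "(\<lambda>(\<omega>, y). measure (\<kappa> \<omega>) {x. (x, y) \<in> ?C}) \<in> borel_measurable (\<Omega> \<Otimes>\<^sub>M (borel \<Otimes>\<^sub>M borel))"
  proof (rule borel_measurable_set_function_section[OF meas _ _ C])
    fix \<omega> B assume "\<omega> \<in> space \<Omega>" and B: "B \<in> sets (borel :: 'a measure)"
    note * = \<kappa>[OF this(1)]
    then interpret K: finite_measure "\<kappa> \<omega>" by blast
    have "space (\<kappa> \<omega>) = UNIV" using * sets_eq_imp_space_eq[of "\<kappa> \<omega>" borel] by simp
    then show "measure (\<kappa> \<omega>) (- B) = measure (\<kappa> \<omega>) UNIV - measure (\<kappa> \<omega>) B"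
      using K.finite_measure_compl[of B] B * by (simp add: Compl_eq_Diff_UNIV)
  next
    fix \<omega> and A :: "nat \<Rightarrow> 'a set"
    assume "\<omega> \<in> space \<Omega>" and A: "range A \<subseteq> sets borel" "disjoint_family A"
    note * = \<kappa>[OF this(1)]
    then interpret K: finite_measure "\<kappa> \<omega>" by blast
    show "(\<lambda>n. measure (\<kappa> \<omega>) (A n)) sums measure (\<kappa> \<omega>) (\<Union>n. A n)"
      using K.finite_measure_UNION[of A] A * by simp
  qed
  moreover have "{x. (x, p) \<in> ?C} = cball (fst p) (rad (snd p))" for p
    by (auto simp: space_pair_measure)
  ultimately show ?thesis by (simp only: case_prod_unfold)
qed

lemma borel_measurable_measure_cball:
  assumes "intensity (\<mu> :: 'a measure)"
  shows "(\<lambda>(z, t). measure \<mu> (cball z (rad t))) \<in> borel_measurable (borel \<Otimes>\<^sub>M borel)"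
proof -
  have "(\<lambda>(\<omega>, z, t). measure ((\<lambda>_. \<mu>) \<omega>) (cball z (rad t)))
      \<in> borel_measurable (count_space (UNIV :: unit set) \<Otimes>\<^sub>M (borel \<Otimes>\<^sub>M borel))"
    using assms by (intro borel_measurable_measure_cball_rad) (simp_all add: intensity_def)
  then have "(\<lambda>p. (\<lambda>(\<omega>, z, t). measure \<mu> (cball z (rad t))) ((), p)) \<in> borel_measurable (borel \<Otimes>\<^sub>M borel)"
    by (rule measurable_compose_Pair1[rotated]) simp
  then show ?thesis by (simp add: case_prod_unfold)
qed

text \<open>Fubini: integrating $\mu(B(z,r))$ over $z$ counts each point $x$ with weight $\eta(B(x,r))$, which does not depend on $x$.\<close>

lemma nn_integral_measure_cball:
  assumes \<mu>: "intensity (\<mu> :: 'a measure)"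
  shows "(\<integral>\<^sup>+z. ennreal (measure \<mu> (cball z r)) \<partial>\<eta>) = ennreal (measure \<mu> UNIV * h r)"
proof -
  interpret \<mu>: finite_measure \<mu> using \<mu> by (simp add: intensity_def)
  have s\<mu>: "sets \<mu> = sets borel" using \<mu> by (simp add: intensity_def)
  interpret P: pair_sigma_finite \<mu> \<eta> ..
  have C: "{p \<in> space (borel \<Otimes>\<^sub>M borel). dist (fst p) (snd p) \<le> r} \<in> sets (borel \<Otimes>\<^sub>M (borel :: 'a measure))"
    by measurable
  have m: "(\<lambda>(x, z). indicator (cball z r) x :: ennreal) \<in> borel_measurable (\<mu> \<Otimes>\<^sub>M \<eta>)"
  proof -
    have "(\<lambda>(x, z :: 'a). indicator (cball z r) x :: ennreal)
        = indicator {p \<in> space (borel \<Otimes>\<^sub>M borel). dist (fst p) (snd p) \<le> r}"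
      by (auto simp: fun_eq_iff indicator_def space_pair_measure dist_commute)
    then show ?thesis
      unfolding measurable_cong_sets[OF sets_pair_measure_cong[OF s\<mu> sets_eq] refl]
      by (simp only: borel_measurable_indicator[OF C])
  qed
  have "(\<integral>\<^sup>+z. ennreal (measure \<mu> (cball z r)) \<partial>\<eta>) = (\<integral>\<^sup>+z. (\<integral>\<^sup>+x. indicator (cball z r) x \<partial>\<mu>) \<partial>\<eta>)"
    by (simp add: s\<mu> \<mu>.emeasure_eq_measure)
  also have "\<dots> = (\<integral>\<^sup>+x. (\<integral>\<^sup>+z. indicator (cball z r) x \<partial>\<eta>) \<partial>\<mu>)"
    using P.Fubini'[OF m] by simp
  also have "\<dots> = (\<integral>\<^sup>+x. ennreal (h r) \<partial>\<mu>)"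
  proof (rule nn_integral_cong)
    fix x
    have "(\<integral>\<^sup>+z. indicator (cball z r) x \<partial>\<eta>) = (\<integral>\<^sup>+z. indicator (cball x r) z \<partial>\<eta>)"
      by (intro nn_integral_cong) (simp add: indicator_def dist_commute)
    also have "\<dots> = ennreal (h r)" by (simp add: sets_eq emeasure_eq_measure measure_cball)
    finally show "(\<integral>\<^sup>+z. indicator (cball z r) x \<partial>\<eta>) = ennreal (h r)" .
  qed
  also have "\<dots> = ennreal (measure \<mu> UNIV * h r)"
    by (simp add: space_intensity[OF \<mu>] \<mu>.emeasure_eq_measure ennreal_mult' h_def mult.commute)
  finally show ?thesis .
qed

lemma annulus:
  fixes k n :: nat
  assumes "k < n"
  shows "measure \<eta> (cball z (rad (real (Suc k) / n)) - cball z (rad (k / n))) = m / n"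
    and "cball z (rad (k / n)) \<subseteq> cball z (rad (real (Suc k) / n))"
proof -
  have le: "real k / n \<le> real (Suc k) / n" "real (Suc k) / n \<le> 1" "0 \<le> real k / n"
    using assms by (simp_all add: divide_simps)
  show sub: "cball z (rad (k / n)) \<subseteq> cball z (rad (real (Suc k) / n))"
    by (intro subset_cball monoD[OF mono_rad] le)
  have "measure \<eta> (cball z (rad (real (Suc k) / n)) - cball z (rad (k / n)))
      = h (rad (real (Suc k) / n)) - h (rad (k / n))"
    using sub by (subst finite_measure_Diff) (simp_all add: sets_eq measure_cball)
  also have "\<dots> = real (Suc k) / n * m - k / n * m"
    using le by (subst (1 2) h_rad) linarith+
  also have "\<dots> = m / n" by (simp add: add_divide_distrib ring_distribs)
  finally show "measure \<eta> (cball z (rad (real (Suc k) / n)) - cball z (rad (k / n))) = m / n" .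
qed

end

section \<open>The value of a uniform player\<close>

text \<open>The left Riemann sum of a decreasing function is an upper bound, and it exceeds the right one by at most $q(0)/n$.\<close>

lemma nn_integral_le_right_sum:
  fixes q :: "real \<Rightarrow> real"
  assumes anti: "\<And>s t. 0 \<le> s \<Longrightarrow> s \<le> t \<Longrightarrow> t \<le> 1 \<Longrightarrow> q t \<le> q s" and nonneg: "\<And>t. 0 \<le> q t" and n: "0 < n"
  shows "(\<integral>\<^sup>+t\<in>{0..1}. ennreal (q t) \<partial>lborel)
    \<le> ennreal ((\<Sum>k<n. q (real (Suc k) / real n)) / real n + q 0 / real n)"
proof -
  have "(\<integral>\<^sup>+t\<in>{0..1}. ennreal (q t) \<partial>lborel)
      \<le> (\<integral>\<^sup>+t. (\<Sum>k<n. ennreal (q (real k / real n)) * indicator {real k / n..real (Suc k) / n} t) \<partial>lborel)"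
  proof (rule nn_integral_mono)
    fix t :: real
    show "ennreal (q t) * indicator {0..1} t
        \<le> (\<Sum>k<n. ennreal (q (real k / real n)) * indicator {real k / n..real (Suc k) / n} t)"
    proof (cases "t \<in> {0..1}")
      case True
      then have t: "0 \<le> t" "t \<le> 1" by simp_all
      \<comment> \<open>The minimum puts the right end point $1$ into the last interval.\<close>
      define k where "k = min (n - 1) (nat \<lfloor>real n * t\<rfloor>)"
      have "k \<le> n - 1" by (simp add: k_def)
      then have k: "k < n" using n by linarith
      have nt: "0 \<le> real n * t" "real n * t \<le> real n" using t mult_left_le[of t "real n"] by simp_all
      have "real k \<le> real (nat \<lfloor>real n * t\<rfloor>)" by (simp add: k_def)
      also have "\<dots> \<le> real n * t" using nt(1) by simp
      finally have k1: "real k / n \<le> t" using n by (simp add: pos_divide_le_eq mult.commute)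
      have "real n * t \<le> real (Suc k)"
      proof (cases "n - 1 \<le> nat \<lfloor>real n * t\<rfloor>")
        case True
        then have "Suc k = n" using n by (simp add: k_def)
        then show ?thesis using nt(2) by simp
      next
        case False
        then have "k = nat \<lfloor>real n * t\<rfloor>" by (simp add: k_def)
        then show ?thesis using nt(1) by linarith
      qed
      then have k2: "t \<le> real (Suc k) / n" using n by (simp only: pos_le_divide_eq of_nat_0_less_iff mult.commute)
      have "ennreal (q t) * indicator {0..1} t
          \<le> ennreal (q (real k / real n)) * indicator {real k / n..real (Suc k) / n} t"
        using True k1 k2 anti[OF _ k1 t(2)] by (simp add: indicator_def ennreal_leI)
      also have "\<dots> \<le> (\<Sum>k<n. ennreal (q (real k / real n)) * indicator {real k / n..real (Suc k) / n} t)"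
        using k by (intro member_le_sum) simp_all
      finally show ?thesis .
    qed simp
  qed
  also have "\<dots> = (\<Sum>k<n. ennreal (q (real k / real n)) * ennreal (1 / real n))"
  proof (subst nn_integral_sum)
    have "real (Suc k) / n - real k / n = 1 / n" "real k / n \<le> real (Suc k) / n" for k
      using n by (simp_all add: diff_divide_distrib[symmetric] divide_right_mono)
    then show "(\<Sum>k<n. \<integral>\<^sup>+t. ennreal (q (real k / real n)) * indicator {real k / n..real (Suc k) / n} t \<partial>lborel)
        = (\<Sum>k<n. ennreal (q (real k / real n)) * ennreal (1 / real n))"
      by (intro sum.cong refl) (simp add: nn_integral_cmult_indicator)
  qed simp
  also have "\<dots> = ennreal ((\<Sum>k<n. q (real k / real n)) * (1 / real n))"
    by (simp add: sum_distrib_right[symmetric] sum_ennreal nonneg sum_nonneg ennreal_mult'[symmetric] sum_divide_distrib)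
  also have "\<dots> \<le> ennreal ((q 0 + (\<Sum>k<n. q (real (Suc k) / real n))) * (1 / real n))"
  proof (intro ennreal_leI mult_right_mono)
    have "(\<Sum>k<n. q (real k / real n)) \<le> (\<Sum>k<Suc n. q (real k / real n))" by (simp add: nonneg)
    also have "\<dots> = q 0 + (\<Sum>k<n. q (real (Suc k) / real n))"
      by (subst sum.lessThan_Suc_shift) simp
    finally show "(\<Sum>k<n. q (real k / real n)) \<le> q 0 + (\<Sum>k<n. q (real (Suc k) / real n))" .
  qed simp
  finally show ?thesis by (simp add: add_divide_distrib add.commute)
qed

lemma points_in_eq_0_iff: "points_in B \<phi> = 0 \<longleftrightarrow> (\<forall>x\<in>#\<phi>. x \<notin> B)"
  by (induction \<phi>) auto

lemma points_in_eq_1D: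
  assumes "points_in B \<phi> = 1"
  obtains x where "x \<in># \<phi>" "x \<in> B" "\<And>y. y \<in># \<phi> \<Longrightarrow> y \<in> B \<Longrightarrow> y = x"
proof -
  from assms obtain x where "filter_mset (\<lambda>x. x \<in> B) \<phi> = {#x#}"
    unfolding points_in_def using size_1_singleton_mset by blast
  then have "{y. y \<in># \<phi> \<and> y \<in> B} = {x}" by (metis set_mset_filter set_mset_single)
  then show thesis using that[of x] by blast
qed

lemma in_sum_mset_iff:
  assumes "finite I"
  shows "x \<in># (\<Sum>j\<in>I. \<phi> j) \<longleftrightarrow> (\<exists>j\<in>I. x \<in># \<phi> j)"
  using assms by (induction I rule: finite_induct) auto

text \<open>The event is phrased in counts on disjoint sets, so that its probability can be read off the definition of a Poisson
process: $z$ is won by the single point of process $i$ in the ring if the inner ball has no point of that process and the outer ball has none of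
the others.\<close>

lemma in_voronoi_cell_of_nearest:
  assumes fin: "finite I" and i: "i \<in> I" and rs: "r \<le> s"
    and one: "points_in (cball z s - cball z r) (\<phi> i) = 1" and none: "points_in (cball z r) (\<phi> i) = 0"
    and others: "\<And>j. j \<in> I - {i} \<Longrightarrow> points_in (cball z s) (\<phi> j) = 0"
  obtains x where "x \<in># \<phi> i" "z \<in> voronoi_cell (\<Sum>j\<in>I. \<phi> j) x"
proof -
  obtain x where x: "x \<in># \<phi> i" "x \<in> cball z s - cball z r"
      "\<And>y. y \<in># \<phi> i \<Longrightarrow> y \<in> cball z s - cball z r \<Longrightarrow> y = x"
    by (rule points_in_eq_1D[OF one]) blast
  have far: "y \<notin> cball z s" if y: "y \<in># (\<Sum>j\<in>I. \<phi> j)" "y \<noteq> x" for y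
  proof -
    from y(1) have "\<exists>j\<in>I. y \<in># \<phi> j" by (simp only: in_sum_mset_iff[OF fin])
    then obtain j where j: "j \<in> I" "y \<in># \<phi> j" by blast
    show ?thesis
    proof (cases "j = i")
      case True
      then have y': "y \<in># \<phi> i" using j(2) by simp
      then have "y \<notin> cball z r" using none points_in_eq_0_iff[of "cball z r" "\<phi> i"] by blast
      moreover have "y \<notin> cball z s - cball z r" using x(3)[OF y'] y(2) by blast
      ultimately show ?thesis by blast
    next
      case False
      then have "points_in (cball z s) (\<phi> j) = 0" using others j(1) by blast
      then show ?thesis using j(2) points_in_eq_0_iff[of "cball z s" "\<phi> j"] by blast
    qed
  qed
  have "z \<in> voronoi_cell (\<Sum>j\<in>I. \<phi> j) x"
    unfolding voronoi_cell_def
  proof (intro CollectI ballI impI)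
    fix y assume "y \<in># (\<Sum>j\<in>I. \<phi> j)" "y \<noteq> x"
    from far[OF this] have "s < dist y z" by (simp add: dist_commute not_le)
    moreover have "dist x z \<le> s" using x(2) by (simp add: dist_commute)
    ultimately show "dist x z < dist y z" by linarith
  qed
  with x(1) show thesis by (rule that)
qed

context homogeneous_space
begin

text \<open>Location $z$ is won in the $k$-th of $n$ rings of equal measure around it, detected as in \<open>in_voronoi_cell_of_nearest\<close>.\<close>

definition hit :: "'i set \<Rightarrow> 'i \<Rightarrow> nat \<Rightarrow> nat \<Rightarrow> 'a \<Rightarrow> ('i \<Rightarrow> 'a multiset) \<Rightarrow> bool" where
  "hit I i n k z \<phi> \<longleftrightarrow>
     points_in (cball z (rad (real (Suc k) / n)) - cball z (rad (k / n))) (\<phi> i) = 1 \<and>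
     points_in (cball z (rad (k / n))) (\<phi> i) = 0 \<and>
     (\<forall>j\<in>I - {i}. points_in (cball z (rad (real (Suc k) / n))) (\<phi> j) = 0)"

lemma hit_disjoint:
  assumes "hit I i n k z \<phi>" "hit I i n l z \<phi>" "k < n" "l < n"
  shows "k = l"
proof -
  have False if kl: "k < l" and hk: "hit I i n k z \<phi>" and hl: "hit I i n l z \<phi>" for k l
  proof -
    have "points_in (cball z (rad (real (Suc k) / n)) - cball z (rad (k / n))) (\<phi> i) = 1"
      using hk by (simp only: hit_def)
    then obtain x where x: "x \<in># \<phi> i" "x \<in> cball z (rad (real (Suc k) / n)) - cball z (rad (k / n))"
      by (rule points_in_eq_1D)
    have "real (Suc k) / n \<le> real l / n" using kl by (intro divide_right_mono) simp_all
    then have "rad (real (Suc k) / n) \<le> rad (real l / n)" by (rule monoD[OF mono_rad])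
    then have "x \<in> cball z (rad (real l / n))" using x(2) by simp
    moreover have "points_in (cball z (rad (real l / n))) (\<phi> i) = 0" using hl by (simp only: hit_def)
    ultimately show False using x(1) unfolding points_in_eq_0_iff by blast
  qed
  from this[of k l] this[of l k] assms(1,2) show ?thesis by (meson linorder_neqE_nat)
qed

text \<open>At most one ring is hit around each $z$, and then $z$ lies in a cell of a point of process $i$.\<close>

lemma sum_cells_ge:
  fixes \<phi> :: "'i \<Rightarrow> 'a multiset"
  assumes fin: "finite I" and i: "i \<in> I"
  shows "(\<integral>\<^sup>+z. (\<Sum>k<n. if hit I i n k z \<phi> then 1 else 0) \<partial>\<eta>)
      \<le> (\<Sum>x\<in>#\<phi> i. emeasure \<eta> (voronoi_cell (\<Sum>j\<in>I. \<phi> j) x))"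
proof -
  let ?W = "\<lambda>x. voronoi_cell (\<Sum>j\<in>I. \<phi> j) x"
  have W: "?W x \<in> sets \<eta>" for x using open_voronoi_cell[of "\<Sum>j\<in>I. \<phi> j" x] by (simp add: sets_eq)
  have "(\<integral>\<^sup>+z. (\<Sum>k<n. if hit I i n k z \<phi> then 1 else 0) \<partial>\<eta>) \<le> (\<integral>\<^sup>+z. (\<Sum>x\<in>#\<phi> i. indicator (?W x) z) \<partial>\<eta>)"
  proof (rule nn_integral_mono)
    fix z
    show "(\<Sum>k<n. if hit I i n k z \<phi> then 1 else 0) \<le> (\<Sum>x\<in>#\<phi> i. indicator (?W x) z :: ennreal)"
    proof (cases "\<exists>k<n. hit I i n k z \<phi>")
      case True
      then obtain k where k: "k < n" "hit I i n k z \<phi>" by blast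
      have "hit I i n l z \<phi> \<longleftrightarrow> l = k" if "l < n" for l
        using hit_disjoint[OF _ k(2) that k(1)] k(2) by blast
      then have "(\<Sum>l<n. if hit I i n l z \<phi> then 1 else 0) = (\<Sum>l<n. if l = k then 1 else 0 :: ennreal)"
        by (intro sum.cong) simp_all
      then have one: "(\<Sum>l<n. if hit I i n l z \<phi> then 1 else 0) = (1 :: ennreal)" using k(1) by simp
      have "real k / n \<le> real (Suc k) / n" by (intro divide_right_mono) simp_all
      then have rs: "rad (k / n) \<le> rad (real (Suc k) / n)" by (rule monoD[OF mono_rad])
      obtain x where x: "x \<in># \<phi> i" "z \<in> ?W x"
      proof (rule in_voronoi_cell_of_nearest[OF fin i rs])
        show "points_in (cball z (rad (real (Suc k) / n)) - cball z (rad (k / n))) (\<phi> i) = 1"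
          and "points_in (cball z (rad (k / n))) (\<phi> i) = 0"
          and "\<And>j. j \<in> I - {i} \<Longrightarrow> points_in (cball z (rad (real (Suc k) / n))) (\<phi> j) = 0"
          using k(2) unfolding hit_def by blast+
      qed (rule that)
      have "(1 :: ennreal) = indicator (?W x) z" using x(2) by simp
      also have "\<dots> \<le> (\<Sum>x\<in>#\<phi> i. indicator (?W x) z)"
      proof -
        obtain \<psi> where "\<phi> i = add_mset x \<psi>" using x(1) by (metis insert_DiffM)
        then show ?thesis by simp
      qed
      finally show ?thesis by (simp only: one)
    next
      case False
      then have "(\<Sum>k<n. if hit I i n k z \<phi> then 1 else 0) = (\<Sum>k<n. 0 :: ennreal)"
        by (intro sum.cong) auto
      then show ?thesis by simp
    qed
  qed
  also have "\<dots> = (\<Sum>x\<in>#\<phi> i. emeasure \<eta> (?W x))"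
  proof -
    have "(\<integral>\<^sup>+z. (\<Sum>x\<in>#\<psi>. indicator (?W x) z) \<partial>\<eta>) = (\<Sum>x\<in>#\<psi>. emeasure \<eta> (?W x))
        \<and> (\<lambda>z. \<Sum>x\<in>#\<psi>. indicator (?W x) z :: ennreal) \<in> borel_measurable \<eta>" for \<psi>
    proof (induction \<psi>)
      case (add x \<psi>)
      have x: "(\<lambda>z. indicator (?W x) z :: ennreal) \<in> borel_measurable \<eta>"
        by (rule borel_measurable_indicator[OF W])
      show ?case
        unfolding image_mset_add_mset sum_mset.add_mset
        using nn_integral_add[OF x conjunct2[OF add.IH]] borel_measurable_add[OF x conjunct2[OF add.IH]]
          conjunct1[OF add.IH] nn_integral_indicator[OF W, of x] by simp
    qed simp
    then show ?thesis by blast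
  qed
  finally show ?thesis .
qed

lemma measurable_points_in_PiM:
  fixes f :: "'i \<Rightarrow> 'a measure"
  assumes f: "\<And>j. j \<in> I \<Longrightarrow> intensity (f j)" and j: "j \<in> I" and C: "C \<in> sets (borel \<Otimes>\<^sub>M borel)"
  shows "(\<lambda>(\<phi>, z). real (points_in {x. (x, z) \<in> C} (\<phi> j)))
    \<in> borel_measurable ((\<Pi>\<^sub>M j\<in>I. poisson_law (f j)) \<Otimes>\<^sub>M \<eta>)"
proof -
  have C': "C \<in> sets (borel \<Otimes>\<^sub>M \<eta>)" using C sets_pair_measure_cong[OF refl sets_eq] by blast
  have "(\<lambda>\<phi>. \<phi> j) \<in> (\<Pi>\<^sub>M j\<in>I. poisson_law (f j)) \<rightarrow>\<^sub>M configurations"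
    using measurable_component_singleton[OF j, of "\<lambda>j. poisson_law (f j)"]
    by (simp add: measurable_cong_sets[OF refl poisson_law_intensity(2)[OF f[OF j]]])
  then have "(\<lambda>p. (fst p j, snd p)) \<in> (\<Pi>\<^sub>M j\<in>I. poisson_law (f j)) \<Otimes>\<^sub>M \<eta> \<rightarrow>\<^sub>M configurations \<Otimes>\<^sub>M \<eta>"
    by (intro measurable_Pair measurable_snd measurable_compose[OF measurable_fst])
  from measurable_compose[OF this measurable_points_in_section[OF C']]
  show ?thesis by (simp add: case_prod_unfold)
qed

lemma measurable_hit:
  fixes f :: "'i \<Rightarrow> 'a measure"
  assumes fin: "finite I" and i: "i \<in> I" and f: "\<And>j. j \<in> I \<Longrightarrow> intensity (f j)"
  defines "L \<equiv> \<Pi>\<^sub>M j\<in>I. poisson_law (f j)"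
  shows "{p \<in> space (L \<Otimes>\<^sub>M \<eta>). hit I i n k (snd p) (fst p)} \<in> sets (L \<Otimes>\<^sub>M \<eta>)"
proof -
  let ?B = "\<lambda>r. {p :: 'a \<times> 'a. dist (snd p) (fst p) \<le> r}"
  have B: "?B r \<in> sets (borel \<Otimes>\<^sub>M borel)" for r
  proof -
    have "{p \<in> space (borel \<Otimes>\<^sub>M borel). dist (snd p) (fst p) \<le> r} \<in> sets (borel \<Otimes>\<^sub>M (borel :: 'a measure))"
      by measurable
    then show ?thesis by (simp add: space_pair_measure)
  qed
  have level: "{p \<in> space (L \<Otimes>\<^sub>M \<eta>). points_in {x. (x, snd p) \<in> C} (fst p j) = v} \<in> sets (L \<Otimes>\<^sub>M \<eta>)"
    if "j \<in> I" "C \<in> sets (borel \<Otimes>\<^sub>M borel)" for j C v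
  proof -
    have "(\<lambda>(\<phi>, z). real (points_in {x. (x, z) \<in> C} (\<phi> j))) \<in> borel_measurable (L \<Otimes>\<^sub>M \<eta>)"
      unfolding L_def by (rule measurable_points_in_PiM[OF f that])
    from measurable_sets[OF this, of "{real v}"] show ?thesis
      by (simp add: case_prod_unfold vimage_def Int_def conj_commute)
  qed
  have ball: "cball z r = {x. (x, z) \<in> ?B r}"
    and ring: "cball z r - cball z s = {x. (x, z) \<in> ?B r - ?B s}" for z r s
    by auto
  show ?thesis
    unfolding hit_def ring unfolding ball
    using fin i B by (intro sets.sets_Collect_conj sets.sets_Collect_finite_All level sets.Diff) auto
qed

text \<open>If player $i$ plays the constant density, each ring carries intensity $r/n$ and the ball inside it $r k / n$; the
processes are independent.\<close>

lemma emeasure_hit: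
  fixes f :: "'i \<Rightarrow> 'a measure"
  assumes fin: "finite I" and i: "i \<in> I" and f: "\<And>j. j \<in> I \<Longrightarrow> intensity (f j)"
    and fi: "\<And>B. B \<in> sets borel \<Longrightarrow> measure (f i) B = r / m * measure \<eta> B" and k: "k < n"
  defines "L \<equiv> \<Pi>\<^sub>M j\<in>I. poisson_law (f j)"
  shows "emeasure L {\<phi> \<in> space L. hit I i n k z \<phi>}
    = ennreal (r / n * (exp (- (r * (real (Suc k) / n)))
        * exp (- (\<Sum>j\<in>I - {i}. measure (f j) (cball z (rad (real (Suc k) / n)))))))"
proof -
  interpret L: prob_space L unfolding L_def using f by (rule prob_space_PiM_poisson)
  let ?b = "cball z (rad (k / n))" and ?b' = "cball z (rad (real (Suc k) / n))"
  let ?A = "\<lambda>j. if j = i then {\<phi>. points_in (?b' - ?b) \<phi> = 1 \<and> points_in ?b \<phi> = 0} else {\<phi>. points_in ?b' \<phi> = 0}"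
  have lev: "{\<phi>. points_in B \<phi> = v} \<in> sets configurations" if "B \<in> sets borel" for B :: "'a set" and v
    using sets_points_in[OF that, of "{v}"] by simp
  have bb: "?b \<in> sets borel" "?b' \<in> sets borel" "?b' - ?b \<in> sets borel" by simp_all
  have A: "?A j \<in> sets configurations" for j
  proof (cases "j = i")
    case True
    have "{\<phi>. points_in (?b' - ?b) \<phi> = 1 \<and> points_in ?b \<phi> = 0}
        = {\<phi>. points_in (?b' - ?b) \<phi> = 1} \<inter> {\<phi>. points_in ?b \<phi> = 0}" by blast
    then show ?thesis using True lev[OF bb(1)] lev[OF bb(3)] by simp
  next
    case False then show ?thesis using lev[OF bb(2)] by simp
  qed
  have "{\<phi> \<in> space L. hit I i n k z \<phi>} = {\<phi> \<in> space L. \<forall>j\<in>I. \<phi> j \<in> ?A j}"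
    using i unfolding hit_def by auto
  then have "measure L {\<phi> \<in> space L. hit I i n k z \<phi>} = (\<Prod>j\<in>I. measure (poisson_law (f j)) (?A j))"
    unfolding L_def using measure_PiM_poisson_box(2)[of I f ?A, OF fin f A] by simp
  also have "\<dots> = measure (poisson_law (f i)) (?A i) * (\<Prod>j\<in>I - {i}. measure (poisson_law (f j)) (?A j))"
    by (rule prod.remove[OF fin i])
  also have "(\<Prod>j\<in>I - {i}. measure (poisson_law (f j)) (?A j)) = (\<Prod>j\<in>I - {i}. exp (- measure (f j) ?b'))"
    using f bb(2) by (intro prod.cong refl) (simp add: measure_poisson_law_void)
  also have "\<dots> = exp (- (\<Sum>j\<in>I - {i}. measure (f j) ?b'))"
    using fin by (simp add: exp_sum[symmetric] sum_negf)
  also have "measure (poisson_law (f i)) (?A i) = r / n * exp (- (r * (real (Suc k) / n)))"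
  proof -
    have "measure (poisson_law (f i)) (?A i)
        = measure (f i) (?b' - ?b) * exp (- measure (f i) (?b' - ?b)) * exp (- measure (f i) ?b)"
      using measure_poisson_law_one[OF f[OF i] bb(3) bb(1)] by (simp only: Diff_disjoint Int_commute simp_thms if_True)
    also have "measure (f i) (?b' - ?b) = r / m * (m / n)"
      by (simp only: fi[OF bb(3)] annulus(1)[OF k])
    also have "\<dots> = r / n" using pos by simp
    also have "measure (f i) ?b = r * (real k / n)"
      using pos k by (simp add: fi[OF bb(1)] measure_cball h_rad)
    also have "r / n * exp (- (r / n)) * exp (- (r * (real k / n))) = r / n * exp (- (r * (real (Suc k) / n)))"
      by (simp add: exp_add[symmetric] mult.assoc add_divide_distrib ring_distribs)
    finally show ?thesis .
  qed
  finally show ?thesis by (simp add: L.emeasure_eq_measure mult.assoc)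
qed

text \<open>The probabilities of being hit in the rings form a Riemann sum of the inner integral. The integrand is decreasing in $t$, so
the sum falls short of the integral by at most $r/n$, uniformly in $z$.\<close>

lemma game_value_ge:
  fixes f :: "nat \<Rightarrow> 'a measure"
  assumes i: "i \<in> {1..N}" and f: "\<And>j. j \<in> {1..N} \<Longrightarrow> intensity (f j)"
    and fi: "\<And>B. B \<in> sets borel \<Longrightarrow> measure (f i) B = r / m * measure \<eta> B" and r: "0 < r"
  shows "(\<integral>\<^sup>+z. (\<integral>\<^sup>+t\<in>{0..1}. ennreal (r * (exp (- (r * t))
      * exp (- (\<Sum>j\<in>{1..N} - {i}. measure (f j) (cball z (rad t)))))) \<partial>lborel) \<partial>\<eta>)
    \<le> game_value \<eta> N f i"
proof -
  let ?I = "{1..N}"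
  define L where "L = (\<Pi>\<^sub>M j\<in>?I. poisson_law (f j))"
  interpret L: prob_space L unfolding L_def using f by (rule prob_space_PiM_poisson)
  interpret P: pair_sigma_finite L \<eta> ..
  define q where "q z t = r * (exp (- (r * t)) * exp (- (\<Sum>j\<in>?I - {i}. measure (f j) (cball z (rad t)))))" for z t
  have q0: "0 \<le> q z t" for z t using r by (simp add: q_def)
  have q_anti: "q z t \<le> q z s" if "s \<le> t" for z s t
    unfolding q_def
  proof (intro mult_left_mono mult_mono)
    have "(\<Sum>j\<in>?I - {i}. measure (f j) (cball z (rad s))) \<le> (\<Sum>j\<in>?I - {i}. measure (f j) (cball z (rad t)))"
    proof (rule sum_mono)
      fix j assume "j \<in> ?I - {i}"
      then have "intensity (f j)" using f by simp
      then interpret F: finite_measure "f j" by (simp add: intensity_def)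
      show "measure (f j) (cball z (rad s)) \<le> measure (f j) (cball z (rad t))"
        using \<open>intensity (f j)\<close> monoD[OF mono_rad that]
        by (intro F.finite_measure_mono subset_cball) (simp_all add: intensity_def)
    qed
    then show "exp (- (\<Sum>j\<in>?I - {i}. measure (f j) (cball z (rad t))))
        \<le> exp (- (\<Sum>j\<in>?I - {i}. measure (f j) (cball z (rad s))))" by simp
    show "exp (- (r * t)) \<le> exp (- (r * s))" using r that by simp
  qed (use r in simp_all)
  have q_le: "q z 0 \<le> r" for z using r by (simp add: q_def sum_nonneg)
  have q_meas: "(\<lambda>z. q z t) \<in> borel_measurable \<eta>" for t
  proof -
    have "(\<lambda>z. measure (f j) (cball z (rad t))) \<in> borel_measurable \<eta>" if "j \<in> ?I" for j
    proof -
      have "(\<lambda>z. (z, t)) \<in> \<eta> \<rightarrow>\<^sub>M borel \<Otimes>\<^sub>M borel"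
        unfolding measurable_cong_sets[OF sets_eq refl] by simp
      from measurable_compose[OF this borel_measurable_measure_cball[OF f[OF that]]]
      show ?thesis by simp
    qed
    then show ?thesis unfolding q_def
      by (intro borel_measurable_times borel_measurable_const borel_measurable_exp[THEN measurable_compose[rotated]]
          borel_measurable_uminus borel_measurable_sum) simp
  qed
  have approx: "(\<integral>\<^sup>+z. ennreal ((\<Sum>k<n. q z (real (Suc k) / real n)) / real n) \<partial>\<eta>) \<le> game_value \<eta> N f i"
    if n: "0 < n" for n
  proof -
    let ?g = "\<lambda>p. \<Sum>k<n. if hit ?I i n k (snd p) (fst p) then 1 else 0 :: ennreal"
    have hm: "{p \<in> space (L \<Otimes>\<^sub>M \<eta>). hit ?I i n k (snd p) (fst p)} \<in> sets (L \<Otimes>\<^sub>M \<eta>)" for k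
      unfolding L_def by (rule measurable_hit[OF _ i f]) simp_all
    have gm: "?g \<in> borel_measurable (L \<Otimes>\<^sub>M \<eta>)"
      using hm by (intro borel_measurable_sum measurable_If) simp_all
    have "(\<integral>\<^sup>+z. ennreal ((\<Sum>k<n. q z (real (Suc k) / real n)) / real n) \<partial>\<eta>)
        = (\<integral>\<^sup>+z. (\<integral>\<^sup>+\<phi>. ?g (\<phi>, z) \<partial>L) \<partial>\<eta>)"
    proof (rule nn_integral_cong)
      fix z
      have hz: "{\<phi> \<in> space L. hit ?I i n k z \<phi>} \<in> sets L" for k
      proof -
        have "(\<lambda>\<phi>. (\<phi>, z)) \<in> L \<rightarrow>\<^sub>M L \<Otimes>\<^sub>M \<eta>" by (simp add: space_eq)
        from measurable_sets[OF this hm] show ?thesis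
          by (simp add: vimage_def Int_def space_pair_measure space_eq conj_commute)
      qed
      have "(\<integral>\<^sup>+\<phi>. ?g (\<phi>, z) \<partial>L)
          = (\<Sum>k<n. \<integral>\<^sup>+\<phi>. (if hit ?I i n k z \<phi> then 1 else 0) \<partial>L)"
        using hz by (simp add: nn_integral_sum)
      also have "\<dots> = (\<Sum>k<n. emeasure L {\<phi> \<in> space L. hit ?I i n k z \<phi>})"
      proof (rule sum.cong[OF refl])
        fix k
        have "(\<integral>\<^sup>+\<phi>. (if hit ?I i n k z \<phi> then 1 else 0) \<partial>L)
            = (\<integral>\<^sup>+\<phi>. indicator {\<phi> \<in> space L. hit ?I i n k z \<phi>} \<phi> \<partial>L)"
          by (intro nn_integral_cong) (simp add: indicator_def)
        then show "(\<integral>\<^sup>+\<phi>. (if hit ?I i n k z \<phi> then 1 else 0) \<partial>L) = emeasure L {\<phi> \<in> space L. hit ?I i n k z \<phi>}"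
          using hz by simp
      qed
      also have "\<dots> = (\<Sum>k<n. ennreal (q z (real (Suc k) / real n) / real n))"
      proof (rule sum.cong[OF refl])
        fix k assume "k \<in> {..<n}"
        then have k: "k < n" by simp
        have "emeasure L {\<phi> \<in> space L. hit ?I i n k z \<phi>}
            = ennreal (r / n * (exp (- (r * (real (Suc k) / n)))
                * exp (- (\<Sum>j\<in>?I - {i}. measure (f j) (cball z (rad (real (Suc k) / n)))))))"
          unfolding L_def by (rule emeasure_hit[OF finite_atLeastAtMost i f _ k]) (assumption | rule fi)+
        then show "emeasure L {\<phi> \<in> space L. hit ?I i n k z \<phi>} = ennreal (q z (real (Suc k) / real n) / real n)"
          unfolding q_def by (simp only: times_divide_eq_left)
      qed
      also have "\<dots> = ennreal ((\<Sum>k<n. q z (real (Suc k) / real n)) / real n)"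
        by (simp add: sum_ennreal q0 sum_divide_distrib)
      finally show "ennreal ((\<Sum>k<n. q z (real (Suc k) / real n)) / real n) = (\<integral>\<^sup>+\<phi>. ?g (\<phi>, z) \<partial>L)" ..
    qed
    also have "\<dots> = (\<integral>\<^sup>+\<phi>. (\<integral>\<^sup>+z. ?g (\<phi>, z) \<partial>\<eta>) \<partial>L)"
      by (rule P.Fubini') (use gm in \<open>simp add: case_prod_unfold\<close>)
    also have "\<dots> \<le> (\<integral>\<^sup>+\<phi>. (\<Sum>x\<in>#\<phi> i. emeasure \<eta> (voronoi_cell (\<Sum>j\<in>?I. \<phi> j) x)) \<partial>L)"
      using sum_cells_ge[OF _ i] by (intro nn_integral_mono) simp
    finally show ?thesis unfolding game_value_def L_def[symmetric] .
  qed
  have "(\<integral>\<^sup>+z. (\<integral>\<^sup>+t\<in>{0..1}. ennreal (q z t) \<partial>lborel) \<partial>\<eta>) \<le> game_value \<eta> N f i"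
  proof (rule ennreal_le_epsilon)
    fix e :: real assume e: "0 < e"
    obtain n0 where n0: "r * m / e < real n0" using reals_Archimedean2 by blast
    let ?n = "Suc n0"
    have "r * m / e < real ?n" using n0 by simp
    then have small: "r * m / real ?n \<le> e" using e by (simp add: divide_simps mult.commute)
    have "(\<integral>\<^sup>+z. (\<integral>\<^sup>+t\<in>{0..1}. ennreal (q z t) \<partial>lborel) \<partial>\<eta>)
        \<le> (\<integral>\<^sup>+z. ennreal ((\<Sum>k<?n. q z (real (Suc k) / real ?n)) / real ?n) + ennreal (r / real ?n) \<partial>\<eta>)"
    proof (rule nn_integral_mono)
      fix z
      have "(\<integral>\<^sup>+t\<in>{0..1}. ennreal (q z t) \<partial>lborel)
          \<le> ennreal ((\<Sum>k<?n. q z (real (Suc k) / real ?n)) / real ?n + q z 0 / real ?n)"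
        by (rule nn_integral_le_right_sum) (use q_anti q0 in auto)
      also have "\<dots> \<le> ennreal ((\<Sum>k<?n. q z (real (Suc k) / real ?n)) / real ?n + r / real ?n)"
        using q_le by (intro ennreal_leI add_left_mono divide_right_mono) simp_all
      also have "\<dots> = ennreal ((\<Sum>k<?n. q z (real (Suc k) / real ?n)) / real ?n) + ennreal (r / real ?n)"
        using q0 r by (intro ennreal_plus divide_nonneg_nonneg sum_nonneg) simp_all
      finally show "(\<integral>\<^sup>+t\<in>{0..1}. ennreal (q z t) \<partial>lborel)
          \<le> ennreal ((\<Sum>k<?n. q z (real (Suc k) / real ?n)) / real ?n) + ennreal (r / real ?n)" .
    qed
    also have "\<dots> = (\<integral>\<^sup>+z. ennreal ((\<Sum>k<?n. q z (real (Suc k) / real ?n)) / real ?n) \<partial>\<eta>) + ennreal (r / real ?n) * ennreal m"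
      using q_meas by (subst nn_integral_add) (simp_all add: space_eq emeasure_eq_measure)
    also have "ennreal (r / real ?n) * ennreal m \<le> ennreal e"
      using small r by (simp add: ennreal_mult'[symmetric] ennreal_leI)
    also have "(\<integral>\<^sup>+z. ennreal ((\<Sum>k<?n. q z (real (Suc k) / real ?n)) / real ?n) \<partial>\<eta>) \<le> game_value \<eta> N f i"
      by (rule approx) simp
    finally show "(\<integral>\<^sup>+z. (\<integral>\<^sup>+t\<in>{0..1}. ennreal (q z t) \<partial>lborel) \<partial>\<eta>) \<le> game_value \<eta> N f i + ennreal e"
      by (simp add: add_mono)
  qed
  then show ?thesis unfolding q_def .
qed

end

section \<open>Jensen's inequality with remainder\<close>

text \<open>The distance of the convex function $u \mapsto e^{-u}$ from its tangent line at $a$. It measures by how much Jensen's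
inequality fails to be an equality.\<close>

definition gap :: "real \<Rightarrow> real \<Rightarrow> real" where
  "gap u a = exp (- u) - exp (- a) * (1 + a - u)"

lemma gap_eq: "gap u a = exp (- a) * (exp (a - u) - (1 + (a - u)))"
proof -
  have "exp (- u) = exp (- a) * exp (a - u)" by (simp add: exp_add[symmetric])
  then show ?thesis by (simp add: gap_def algebra_simps)
qed

lemma gap_nonneg: "0 \<le> gap u a"
  unfolding gap_eq using exp_ge_add_one_self[of "a - u"] by simp

lemma gap_eq_0_iff: "gap u a = 0 \<longleftrightarrow> u = a"
proof
  assume "gap u a = 0"
  then have "exp (a - u) = 1 + (a - u)" unfolding gap_eq by simp
  then have "ln (exp (a - u)) = exp (a - u) - 1" unfolding ln_exp by linarith
  then have "exp (a - u) = 1" by (intro ln_eq_minus_one) simp_all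
  then show "u = a" by simp
qed (simp add: gap_def)

lemma borel_measurable_gap [measurable]:
  assumes [measurable]: "u \<in> borel_measurable M" "a \<in> borel_measurable M"
  shows "(\<lambda>x. gap (u x) (a x)) \<in> borel_measurable M"
  unfolding gap_def by measurable

lemma ex_in_interval_of_AE_lborel:
  fixes a b :: real
  assumes "AE x in lborel. P x" "a < b"
  obtains x where "a < x" "x < b" "P x"
proof -
  obtain N where N: "{x \<in> space lborel. \<not> P x} \<subseteq> N" "emeasure lborel N = 0" "N \<in> sets lborel"
    using assms(1) by (rule AE_E)
  have "\<not> {a<..<b} \<subseteq> N"
  proof
    assume "{a<..<b} \<subseteq> N"
    then have "emeasure lborel {a<..<b} \<le> 0" using emeasure_mono[of "{a<..<b}" N lborel] N by simp
    then show False using assms(2) by simp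
  qed
  then obtain x where "x \<in> {a<..<b}" "x \<notin> N" by blast
  then show thesis using N(1) that[of x] by auto
qed

context homogeneous_space
begin

text \<open>The total remainder in Jensen's inequality, applied at each $t$ to $F(B(z, rad\ t))$, where $F$ is the sum of the actions
$f_j$, $j \in J$, and has mass $s$.\<close>

definition excess :: "real \<Rightarrow> real \<Rightarrow> 'i set \<Rightarrow> ('i \<Rightarrow> 'a measure) \<Rightarrow> ennreal" where
  "excess r s J f = (\<integral>\<^sup>+t. (\<integral>\<^sup>+z. ennreal (r * exp (- (r * t))
       * gap (\<Sum>j\<in>J. measure (f j) (cball z (rad t))) (s * t)) \<partial>\<eta>) * indicator {0..1} t \<partial>lborel)"

lemma borel_measurable_eta_lborel:
  "g \<in> borel_measurable (borel \<Otimes>\<^sub>M borel) \<Longrightarrow> g \<in> borel_measurable (\<eta> \<Otimes>\<^sub>M lborel)"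
  unfolding measurable_cong_sets[OF sets_pair_measure_cong[OF sets_eq sets_lborel] refl] .

lemma borel_measurable_sum_measure_cball:
  assumes "\<And>j. j \<in> J \<Longrightarrow> intensity (f j)"
  shows "(\<lambda>(z, t). \<Sum>j\<in>J. measure (f j) (cball z (rad t))) \<in> borel_measurable (\<eta> \<Otimes>\<^sub>M lborel)"
  using borel_measurable_sum[of J "\<lambda>j (z, t). measure (f j) (cball z (rad t))" "\<eta> \<Otimes>\<^sub>M lborel"]
    borel_measurable_eta_lborel[OF borel_measurable_measure_cball[OF assms]]
  by (simp add: case_prod_unfold)

lemma borel_measurable_gap_integral:
  assumes "\<And>j. j \<in> J \<Longrightarrow> intensity (f j)"
  shows "(\<lambda>t. (\<integral>\<^sup>+z. ennreal (r * exp (- (r * t))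
       * gap (\<Sum>j\<in>J. measure (f j) (cball z (rad t))) (s * t)) \<partial>\<eta>) * indicator {0..1} t) \<in> borel_measurable lborel"
proof -
  define u where "u z t = (\<Sum>j\<in>J. measure (f j) (cball z (rad t)))" for z t
  have "(\<lambda>(z, t). u z t) \<in> borel_measurable (\<eta> \<Otimes>\<^sub>M lborel)"
    unfolding u_def by (rule borel_measurable_sum_measure_cball[OF assms])
  from measurable_pair_swap[OF this]
  have [measurable]: "(\<lambda>p. u (snd p) (fst p)) \<in> borel_measurable (lborel \<Otimes>\<^sub>M \<eta>)"
    by (simp add: case_prod_unfold)
  have "(\<lambda>(t, z). ennreal (r * exp (- (r * t)) * gap (u z t) (s * t))) \<in> borel_measurable (lborel \<Otimes>\<^sub>M \<eta>)"
    unfolding case_prod_unfold by measurable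
  from borel_measurable_nn_integral[OF this]
  have "(\<lambda>t. \<integral>\<^sup>+z. ennreal (r * exp (- (r * t)) * gap (u z t) (s * t)) \<partial>\<eta>) \<in> borel_measurable lborel" .
  then show ?thesis unfolding u_def by (intro borel_measurable_times_ennreal borel_measurable_indicator) simp_all
qed

text \<open>The tangent line is taken at the mean $s t$ of $F(B(z, rad\ t))$, so its linear part integrates to zero.\<close>

lemma nn_integral_exp_tangent:
  fixes f :: "'i \<Rightarrow> 'a measure"
  assumes f: "\<And>j. j \<in> J \<Longrightarrow> intensity (f j)" and s: "s = (\<Sum>j\<in>J. measure (f j) UNIV)"
    and t: "0 \<le> t" "t \<le> 1" and w: "0 \<le> w"
  shows "(\<integral>\<^sup>+z. ennreal (w * exp (- (\<Sum>j\<in>J. measure (f j) (cball z (rad t))))) \<partial>\<eta>)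
    = ennreal (w * exp (- (s * t)) * m)
      + (\<integral>\<^sup>+z. ennreal (w * gap (\<Sum>j\<in>J. measure (f j) (cball z (rad t))) (s * t)) \<partial>\<eta>)"
proof -
  let ?u = "\<lambda>z. \<Sum>j\<in>J. measure (f j) (cball z (rad t))"
  \<comment> \<open>All integrands must be nonnegative, so the linear term is added on both sides and cancelled at the end.\<close>
  define a where "a = s * t"
  have a: "0 \<le> a" using t by (simp add: a_def s sum_nonneg)
  have u0: "0 \<le> ?u z" for z by (simp add: sum_nonneg)
  have fm: "(\<lambda>z. measure (f j) (cball z (rad t))) \<in> borel_measurable \<eta>" if "j \<in> J" for j
  proof -
    have "(\<lambda>z. (z, t)) \<in> \<eta> \<rightarrow>\<^sub>M borel \<Otimes>\<^sub>M borel"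
      unfolding measurable_cong_sets[OF sets_eq refl] by simp
    from measurable_compose[OF this borel_measurable_measure_cball[OF f[OF that]]]
    show ?thesis by simp
  qed
  then have um[measurable]: "?u \<in> borel_measurable \<eta>" by (rule borel_measurable_sum)
  have int_u: "(\<integral>\<^sup>+z. ennreal (w * exp (- a) * ?u z) \<partial>\<eta>) = ennreal (w * exp (- a) * (a * m))"
  proof -
    have "(\<integral>\<^sup>+z. ennreal (w * exp (- a) * ?u z) \<partial>\<eta>) = ennreal (w * exp (- a)) * (\<integral>\<^sup>+z. ennreal (?u z) \<partial>\<eta>)"
      using w u0 by (simp add: ennreal_mult nn_integral_cmult)
    also have "(\<integral>\<^sup>+z. ennreal (?u z) \<partial>\<eta>) = (\<Sum>j\<in>J. \<integral>\<^sup>+z. ennreal (measure (f j) (cball z (rad t))) \<partial>\<eta>)"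
    proof -
      have "(\<integral>\<^sup>+z. ennreal (?u z) \<partial>\<eta>) = (\<integral>\<^sup>+z. (\<Sum>j\<in>J. ennreal (measure (f j) (cball z (rad t)))) \<partial>\<eta>)"
        by (rule nn_integral_cong) (rule sum_ennreal[symmetric], rule measure_nonneg)
      also have "\<dots> = (\<Sum>j\<in>J. \<integral>\<^sup>+z. ennreal (measure (f j) (cball z (rad t))) \<partial>\<eta>)"
        using fm by (intro nn_integral_sum measurable_compose[OF _ measurable_ennreal])
      finally show ?thesis .
    qed
    also have "\<dots> = (\<Sum>j\<in>J. ennreal (measure (f j) UNIV * (t * m)))"
      using f t by (intro sum.cong refl) (simp add: nn_integral_measure_cball h_rad)
    also have "\<dots> = ennreal (a * m)"
      using t by (simp add: sum_ennreal a_def s sum_distrib_right mult.assoc)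
    finally show ?thesis using w a by (simp add: ennreal_mult[symmetric])
  qed
  have "(\<integral>\<^sup>+z. ennreal (w * exp (- ?u z)) \<partial>\<eta>) + ennreal (w * exp (- a) * (a * m))
      = (\<integral>\<^sup>+z. ennreal (w * exp (- ?u z)) + ennreal (w * exp (- a) * ?u z) \<partial>\<eta>)"
    unfolding int_u[symmetric] by (rule nn_integral_add[symmetric]) measurable
  also have "\<dots> = (\<integral>\<^sup>+z. ennreal (w * gap (?u z) a) + ennreal (w * exp (- a) * (1 + a)) \<partial>\<eta>)"
  proof (rule nn_integral_cong)
    fix z
    have "w * exp (- ?u z) + w * exp (- a) * ?u z = w * gap (?u z) a + w * exp (- a) * (1 + a)"
      by (simp add: gap_def algebra_simps)
    then show "ennreal (w * exp (- ?u z)) + ennreal (w * exp (- a) * ?u z)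
        = ennreal (w * gap (?u z) a) + ennreal (w * exp (- a) * (1 + a))"
      using w u0 a gap_nonneg by (simp add: ennreal_plus[symmetric] del: ennreal_plus)
  qed
  also have "\<dots> = (\<integral>\<^sup>+z. ennreal (w * gap (?u z) a) \<partial>\<eta>) + ennreal (w * exp (- a) * (1 + a) * m)"
  proof (subst nn_integral_add)
    have "(\<integral>\<^sup>+z. ennreal (w * exp (- a) * (1 + a)) \<partial>\<eta>) = ennreal (w * exp (- a) * (1 + a) * m)"
      using w a by (simp add: space_eq emeasure_eq_measure ennreal_mult)
    then show "(\<integral>\<^sup>+z. ennreal (w * gap (?u z) a) \<partial>\<eta>) + (\<integral>\<^sup>+z. ennreal (w * exp (- a) * (1 + a)) \<partial>\<eta>)
        = (\<integral>\<^sup>+z. ennreal (w * gap (?u z) a) \<partial>\<eta>) + ennreal (w * exp (- a) * (1 + a) * m)" by (simp only:)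
  qed measurable
  also have "ennreal (w * exp (- a) * (1 + a) * m) = ennreal (w * exp (- a) * m) + ennreal (w * exp (- a) * (a * m))"
    using w a by (simp add: ennreal_plus[symmetric] algebra_simps del: ennreal_plus)
  finally have "ennreal (w * exp (- a) * (a * m)) + (\<integral>\<^sup>+z. ennreal (w * exp (- ?u z)) \<partial>\<eta>)
      = ennreal (w * exp (- a) * (a * m))
        + (ennreal (w * exp (- a) * m) + (\<integral>\<^sup>+z. ennreal (w * gap (?u z) a) \<partial>\<eta>))"
    by (simp only: add_ac)
  then show ?thesis unfolding a_def by (subst (asm) ennreal_add_left_cancel) simp
qed

text \<open>The order of integration in \<open>game_value_ge\<close> is exchanged, so that the tangent line can be used at each $t$. What
remains after the excess is $\int_0^1 r m e^{-(r + s) t}\, dt$.\<close>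

lemma game_value_ge_excess:
  fixes f :: "nat \<Rightarrow> 'a measure"
  assumes i: "i \<in> {1..N}" and f: "\<And>j. j \<in> {1..N} \<Longrightarrow> intensity (f j)"
    and fi: "\<And>B. B \<in> sets borel \<Longrightarrow> measure (f i) B = r / m * measure \<eta> B" and r: "0 < r"
    and s: "s = (\<Sum>j\<in>{1..N} - {i}. measure (f j) UNIV)"
  shows "ennreal (r * m * (1 - exp (- (r + s))) / (r + s)) + excess r s ({1..N} - {i}) f
    \<le> game_value \<eta> N f i"
proof -
  define J where "J = {1..N} - {i}"
  define u where "u z t = (\<Sum>j\<in>J. measure (f j) (cball z (rad t)))" for z t
  define c where "c = r + s"
  interpret P: pair_sigma_finite \<eta> lborel ..
  have fJ: "intensity (f j)" if "j \<in> J" for j using that f by (simp add: J_def)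
  have sJ: "s = (\<Sum>j\<in>J. measure (f j) UNIV)" by (simp add: s J_def)
  have c: "0 < c" using r by (simp add: c_def sJ add_pos_nonneg sum_nonneg)
  have um[measurable]: "(\<lambda>p. u (fst p) (snd p)) \<in> borel_measurable (\<eta> \<Otimes>\<^sub>M lborel)"
    using borel_measurable_sum_measure_cball[of J f, OF fJ] by (simp add: case_prod_unfold u_def)
  have "(\<integral>\<^sup>+z. (\<integral>\<^sup>+t\<in>{0..1}. ennreal (r * (exp (- (r * t)) * exp (- u z t))) \<partial>lborel) \<partial>\<eta>)
      = (\<integral>\<^sup>+t. (\<integral>\<^sup>+z. ennreal (r * (exp (- (r * t)) * exp (- u z t))) * indicator {0..1} t \<partial>\<eta>) \<partial>lborel)"
    by (rule P.Fubini'[symmetric]) (unfold case_prod_unfold, measurable)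
  also have "\<dots> = (\<integral>\<^sup>+t. ennreal (r * m * exp (- c * t)) * indicator {0..1} t
      + (\<integral>\<^sup>+z. ennreal (r * exp (- (r * t)) * gap (u z t) (s * t)) \<partial>\<eta>) * indicator {0..1} t \<partial>lborel)"
  proof (rule nn_integral_cong)
    fix t :: real
    show "(\<integral>\<^sup>+z. ennreal (r * (exp (- (r * t)) * exp (- u z t))) * indicator {0..1} t \<partial>\<eta>)
      = ennreal (r * m * exp (- c * t)) * indicator {0..1} t
      + (\<integral>\<^sup>+z. ennreal (r * exp (- (r * t)) * gap (u z t) (s * t)) \<partial>\<eta>) * indicator {0..1} t"
    proof (cases "t \<in> {0..1}")
      case True
      then have t: "0 \<le> t" "t \<le> 1" and ind: "indicator {0..1} t = (1 :: ennreal)" by simp_all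
      have w: "0 \<le> r * exp (- (r * t))" using r by simp
      have "exp (- c * t) = exp (- (r * t)) * exp (- (s * t))"
        by (simp add: c_def exp_add[symmetric] ring_distribs)
      then have e: "r * exp (- (r * t)) * exp (- (s * t)) * m = r * m * exp (- c * t)"
        by (simp only: mult_ac)
      have "(\<integral>\<^sup>+z. ennreal (r * exp (- (r * t)) * exp (- u z t)) \<partial>\<eta>)
        = ennreal (r * exp (- (r * t)) * exp (- (s * t)) * m)
          + (\<integral>\<^sup>+z. ennreal (r * exp (- (r * t)) * gap (u z t) (s * t)) \<partial>\<eta>)"
        unfolding u_def by (rule nn_integral_exp_tangent[of J f, OF fJ sJ t w])
      then show ?thesis unfolding ind mult_1_right e by (simp only: mult.assoc)
    qed simp
  qed
  also have "\<dots> = (\<integral>\<^sup>+t. ennreal (r * m * exp (- c * t)) * indicator {0..1} t \<partial>lborel) + excess r s J f"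
    unfolding excess_def u_def by (rule nn_integral_add[OF _ borel_measurable_gap_integral[OF fJ]]) simp_all
  also have "(\<integral>\<^sup>+t. ennreal (r * m * exp (- c * t)) * indicator {0..1} t \<partial>lborel)
      = ennreal (r * m * (1 - exp (- c)) / c)"
  proof -
    let ?F = "\<lambda>t. - (r * m * exp (- c * t) / c)"
    have "(\<integral>\<^sup>+t. ennreal (r * m * exp (- c * t)) * indicator {0..1} t \<partial>lborel) = ennreal (?F 1 - ?F 0)"
    proof (rule nn_integral_FTC_Icc)
      fix t :: real
      show "0 \<le> r * m * exp (- c * t)" using r by simp
      show "(?F has_real_derivative r * m * exp (- c * t)) (at t)"
        using c by (auto intro!: derivative_eq_intros)
    qed simp_all
    also have "?F 1 - ?F 0 = r * m * (1 - exp (- c)) / c"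
      by (simp add: diff_divide_distrib right_diff_distrib)
    finally show ?thesis .
  qed
  finally show ?thesis
    using game_value_ge[of i N f r, OF i f fi r] unfolding u_def J_def c_def by (simp only:)
qed

text \<open>The equality case of Jensen's inequality: the remainder is nonnegative and vanishes only at the point of tangency.\<close>

lemma AE_of_excess_eq_0:
  fixes f :: "'i \<Rightarrow> 'a measure"
  assumes f: "\<And>j. j \<in> J \<Longrightarrow> intensity (f j)" and r: "0 < r"
    and ex: "excess r s J f = 0"
  shows "AE t in lborel. t \<in> {0..1} \<longrightarrow> (AE z in \<eta>. (\<Sum>j\<in>J. measure (f j) (cball z (rad t))) = s * t)"
proof -
  let ?u = "\<lambda>z t. \<Sum>j\<in>J. measure (f j) (cball z (rad t))"
  interpret P: pair_sigma_finite \<eta> lborel ..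
  have um: "(\<lambda>(z, t). ?u z t) \<in> borel_measurable (\<eta> \<Otimes>\<^sub>M lborel)"
    by (rule borel_measurable_sum_measure_cball[OF f])
  have uz: "(\<lambda>z. ?u z t) \<in> borel_measurable \<eta>" for t
    using measurable_compose[OF measurable_Pair2'[of t lborel \<eta>] um] by simp
  from iffD1[OF nn_integral_0_iff_AE[OF borel_measurable_gap_integral[of J f, OF f]] ex[unfolded excess_def]]
  have "AE t in lborel. (\<integral>\<^sup>+z. ennreal (r * exp (- (r * t)) * gap (?u z t) (s * t)) \<partial>\<eta>) * indicator {0..1} t = 0"
 .
  then show ?thesis
  proof eventually_elim
    case (elim t)
    show ?case
    proof
      assume "t \<in> {0..1}"
      then have "(\<integral>\<^sup>+z. ennreal (r * exp (- (r * t)) * gap (?u z t) (s * t)) \<partial>\<eta>) = 0"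
        using elim by simp
      moreover have "(\<lambda>z. ennreal (r * exp (- (r * t)) * gap (?u z t) (s * t))) \<in> borel_measurable \<eta>"
        using borel_measurable_gap[OF uz borel_measurable_const] by measurable
      ultimately have "AE z in \<eta>. ennreal (r * exp (- (r * t)) * gap (?u z t) (s * t)) = 0"
        by (simp add: nn_integral_0_iff_AE)
      then show "AE z in \<eta>. ?u z t = s * t"
      proof eventually_elim
        case (elim z)
        then have "r * exp (- (r * t)) * gap (?u z t) (s * t) \<le> 0" by (simp only: ennreal_eq_0_iff)
        then have "gap (?u z t) (s * t) \<le> 0" using r by (simp add: mult_le_0_iff)
        then have "gap (?u z t) (s * t) = 0" using gap_nonneg by (rule antisym)
        then show ?case by (simp only: gap_eq_0_iff)
      qed
    qed
  qed
qed

text \<open>Fubini for the pairs $x \in C$, $z \in B(x, r)$: such $z$ lie in the closed $\epsilon$-neighbourhood of $C$.\<close>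

lemma measure_le_of_cball_measures:
  fixes \<mu> :: "'a measure"
  assumes \<mu>: "intensity \<mu>" and C: "closed C" "C \<noteq> {}" and r: "r \<le> \<epsilon>"
    and ball: "AE z in \<eta>. measure \<mu> (cball z r) = c" and c: "0 \<le> c"
  shows "measure \<mu> C * h r \<le> c * measure \<eta> {z. infdist z C \<le> \<epsilon>}"
proof -
  interpret \<mu>: finite_measure \<mu> using \<mu> by (simp add: intensity_def)
  have s\<mu>: "sets \<mu> = sets borel" using \<mu> by (simp add: intensity_def)
  interpret P: pair_sigma_finite \<mu> \<eta> ..
  let ?T = "{z. infdist z C \<le> \<epsilon>}"
  have T: "?T \<in> sets borel"
    by (intro borel_closed closed_Collect_le continuous_intros)
  have D: "{p \<in> space (borel \<Otimes>\<^sub>M borel). dist (fst p) (snd p) \<le> r \<and> snd p \<in> ?T} \<in> sets (borel \<Otimes>\<^sub>M (borel :: 'a measure))"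
    using T by measurable
  have m: "(\<lambda>(x, z :: 'a). indicator (cball z r) x * indicator ?T z :: ennreal) \<in> borel_measurable (\<mu> \<Otimes>\<^sub>M \<eta>)"
  proof -
    have "(\<lambda>(x, z :: 'a). indicator (cball z r) x * indicator ?T z :: ennreal)
        = indicator {p \<in> space (borel \<Otimes>\<^sub>M borel). dist (fst p) (snd p) \<le> r \<and> snd p \<in> ?T}"
      by (auto simp: fun_eq_iff indicator_def space_pair_measure dist_commute)
    then show ?thesis
      unfolding measurable_cong_sets[OF sets_pair_measure_cong[OF s\<mu> sets_eq] refl]
      by (simp only: borel_measurable_indicator[OF D])
  qed
  have "ennreal (measure \<mu> C * h r) = (\<integral>\<^sup>+x. ennreal (h r) * indicator C x \<partial>\<mu>)"
  proof -
    have "(\<integral>\<^sup>+x. ennreal (h r) * indicator C x \<partial>\<mu>) = ennreal (h r) * emeasure \<mu> C"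
      using C(1) by (intro nn_integral_cmult_indicator) (simp add: s\<mu>)
    also have "\<dots> = ennreal (h r * measure \<mu> C)"
      by (simp add: \<mu>.emeasure_eq_measure ennreal_mult' h_def ennreal_mult)
    finally show ?thesis by (simp only: mult.commute)
  qed
  also have "\<dots> \<le> (\<integral>\<^sup>+x. (\<integral>\<^sup>+z. indicator (cball z r) x * indicator ?T z \<partial>\<eta>) \<partial>\<mu>)"
  proof (rule nn_integral_mono)
    fix x
    show "ennreal (h r) * indicator C x \<le> (\<integral>\<^sup>+z. indicator (cball z r) x * indicator ?T z \<partial>\<eta>)"
    proof (cases "x \<in> C")
      case True
      have "ennreal (h r) = (\<integral>\<^sup>+z. indicator (cball x r) z \<partial>\<eta>)"
        by (simp add: sets_eq emeasure_eq_measure measure_cball)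
      also have "\<dots> \<le> (\<integral>\<^sup>+z. indicator (cball z r) x * indicator ?T z \<partial>\<eta>)"
      proof (rule nn_integral_mono)
        fix z
        show "indicator (cball x r) z \<le> (indicator (cball z r) x * indicator ?T z :: ennreal)"
        proof (cases "z \<in> cball x r")
          case z: True
          have "infdist z C \<le> dist z x" using True by (rule infdist_le)
          then have "infdist z C \<le> \<epsilon>" using z r by (simp add: dist_commute)
          then show ?thesis using z by (simp add: dist_commute)
        qed simp
      qed
      finally show ?thesis using True by simp
    qed simp
  qed
  also have "\<dots> = (\<integral>\<^sup>+z. (\<integral>\<^sup>+x. indicator (cball z r) x * indicator ?T z \<partial>\<mu>) \<partial>\<eta>)"
    using P.Fubini'[OF m] by simp
  also have "\<dots> = (\<integral>\<^sup>+z. ennreal c * indicator ?T z \<partial>\<eta>)"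
  proof (rule nn_integral_cong_AE)
    show "AE z in \<eta>. (\<integral>\<^sup>+x. indicator (cball z r) x * indicator ?T z \<partial>\<mu>) = ennreal c * indicator ?T z"
      using ball 
    proof eventually_elim
      case (elim z)
      have "(\<integral>\<^sup>+x. indicator (cball z r) x * indicator ?T z \<partial>\<mu>)
          = (\<integral>\<^sup>+x. indicator (cball z r) x \<partial>\<mu>) * indicator ?T z"
        by (intro nn_integral_multc borel_measurable_indicator) (simp add: s\<mu>)
      also have "(\<integral>\<^sup>+x. indicator (cball z r) x \<partial>\<mu>) = ennreal c"
        using elim by (simp add: s\<mu> \<mu>.emeasure_eq_measure)
      finally show ?case .
    qed
  qed
  also have "\<dots> = ennreal (c * measure \<eta> ?T)"
    using T c by (simp add: nn_integral_cmult_indicator sets_eq emeasure_eq_measure ennreal_mult)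
  finally show ?thesis using c by (simp add: ennreal_le_iff)
qed

text \<open>In a general metric space two finite measures may agree on all balls and yet differ. Here the balls of one radius have the same
$\eta$-measure, which turns \<open>measure_le_of_cball_measures\<close> into
$\mu(C) \le \kappa\, \eta(C_\epsilon)$ for the $\epsilon$-neighbourhoods of closed sets, with $\kappa = \mu(D)/m$. Then $\mu \le \kappa \eta$ on closed
sets and, by inner regularity, on all Borel sets; since the total masses agree, equality follows by passing to complements.\<close>

lemma uniform_of_cball_measures:
  fixes \<mu> :: "'a measure"
  assumes \<mu>: "intensity \<mu>"
    and balls: "\<And>\<epsilon>. 0 < \<epsilon> \<Longrightarrow> \<exists>t. 0 < t \<and> t \<le> 1 \<and> rad t \<le> \<epsilon> \<and>
        (AE z in \<eta>. measure \<mu> (cball z (rad t)) = measure \<mu> UNIV * t)"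
    and B: "B \<in> sets borel"
  shows "measure \<mu> B = measure \<mu> UNIV / m * measure \<eta> B"
proof -
  interpret \<mu>: finite_measure \<mu> using \<mu> by (simp add: intensity_def)
  have s\<mu>: "sets \<mu> = sets borel" using \<mu> by (simp add: intensity_def)
  define s where "s = measure \<mu> UNIV"
  have s: "0 < s" using \<mu> by (simp add: s_def intensity_def)
  have closed_le: "measure \<mu> C \<le> s / m * measure \<eta> C" if C: "closed C" for C
  proof (cases "C = {}")
    case False
    have T: "{z. infdist z C \<le> \<epsilon>} \<in> sets \<eta>" for \<epsilon>
      unfolding sets_eq by (intro borel_closed closed_Collect_le continuous_intros)
    have le: "measure \<mu> C \<le> s / m * measure \<eta> {z. infdist z C \<le> \<epsilon>}" if \<epsilon>: "0 < \<epsilon>" for \<epsilon>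
    proof -
      obtain t where t: "0 < t" "t \<le> 1" "rad t \<le> \<epsilon>"
        "AE z in \<eta>. measure \<mu> (cball z (rad t)) = s * t"
        using balls[OF \<epsilon>] unfolding s_def by blast
      have "measure \<mu> C * h (rad t) \<le> s * t * measure \<eta> {z. infdist z C \<le> \<epsilon>}"
        using t s by (intro measure_le_of_cball_measures[OF \<mu> C False]) simp_all
      then have "t * (measure \<mu> C * m) \<le> t * (s * measure \<eta> {z. infdist z C \<le> \<epsilon>})"
        using t by (simp add: h_rad mult_ac)
      then have "measure \<mu> C * m \<le> s * measure \<eta> {z. infdist z C \<le> \<epsilon>}" using t(1) by simp
      then show ?thesis using pos by (simp add: field_simps)
    qed
    have "(\<lambda>n. measure \<eta> {z. infdist z C \<le> inverse (real (Suc n))})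
        \<longlonglongrightarrow> measure \<eta> (\<Inter>n. {z. infdist z C \<le> inverse (real (Suc n))})"
    proof (rule finite_Lim_measure_decseq)
      show "range (\<lambda>n. {z. infdist z C \<le> inverse (real (Suc n))}) \<subseteq> sets \<eta>" using T by blast
      show "decseq (\<lambda>n. {z. infdist z C \<le> inverse (real (Suc n))})"
      proof (rule antimonoI, rule subsetI)
        fix k n :: nat and z assume "k \<le> n" and z: "z \<in> {z. infdist z C \<le> inverse (real (Suc n))}"
        then have "inverse (real (Suc n)) \<le> inverse (real (Suc k))" by (intro le_imp_inverse_le) simp_all
        moreover have "infdist z C \<le> inverse (real (Suc n))" using z by (simp only: mem_Collect_eq)
        ultimately have "infdist z C \<le> inverse (real (Suc k))" by linarith
        then show "z \<in> {z. infdist z C \<le> inverse (real (Suc k))}" by (simp only: mem_Collect_eq)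
      qed
    qed
    also have "(\<Inter>n. {z. infdist z C \<le> inverse (real (Suc n))}) = C"
    proof (intro equalityI subsetI)
      fix z assume z: "z \<in> (\<Inter>n. {z. infdist z C \<le> inverse (real (Suc n))})"
      have "infdist z C \<le> 0"
      proof (rule ccontr)
        assume "\<not> infdist z C \<le> 0"
        then have "0 < infdist z C" by (simp only: not_le)
        from reals_Archimedean[OF this] obtain n where "inverse (real (Suc n)) < infdist z C" by blast
        moreover have "infdist z C \<le> inverse (real (Suc n))" using z by blast
        ultimately show False by linarith
      qed
      then have "infdist z C = 0" using infdist_nonneg by (rule antisym)
      then show "z \<in> C" using in_closed_iff_infdist_zero[OF C False] by simp
    next
      fix z assume "z \<in> C"
      then show "z \<in> (\<Inter>n. {z. infdist z C \<le> inverse (real (Suc n))})" by simp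
    qed
    finally have "(\<lambda>n. s / m * measure \<eta> {z. infdist z C \<le> inverse (real (Suc n))}) \<longlonglongrightarrow> s / m * measure \<eta> C"
      by (rule tendsto_mult[OF tendsto_const])
    then show ?thesis
      by (rule LIMSEQ_le_const) (use le in auto)
  qed (use s pos in simp)
  have le: "measure \<mu> B \<le> s / m * measure \<eta> B" if B: "B \<in> sets borel" for B
  proof -
    have "emeasure \<mu> B = (SUP K\<in>{K. K \<subseteq> B \<and> compact K}. emeasure \<mu> K)"
      by (rule inner_regular[OF s\<mu> _ B]) simp
    also have "\<dots> \<le> ennreal (s / m * measure \<eta> B)"
    proof (rule SUP_least)
      fix K assume "K \<in> {K. K \<subseteq> B \<and> compact K}"
      then have K: "K \<subseteq> B" "closed K" by (simp_all add: compact_imp_closed)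
      have "measure \<mu> K \<le> s / m * measure \<eta> K" using K(2) by (rule closed_le)
      also have "\<dots> \<le> s / m * measure \<eta> B"
        using K(1) B s pos by (intro mult_left_mono finite_measure_mono) (simp_all add: sets_eq)
      finally show "emeasure \<mu> K \<le> ennreal (s / m * measure \<eta> B)"
        by (simp only: \<mu>.emeasure_eq_measure ennreal_leI)
    qed
    finally show ?thesis using s pos by (simp add: \<mu>.emeasure_eq_measure)
  qed
  have "measure \<mu> (- B) \<le> s / m * measure \<eta> (- B)" using B by (intro le) (simp add: borel_comp)
  moreover have "measure \<mu> (- B) = s - measure \<mu> B"
    using \<mu>.finite_measure_compl[of B] B by (simp add: s\<mu> space_intensity[OF \<mu>] s_def Compl_eq_Diff_UNIV)
  moreover have "measure \<eta> (- B) = m - measure \<eta> B"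
    using finite_measure_compl[of B] B by (simp add: sets_eq space_eq Compl_eq_Diff_UNIV)
  ultimately have "s - measure \<mu> B \<le> s - s / m * measure \<eta> B" using pos by (simp add: right_diff_distrib)
  with le[OF B] show ?thesis unfolding s_def by linarith
qed

text \<open>Almost every $t$ is good; those close to $0$ give arbitrarily small radii, because \<open>h\<close> is positive at positive radii.\<close>

lemma sum_uniform_of_excess_eq_0:
  fixes f :: "'i \<Rightarrow> 'a measure"
  assumes f: "\<And>j. j \<in> J \<Longrightarrow> intensity (f j)" and r: "0 < r"
    and \<mu>: "intensity \<mu>" "\<And>B. B \<in> sets borel \<Longrightarrow> measure \<mu> B = (\<Sum>j\<in>J. measure (f j) B)"
    and ex: "excess r (measure \<mu> UNIV) J f = 0" and B: "B \<in> sets borel"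
  shows "measure \<mu> B = measure \<mu> UNIV / m * measure \<eta> B"
proof (rule uniform_of_cball_measures[OF \<mu>(1) _ B])
  fix \<epsilon> :: real assume \<epsilon>: "0 < \<epsilon>"
  let ?\<delta> = "min 1 (h \<epsilon> / m)"
  have \<delta>: "0 < ?\<delta>" using h_pos[OF \<epsilon>] pos by simp
  obtain t where t: "0 < t" "t < ?\<delta>"
      "t \<in> {0..1} \<longrightarrow> (AE z in \<eta>. (\<Sum>j\<in>J. measure (f j) (cball z (rad t))) = measure \<mu> UNIV * t)"
    by (rule ex_in_interval_of_AE_lborel[OF AE_of_excess_eq_0[OF f r ex] \<delta>])
  have t1: "t \<le> 1" using t(2) by simp
  have "t * m < h \<epsilon>" using t(2) pos by (simp add: pos_less_divide_eq)
  then have "h (rad t) < h \<epsilon>" using t(1) t1 by (simp add: h_rad)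
  then have "rad t \<le> \<epsilon>" using less_of_h_less by fastforce
  moreover have "AE z in \<eta>. measure \<mu> (cball z (rad t)) = measure \<mu> UNIV * t"
    using t(1,3) t1 by (simp add: \<mu>(2))
  ultimately show "\<exists>t. 0 < t \<and> t \<le> 1 \<and> rad t \<le> \<epsilon> \<and>
        (AE z in \<eta>. measure \<mu> (cball z (rad t)) = measure \<mu> UNIV * t)"
    using t(1) t1 by blast
qed

end

section \<open>Null spheres\<close>

lemma borel_sphere: "sphere x r \<in> sets (borel :: 'a::metric_space measure)"
  unfolding sphere_def by (intro borel_closed closed_Collect_eq continuous_intros)

lemma vimage_isometry:
  assumes G: "isometry_group G" and "g \<in> G"
  shows "g -` cball (g x) r = cball x r" "g -` sphere (g x) r = sphere x r"
  using assms unfolding isometry_group_def by (auto simp: cball_def sphere_def)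

lemma measure_invariant:
  assumes inv: "invariant_under \<eta> G" and g: "g \<in> G" and B: "B \<in> sets \<eta>" and sp: "space \<eta> = UNIV"
  shows "measure \<eta> (g -` B) = measure \<eta> B"
proof -
  have gm: "g \<in> \<eta> \<rightarrow>\<^sub>M \<eta>" and d: "distr \<eta> \<eta> g = \<eta>" using inv g by (simp_all add: invariant_under_def)
  have "measure \<eta> B = measure (distr \<eta> \<eta> g) B" by (simp only: d)
  also have "\<dots> = measure \<eta> (g -` B)" using measure_distr[OF gm B] sp by simp
  finally show ?thesis ..
qed

text \<open>The two open cells miss exactly the ties.\<close>

lemma ties_null_of_full_voronoi:
  fixes \<eta> :: "'a::metric_space measure"
  assumes fm: "finite_measure \<eta>" and sets: "sets \<eta> = sets borel"
    and full: "emeasure \<eta> (\<Union>w\<in>set_mset {#x, y#}. voronoi_cell {#x, y#} w) = emeasure \<eta> UNIV" and xy: "x \<noteq> y"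
  shows "emeasure \<eta> {z. dist x z = dist y z} = 0"
proof -
  interpret finite_measure \<eta> by fact
  have sp: "space \<eta> = UNIV" using sets_eq_imp_space_eq[OF sets] by simp
  let ?W = "\<Union>w\<in>set_mset {#x, y#}. voronoi_cell {#x, y#} w"
  have W: "?W \<in> sets \<eta>"
    unfolding sets by (intro borel_open open_UN ballI open_voronoi_cell)
  have "emeasure \<eta> (UNIV - ?W) = 0"
    using emeasure_Diff[of \<eta> ?W UNIV] W full sp sets.top[of \<eta>] by (simp add: emeasure_eq_measure)
  moreover have sub: "{z. dist x z = dist y z} \<subseteq> UNIV - ?W"
  proof
    fix z assume "z \<in> {z. dist x z = dist y z}"
    then have tie: "dist x z = dist y z" by simp
    have "z \<notin> voronoi_cell {#x, y#} x"
      using voronoi_cellD[of z "{#x, y#}" x y] tie xy by fastforce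
    moreover have "z \<notin> voronoi_cell {#x, y#} y"
      using voronoi_cellD[of z "{#x, y#}" y x] tie xy by fastforce
    ultimately show "z \<in> UNIV - ?W" unfolding set_mset_add_mset_insert set_mset_empty by blast
  qed
  moreover have "UNIV - ?W \<in> sets \<eta>" using sets.compl_sets[OF W] by (simp only: sp)
  ultimately show ?thesis using emeasure_mono[OF sub, of \<eta>] by (simp only: le_zero_eq)
qed

text \<open>If spheres of radius $r$ have measure $s > 0$, then around every $z$ the sphere contains a whole two-point configuration with
probability $e^{-m} s^2 / 2$. By Fubini the two points of a configuration tie on a set of positive measure with positive probability, which contradicts
\<open>ties_null_of_full_voronoi\<close>.\<close>

lemma sphere_null_of_non_conflicting:
  fixes \<eta> :: "'a::polish_space measure"
  assumes \<eta>: "intensity \<eta>" and comp: "compact (UNIV :: 'a set)"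
    and atom: "\<And>x. measure \<eta> {x} = 0" and nc: "non_conflicting \<eta>"
    and inv: "\<And>x y. measure \<eta> (sphere x r) = measure \<eta> (sphere y r)"
  shows "measure \<eta> (sphere x r) = 0"
proof (rule ccontr)
  assume "measure \<eta> (sphere x r) \<noteq> 0"
  then have s: "0 < measure \<eta> (sphere x r)" using measure_nonneg[of \<eta> "sphere x r"] by linarith
  interpret \<eta>: finite_measure \<eta> using \<eta> by (simp add: intensity_def)
  have sets: "sets \<eta> = sets borel" using \<eta> by (simp add: intensity_def)
  have sp: "space \<eta> = UNIV" by (rule space_intensity[OF \<eta>])
  define Q where "Q = poisson_law \<eta>"
  interpret Q: prob_space Q unfolding Q_def by (rule poisson_law_intensity[OF \<eta>])
  have Qs: "sets Q = sets configurations" and Qsp: "space Q = UNIV"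
    unfolding Q_def by (rule poisson_law_intensity[OF \<eta>])+
  \<comment> \<open>\<open>AE_poisson_simple\<close> speaks of product spaces: a product with one factor transports it to \<open>Q\<close>.\<close>
  define L where "L = (\<Pi>\<^sub>M j\<in>{0 :: nat}. poisson_law \<eta>)"
  have proj: "(\<lambda>\<phi>. \<phi> 0) \<in> L \<rightarrow>\<^sub>M Q" unfolding L_def Q_def by (rule measurable_component_singleton) simp
  have distr: "distr L Q (\<lambda>\<phi>. \<phi> 0) = Q"
  proof -
    interpret product_prob_space "\<lambda>_ :: nat. Q" "{0 :: nat}" by standard
    show ?thesis unfolding L_def Q_def[symmetric] by (rule PiM_component) simp
  qed
  interpret P: pair_sigma_finite Q \<eta> ..
  let ?S = "\<lambda>z. sphere z r"
  define E where "E = {p \<in> space (Q \<Otimes>\<^sub>M \<eta>). points_in (?S (snd p)) (fst p) = 2 \<and> points_in (- ?S (snd p)) (fst p) = 0}"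
  have E: "E \<in> sets (Q \<Otimes>\<^sub>M \<eta>)"
  proof -
    let ?C = "{p :: 'a \<times> 'a. dist (snd p) (fst p) = r}"
    have "{p \<in> space (borel \<Otimes>\<^sub>M borel). dist (snd p) (fst p) = r} \<in> sets (borel \<Otimes>\<^sub>M (borel :: 'a measure))"
      by measurable
    then have "?C \<in> sets (borel \<Otimes>\<^sub>M borel)" by (simp add: space_pair_measure)
    then have C: "?C \<in> sets (borel \<Otimes>\<^sub>M \<eta>)" using sets_pair_measure_cong[OF refl sets] by blast
    have C': "- ?C \<in> sets (borel \<Otimes>\<^sub>M \<eta>)"
      using sets.compl_sets[OF C] by (simp add: space_pair_measure sp Compl_eq_Diff_UNIV)
    have level: "{p \<in> space (Q \<Otimes>\<^sub>M \<eta>). points_in {x. (x, snd p) \<in> D} (fst p) = v} \<in> sets (Q \<Otimes>\<^sub>M \<eta>)"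
      if D: "D \<in> sets (borel \<Otimes>\<^sub>M \<eta>)" for D v
    proof -
      have "(\<lambda>(\<phi>, z). real (points_in {x. (x, z) \<in> D} \<phi>)) \<in> borel_measurable (Q \<Otimes>\<^sub>M \<eta>)"
        using measurable_points_in_section[OF D]
        by (simp only: measurable_cong_sets[OF sets_pair_measure_cong[OF Qs refl] refl])
      from measurable_sets[OF this, of "{real v}"] show ?thesis
        by (simp add: case_prod_unfold vimage_def Int_def conj_commute)
    qed
    have "?S z = {x. (x, z) \<in> ?C}" "- ?S z = {x. (x, z) \<in> - ?C}" for z by auto
    then show ?thesis unfolding E_def
      using level[OF C] level[OF C'] by (simp only: sets.sets_Collect_conj)
  qed
  have Ez: "emeasure Q ((\<lambda>\<phi>. (\<phi>, z)) -` E) = ennreal (exp (- measure \<eta> UNIV) * (measure \<eta> (sphere x r))\<^sup>2 / 2)" for z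
  proof -
    let ?B = "\<lambda>j::nat. if j = 0 then ?S z else - ?S z" and ?v = "\<lambda>j::nat. if j = 0 then 2 else 0 :: nat"
    have S: "?S z \<in> sets borel" by (rule borel_sphere)
    have dj: "disjoint_family_on ?B {0,1}" by (auto simp: disjoint_family_on_def)
    have B: "?B j \<in> sets borel" for j using S borel_comp[OF S] by simp
    have "measure Q {\<phi>. \<forall>j\<in>{0,1}. points_in (?B j) \<phi> = ?v j}
        = (\<Prod>j\<in>{0,1}. exp (- measure \<eta> (?B j)) * measure \<eta> (?B j) ^ ?v j / fact (?v j))"
      unfolding Q_def
      using \<eta> measure_poisson_sample_counts[of \<eta> "{0,1}" ?B ?v, OF _ _ _ _ B dj]
      by (simp only: poisson_law_eq_sample intensity_def finite.intros)
    also have "\<dots> = exp (- measure \<eta> (?S z)) * exp (- measure \<eta> (- ?S z)) * (measure \<eta> (?S z))\<^sup>2 / 2"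
      by (simp add: fact_numeral)
    also have "measure \<eta> (- ?S z) = measure \<eta> UNIV - measure \<eta> (?S z)"
      using \<eta>.finite_measure_compl[of "?S z"] S by (simp add: sets sp Compl_eq_Diff_UNIV)
    also have "exp (- measure \<eta> (?S z)) * exp (- (measure \<eta> UNIV - measure \<eta> (?S z))) = exp (- measure \<eta> UNIV)"
      by (simp add: exp_add[symmetric])
    also have "measure \<eta> (?S z) = measure \<eta> (sphere x r)" by (rule inv)
    finally have "measure Q {\<phi>. \<forall>j\<in>{0,1}. points_in (?B j) \<phi> = ?v j}
        = exp (- measure \<eta> UNIV) * (measure \<eta> (sphere x r))\<^sup>2 / 2" .
    moreover have "(\<lambda>\<phi>. (\<phi>, z)) -` E = {\<phi>. \<forall>j\<in>{0,1}. points_in (?B j) \<phi> = ?v j}"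
      unfolding E_def by (auto simp: space_pair_measure Qsp sp)
    ultimately show ?thesis by (simp add: Q.emeasure_eq_measure)
  qed
  have g: "(\<lambda>\<phi>. emeasure \<eta> (Pair \<phi> -` E)) \<in> borel_measurable Q" by (rule \<eta>.measurable_emeasure_Pair[OF E])
  have "AE \<phi> in L. emeasure \<eta> (Pair (\<phi> 0) -` E) = 0"
  proof -
    let ?P = "\<lambda>\<phi>. emeasure \<eta> (\<Union>x\<in>set_mset \<phi>. voronoi_cell \<phi> x) = emeasure \<eta> UNIV"
    have ne: "{\<phi>. \<phi> \<noteq> {#}} = UNIV - {\<phi> :: 'a multiset. points_in UNIV \<phi> = 0}" by (auto simp: points_in_def)
    have v: "{\<phi> :: 'a multiset. points_in UNIV \<phi> = 0} \<in> sets Q"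
      using sets_points_in[of "UNIV :: 'a set" "{0}"] by (simp add: Qs)
    have "measure Q {\<phi>. points_in UNIV \<phi> = 0} = exp (- measure \<eta> UNIV)"
      unfolding Q_def by (rule measure_poisson_law_void[OF \<eta>]) simp
    then have "measure Q {\<phi>. \<phi> \<noteq> {#}} = 1 - exp (- measure \<eta> UNIV)"
      unfolding ne using Q.prob_compl[OF v] by (simp only: Qsp)
    then have "measure Q {\<phi>. \<phi> \<noteq> {#}} > 0" using \<eta> by (simp add: intensity_def)
    then have A: "emeasure Q {\<phi>. \<phi> \<noteq> {#}} \<noteq> 0" "emeasure Q {\<phi>. \<phi> \<noteq> {#}} < \<infinity>"
      by (simp_all add: Q.emeasure_eq_measure)
    have "AE \<phi> in Q. \<phi> \<in> {\<phi>. \<phi> \<noteq> {#}} \<longrightarrow> ?P \<phi>"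
      using nc unfolding non_conflicting_def Q_def[symmetric] AE_uniform_measure[OF A] .
    then have "AE \<phi> in distr L Q (\<lambda>\<phi>. \<phi> 0). \<phi> \<in> {\<phi>. \<phi> \<noteq> {#}} \<longrightarrow> ?P \<phi>" unfolding distr .
    from AE_distrD[OF proj this] have "AE \<phi> in L. \<phi> 0 \<in> {\<phi>. \<phi> \<noteq> {#}} \<longrightarrow> ?P (\<phi> 0)" .
    moreover have "AE \<phi> in L. \<forall>x. count (\<Sum>j\<in>{0}. \<phi> j) x \<le> 1"
      unfolding L_def using \<eta> atom by (intro AE_poisson_simple[OF comp]) simp_all
    ultimately show ?thesis
    proof eventually_elim
      case (elim \<phi>)
      show ?case
      proof (cases "\<exists>z. (\<phi> 0, z) \<in> E")
        case True
        then obtain z0 where z0: "points_in (?S z0) (\<phi> 0) = 2" "points_in (- ?S z0) (\<phi> 0) = 0"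
          unfolding E_def by auto
        have "size (\<phi> 0) = points_in UNIV (\<phi> 0)" by (simp add: points_in_def)
        also have "\<dots> = 2" using z0 points_in_Compl[of "?S z0" "\<phi> 0"] by linarith
        finally have "size (\<phi> 0) = 2" .
        then have "size (\<phi> 0) = Suc 1" by simp
        from size_eq_Suc_imp_eq_union[OF this] obtain a M where a: "\<phi> 0 = add_mset a M" by blast
        then have "size M = 1" using \<open>size (\<phi> 0) = Suc 1\<close> by simp
        from size_1_singleton_mset[OF this] obtain b where ab: "\<phi> 0 = {#a, b#}" using a by blast
        have neq: "a \<noteq> b" using elim(2)[rule_format, of a] by (auto simp: ab)
        have "?P {#a, b#}" using elim(1) by (simp only: ab) simp
        then have null: "emeasure \<eta> {z. dist a z = dist b z} = 0"
          using neq by (rule ties_null_of_full_voronoi[OF \<eta>.finite_measure_axioms sets])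
        have "Pair (\<phi> 0) -` E \<subseteq> {z. dist a z = dist b z}"
        proof
          fix z assume "z \<in> Pair (\<phi> 0) -` E"
          then have "points_in (- ?S z) {#a, b#} = 0" unfolding E_def by (simp add: ab)
          then have "a \<in> ?S z" "b \<in> ?S z" unfolding points_in_eq_0_iff by simp_all
          then show "z \<in> {z. dist a z = dist b z}" by (simp add: dist_commute)
        qed
        moreover have "{z. dist a z = dist b z} \<in> sets \<eta>"
          unfolding sets by (intro borel_closed closed_Collect_eq continuous_intros)
        ultimately have "emeasure \<eta> (Pair (\<phi> 0) -` E) \<le> 0" using null emeasure_mono[of "Pair (\<phi> 0) -` E" "{z. dist a z = dist b z}" \<eta>] by simp
        then show ?thesis by simp
      next
        case False
        then have "Pair (\<phi> 0) -` E = {}" by auto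
        then show ?thesis by simp
      qed
    qed
  qed
  then have "(\<integral>\<^sup>+\<phi>. emeasure \<eta> (Pair (\<phi> 0) -` E) \<partial>L) = (\<integral>\<^sup>+\<phi>. 0 \<partial>L)"
    by (rule nn_integral_cong_AE)
  also have "(\<integral>\<^sup>+\<phi>. emeasure \<eta> (Pair (\<phi> 0) -` E) \<partial>L) = (\<integral>\<^sup>+\<phi>. emeasure \<eta> (Pair \<phi> -` E) \<partial>distr L Q (\<lambda>\<phi>. \<phi> 0))"
    by (rule nn_integral_distr[OF proj, symmetric]) (use g in \<open>simp add: distr\<close>)
  also have "\<dots> = emeasure (Q \<Otimes>\<^sub>M \<eta>) E"
    unfolding distr by (rule \<eta>.emeasure_pair_measure_alt[OF E, symmetric])
  also have "\<dots> = (\<integral>\<^sup>+z. emeasure Q ((\<lambda>\<phi>. (\<phi>, z)) -` E) \<partial>\<eta>)"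
    by (rule P.emeasure_pair_measure_alt2[OF E])
  also have "\<dots> = ennreal (exp (- measure \<eta> UNIV) * (measure \<eta> (sphere x r))\<^sup>2 / 2) * ennreal (measure \<eta> UNIV)"
    by (simp add: Ez sp \<eta>.emeasure_eq_measure)
  finally have "exp (- measure \<eta> UNIV) * (measure \<eta> (sphere x r))\<^sup>2 / 2 * measure \<eta> UNIV \<le> 0"
    by (simp add: ennreal_mult[symmetric] ennreal_eq_0_iff)
  moreover have "0 < exp (- measure \<eta> UNIV) * (measure \<eta> (sphere x r))\<^sup>2 / 2 * measure \<eta> UNIV"
    using s \<eta> by (simp add: intensity_def)
  ultimately show False by linarith
qed

text \<open>Diffuseness excludes atoms, since a singleton has no subset of intermediate measure.\<close>

lemma homogeneous_space_of_game:
  fixes \<eta> :: "'a::polish_space measure"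
  assumes game: "cox_hotelling_game \<eta> N \<rho>" and comp: "compact (UNIV :: 'a set)"
    and G: "isometry_group G" "acts_transitively G" "invariant_under \<eta> G"
  shows "homogeneous_space \<eta>"
proof -
  have fm: "finite_measure \<eta>" and sets: "sets \<eta> = sets borel" and pos: "0 < emeasure \<eta> UNIV"
    and diff: "diffuse \<eta>" and nc: "non_conflicting \<eta>"
    using game by (simp_all add: cox_hotelling_game_def)
  interpret finite_measure \<eta> by fact
  have sp: "space \<eta> = UNIV" using sets_eq_imp_space_eq[OF sets] by simp
  have m: "0 < measure \<eta> UNIV" using pos by (simp add: emeasure_eq_measure)
  have \<eta>: "intensity \<eta>" using fm sets m by (simp add: intensity_def)
  have cb: "measure \<eta> (cball x r) = measure \<eta> (cball y r)"
    and sph: "measure \<eta> (sphere x r) = measure \<eta> (sphere y r)" for x y r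
  proof -
    obtain g where g: "g \<in> G" "g x = y" using G(2) unfolding acts_transitively_def by blast
    have "cball y r \<in> sets \<eta>" "sphere y r \<in> sets \<eta>"
      unfolding sets by (rule borel_closed[OF closed_cball], rule borel_sphere)
    from this[THEN measure_invariant[OF G(3) g(1) _ sp]] vimage_isometry[OF G(1) g(1), of x r]
    show "measure \<eta> (cball x r) = measure \<eta> (cball y r)" "measure \<eta> (sphere x r) = measure \<eta> (sphere y r)"
      by (simp_all add: g(2))
  qed
  have atom: "measure \<eta> {x} = 0" for x
  proof (rule ccontr)
    assume "measure \<eta> {x} \<noteq> 0"
    then have "0 < emeasure \<eta> {x}" by (simp add: emeasure_eq_measure zero_less_measure_iff)
    moreover have "{x} \<in> sets \<eta>" by (simp add: sets)
    ultimately obtain C where C: "C \<subseteq> {x}" "0 < emeasure \<eta> C" "emeasure \<eta> C < emeasure \<eta> {x}"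
      using diff unfolding diffuse_def by blast
    from C(1) have "C = {} \<or> C = {x}" by blast
    then show False using C(2,3) by auto
  qed
  show ?thesis
    by (intro homogeneous_space.intro homogeneous_space_axioms.intro fm sets m comp cb
        sphere_null_of_non_conflicting[OF \<eta> comp atom nc sph])
qed

section \<open>Nash equilibria\<close>

context homogeneous_space
begin

lemma action_density:
  assumes "\<mu> \<in> actions \<eta> r"
  obtains g :: "'a \<Rightarrow> real" where "\<mu> = density \<eta> (\<lambda>x. ennreal (g x))" "g \<in> borel_measurable \<eta>"
    "(\<integral>\<^sup>+x. ennreal (g x) \<partial>\<eta>) = ennreal r"
  using assms unfolding actions_def by blast

lemma intensity_action:
  assumes \<mu>: "\<mu> \<in> actions \<eta> r" and r: "0 < r"
  shows "intensity \<mu>" "measure \<mu> UNIV = r" "measure \<mu> {x} = 0"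
proof -
  obtain g :: "'a \<Rightarrow> real" where g: "\<mu> = density \<eta> (\<lambda>x. ennreal (g x))" "g \<in> borel_measurable \<eta>"
    "(\<integral>\<^sup>+x. ennreal (g x) \<partial>\<eta>) = ennreal r" by (rule action_density[OF \<mu>])
  have s: "sets \<mu> = sets borel" by (simp add: g(1) sets_eq)
  have "emeasure \<mu> (space \<eta>) = (\<integral>\<^sup>+x. ennreal (g x) * indicator (space \<eta>) x \<partial>\<eta>)"
    unfolding g(1) using g(2) by (intro emeasure_density) simp_all
  then have e: "emeasure \<mu> UNIV = ennreal r" using g(3) by (simp add: space_eq)
  show m: "measure \<mu> UNIV = r" using e r by (simp add: measure_def)
  have "finite_measure \<mu>"
    by (rule finite_measureI) (simp add: g(1) space_eq e[unfolded g(1)])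
  then show "intensity \<mu>" using s m r by (simp add: intensity_def)
  have x: "{x} \<in> null_sets \<eta>"
    using sphere_null[of x 0] by (simp add: null_sets_def sets_eq emeasure_eq_measure)
  have "emeasure \<mu> {x} = 0"
    unfolding g(1) using x g(2) by (subst emeasure_density) (auto simp: sets_eq intro!: nn_integral_null_set)
  then show "measure \<mu> {x} = 0" by (simp add: measure_def)
qed

text \<open>The sum of the measures, realized by adding the densities.\<close>

lemma ex_sum_of_actions:
  fixes f :: "'i \<Rightarrow> 'a measure"
  assumes fin: "finite J" and ne: "J \<noteq> {}" and f: "\<And>j. j \<in> J \<Longrightarrow> f j \<in> actions \<eta> (\<rho> j)"
    and \<rho>: "\<And>j. j \<in> J \<Longrightarrow> 0 < \<rho> j"
  obtains \<mu> where "intensity \<mu>" "\<And>B. B \<in> sets borel \<Longrightarrow> measure \<mu> B = (\<Sum>j\<in>J. measure (f j) B)"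
proof -
  have "\<forall>j\<in>J. \<exists>g. f j = density \<eta> (\<lambda>x. ennreal (g x)) \<and> g \<in> borel_measurable \<eta>"
    using f by (blast elim: action_density)
  from bchoice[OF this] obtain g :: "'i \<Rightarrow> 'a \<Rightarrow> real"
    where g: "\<And>j. j \<in> J \<Longrightarrow> f j = density \<eta> (\<lambda>x. ennreal (g j x))" "\<And>j. j \<in> J \<Longrightarrow> g j \<in> borel_measurable \<eta>"
    by blast
  define \<mu> where "\<mu> = density \<eta> (\<lambda>x. \<Sum>j\<in>J. ennreal (g j x))"
  have gm: "(\<lambda>x. ennreal (g j x)) \<in> borel_measurable \<eta>" if "j \<in> J" for j using g(2)[OF that] by simp
  have e: "emeasure \<mu> B = ennreal (\<Sum>j\<in>J. measure (f j) B)" if B: "B \<in> sets borel" for B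
  proof -
    have "emeasure \<mu> B = (\<integral>\<^sup>+x. (\<Sum>j\<in>J. ennreal (g j x)) * indicator B x \<partial>\<eta>)"
      unfolding \<mu>_def using B gm by (intro emeasure_density borel_measurable_sum) (simp_all add: sets_eq)
    also have "\<dots> = (\<integral>\<^sup>+x. (\<Sum>j\<in>J. ennreal (g j x) * indicator B x) \<partial>\<eta>)"
      by (simp only: sum_distrib_right)
    also have "\<dots> = (\<Sum>j\<in>J. \<integral>\<^sup>+x. ennreal (g j x) * indicator B x \<partial>\<eta>)"
      using B gm by (intro nn_integral_sum borel_measurable_times_ennreal borel_measurable_indicator) (simp_all add: sets_eq)
    also have "\<dots> = (\<Sum>j\<in>J. ennreal (measure (f j) B))"
    proof (rule sum.cong[OF refl])
      fix j assume j: "j \<in> J"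
      interpret F: finite_measure "f j"
        using intensity_action(1)[OF f[OF j] \<rho>[OF j]] by (simp add: intensity_def)
      have "emeasure (f j) B = (\<integral>\<^sup>+x. ennreal (g j x) * indicator B x \<partial>\<eta>)"
        unfolding g(1)[OF j] using B gm[OF j] by (intro emeasure_density) (simp_all add: sets_eq)
      then show "(\<integral>\<^sup>+x. ennreal (g j x) * indicator B x \<partial>\<eta>) = ennreal (measure (f j) B)"
        by (simp add: F.emeasure_eq_measure)
    qed
    finally show ?thesis by (simp add: sum_ennreal)
  qed
  have m: "measure \<mu> B = (\<Sum>j\<in>J. measure (f j) B)" if "B \<in> sets borel" for B
    using e[OF that] by (simp add: measure_def sum_nonneg)
  have "measure \<mu> UNIV = (\<Sum>j\<in>J. \<rho> j)"
    using m[of UNIV] intensity_action(2)[OF f \<rho>] by simp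
  also have "\<dots> > 0" using fin ne \<rho> by (intro sum_pos) simp_all
  finally have p: "0 < measure \<mu> UNIV" .
  have "finite_measure \<mu>"
    by (rule finite_measureI) (use e[of UNIV] in \<open>simp add: \<mu>_def space_eq\<close>)
  then have "intensity \<mu>" using p by (simp add: intensity_def \<mu>_def sets_eq)
  then show thesis using m by (rule that)
qed

lemma uniform_action_in_actions: "0 < r \<Longrightarrow> uniform_action \<eta> r \<in> actions \<eta> r"
  unfolding uniform_action_def actions_def
  by (intro CollectI exI[of _ "\<lambda>_. r / m"])
     (use pos in \<open>simp add: space_eq emeasure_eq_measure ennreal_mult'[symmetric]\<close>)

lemma measure_uniform_action:
  assumes "0 < r" "B \<in> sets borel"
  shows "measure (uniform_action \<eta> r) B = r / m * measure \<eta> B"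
proof -
  have "emeasure (uniform_action \<eta> r) B = ennreal (r / m) * emeasure \<eta> B"
    unfolding uniform_action_def using assms(2)
    by (subst emeasure_density) (simp_all add: sets_eq nn_integral_cmult_indicator)
  then show ?thesis using assms(1) pos by (simp add: measure_def enn2real_mult)
qed

lemma eq_uniform_action:
  assumes \<mu>: "\<mu> \<in> actions \<eta> r" and r: "0 < r" and eq: "\<And>B. B \<in> sets borel \<Longrightarrow> measure \<mu> B = r / m * measure \<eta> B"
  shows "\<mu> = uniform_action \<eta> r"
proof (rule measure_eqI)
  have i: "intensity \<mu>" "intensity (uniform_action \<eta> r)"
    using intensity_action(1) \<mu> uniform_action_in_actions r by blast+
  then show s: "sets \<mu> = sets (uniform_action \<eta> r)" by (simp add: intensity_def)
  interpret A: finite_measure \<mu> using i by (simp add: intensity_def)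
  interpret B: finite_measure "uniform_action \<eta> r" using i by (simp add: intensity_def)
  fix B assume "B \<in> sets \<mu>"
  then have "B \<in> sets borel" using i(1) by (simp add: intensity_def)
  then show "emeasure \<mu> B = emeasure (uniform_action \<eta> r) B"
    by (simp add: A.emeasure_eq_measure B.emeasure_eq_measure eq measure_uniform_action r)
qed

lemma uniform_action_in_space:
  assumes "0 < r"
  shows "uniform_action \<eta> r \<in> space (action_space \<eta> r)"
proof -
  let ?\<mu> = "uniform_action \<eta> r"
  have "intensity ?\<mu>" using intensity_action(1)[OF uniform_action_in_actions] assms by blast
  then have fm: "finite_measure ?\<mu>" "sets ?\<mu> = sets borel" by (simp_all add: intensity_def)
  have "?\<mu> \<in> topspace weak_topology"
    unfolding weak_topology_def topology_generated_by_topspace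
  proof (rule UnionI)
    show "{\<mu>. finite_measure \<mu> \<and> sets \<mu> = sets borel \<and> (\<integral>x. (\<lambda>_. 0 :: real) x \<partial>\<mu>) \<in> UNIV}
      \<in> {{\<mu>. finite_measure \<mu> \<and> sets \<mu> = sets borel \<and> (\<integral>x. g x \<partial>\<mu>) \<in> U} | (g :: 'a \<Rightarrow> real) U.
        continuous_on UNIV g \<and> bounded (range g) \<and> open U}"
      by (intro CollectI exI[of _ "\<lambda>_. 0"] exI[of _ UNIV] conjI refl) simp_all
  qed (use fm in simp)
  then show ?thesis
    using uniform_action_in_actions[OF assms]
    by (simp add: action_space_def borel_of_def space_measure_of_conv)
qed

text \<open>The part of the total value that belongs to player $i$ in proportion to the mass $\rho_i$.\<close>

definition share :: "nat \<Rightarrow> (nat \<Rightarrow> real) \<Rightarrow> nat \<Rightarrow> real" where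
  "share N \<rho> i = \<rho> i * m * (1 - exp (- (\<Sum>j\<in>{1..N}. \<rho> j))) / (\<Sum>j\<in>{1..N}. \<rho> j)"

lemma share_nonneg:
  assumes \<rho>: "\<And>j. j \<in> {1..N} \<Longrightarrow> 0 < \<rho> j" and i: "i \<in> {1..N}"
  shows "0 \<le> share N \<rho> i"
proof -
  have "0 \<le> (\<Sum>j\<in>{1..N}. \<rho> j)" using \<rho> by (intro sum_nonneg less_imp_le)
  moreover have "0 < \<rho> i" by (rule \<rho>[OF i])
  ultimately show ?thesis unfolding share_def by simp
qed

lemma game_value_uniform_ge:
  assumes \<rho>: "\<And>j. j \<in> {1..N} \<Longrightarrow> 0 < \<rho> j" and f: "\<And>j. j \<in> {1..N} \<Longrightarrow> f j \<in> actions \<eta> (\<rho> j)"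
    and i: "i \<in> {1..N}" and fi: "f i = uniform_action \<eta> (\<rho> i)"
  shows "ennreal (share N \<rho> i) + excess (\<rho> i) (\<Sum>j\<in>{1..N} - {i}. \<rho> j) ({1..N} - {i}) f \<le> game_value \<eta> N f i"
proof -
  have "ennreal (\<rho> i * m * (1 - exp (- (\<rho> i + (\<Sum>j\<in>{1..N} - {i}. \<rho> j)))) / (\<rho> i + (\<Sum>j\<in>{1..N} - {i}. \<rho> j)))
      + excess (\<rho> i) (\<Sum>j\<in>{1..N} - {i}. \<rho> j) ({1..N} - {i}) f \<le> game_value \<eta> N f i"
  proof (rule game_value_ge_excess[OF i])
    show "intensity (f j)" if "j \<in> {1..N}" for j by (rule intensity_action(1)[OF f[OF that] \<rho>[OF that]])
    show "measure (f i) B = \<rho> i / m * measure \<eta> B" if "B \<in> sets borel" for B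
      unfolding fi by (rule measure_uniform_action[OF \<rho>[OF i] that])
    show "0 < \<rho> i" by (rule \<rho>[OF i])
    show "(\<Sum>j\<in>{1..N} - {i}. \<rho> j) = (\<Sum>j\<in>{1..N} - {i}. measure (f j) UNIV)"
      using intensity_action(2)[OF f \<rho>] by (intro sum.cong refl) simp
  qed
  also have "\<rho> i + (\<Sum>j\<in>{1..N} - {i}. \<rho> j) = (\<Sum>j\<in>{1..N}. \<rho> j)"
    using i by (simp add: sum.remove[of _ i])
  finally show ?thesis unfolding share_def .
qed

lemma sum_game_value_le_shares:
  assumes \<rho>: "\<And>j. j \<in> {1..N} \<Longrightarrow> 0 < \<rho> j" and f: "\<And>j. j \<in> {1..N} \<Longrightarrow> f j \<in> actions \<eta> (\<rho> j)" and N: "1 \<le> N"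
  shows "(\<Sum>i\<in>{1..N}. game_value \<eta> N f i) \<le> (\<Sum>i\<in>{1..N}. ennreal (share N \<rho> i))"
proof -
  let ?R = "\<Sum>j\<in>{1..N}. \<rho> j"
  have R: "0 < ?R" using \<rho> N by (intro sum_pos) simp_all
  have "(\<Sum>i\<in>{1..N}. game_value \<eta> N f i)
      \<le> ennreal (m * (1 - exp (- (\<Sum>j\<in>{1..N}. measure (f j) UNIV))))"
    using intensity_action[OF f \<rho>] by (intro sum_game_value_le compact_space finite_measure_axioms sets_eq)
  also have "(\<Sum>j\<in>{1..N}. measure (f j) UNIV) = ?R"
    using intensity_action(2)[OF f \<rho>] by (intro sum.cong refl)
  also have "m * (1 - exp (- ?R)) = (\<Sum>i\<in>{1..N}. share N \<rho> i)"
  proof -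
    have "(\<Sum>i\<in>{1..N}. share N \<rho> i) = ?R * (m * (1 - exp (- ?R)) / ?R)"
      unfolding share_def sum_distrib_right by (intro sum.cong refl) (simp only: times_divide_eq_right mult.assoc)
    then show ?thesis using R by simp
  qed
  also have "ennreal (\<Sum>i\<in>{1..N}. share N \<rho> i) = (\<Sum>i\<in>{1..N}. ennreal (share N \<rho> i))"
    using share_nonneg[OF \<rho>] by (intro sum_ennreal[symmetric])
  finally show ?thesis .
qed

text \<open>For each $i$ the sum of the actions other than $f_i$ is uniform. Adding these $N$ relations determines the sum $F$ of all actions, since
$N - 1 \neq 0$, and subtraction isolates $f_i$.\<close>

lemma uniform_of_no_excess:
  fixes N :: nat
  assumes N: "2 \<le> N" and \<rho>: "\<And>j. j \<in> {1..N} \<Longrightarrow> 0 < \<rho> j"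
    and f: "\<And>j. j \<in> {1..N} \<Longrightarrow> f j \<in> actions \<eta> (\<rho> j)"
    and ex: "\<And>i. i \<in> {1..N} \<Longrightarrow> excess (\<rho> i) (\<Sum>j\<in>{1..N} - {i}. \<rho> j) ({1..N} - {i}) f = 0"
    and k: "k \<in> {1..N}"
  shows "f k = uniform_action \<eta> (\<rho> k)"
proof (rule eq_uniform_action[OF f[OF k] \<rho>[OF k]])
  fix B :: "'a set" assume B: "B \<in> sets borel"
  let ?R = "\<Sum>j\<in>{1..N}. \<rho> j" and ?F = "\<Sum>j\<in>{1..N}. measure (f j) B"
  have one: "?F - measure (f i) B = (?R - \<rho> i) / m * measure \<eta> B" if i: "i \<in> {1..N}" for i
  proof -
    define J where "J = {1..N} - {i}"
    have J: "finite J" "J \<subseteq> {1..N}" by (auto simp: J_def)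
    have "J \<noteq> {}"
    proof -
      have "(if i = 1 then 2 else 1) \<in> J" using N by (simp add: J_def)
      then show ?thesis by blast
    qed
    then obtain \<mu> where \<mu>: "intensity \<mu>" "\<And>B. B \<in> sets borel \<Longrightarrow> measure \<mu> B = (\<Sum>j\<in>J. measure (f j) B)"
      using ex_sum_of_actions[of J f \<rho>] J f \<rho> by (metis subsetD)
    have u: "measure \<mu> UNIV = (\<Sum>j\<in>J. \<rho> j)"
      using \<mu>(2)[of UNIV] intensity_action(2)[OF f \<rho>] J(2) by (simp add: subset_iff)
    have "measure \<mu> B = measure \<mu> UNIV / m * measure \<eta> B"
    proof (rule sum_uniform_of_excess_eq_0[OF _ \<rho>[OF i] \<mu> _ B])
      show "intensity (f j)" if "j \<in> J" for j
        using intensity_action(1)[OF f \<rho>] that J(2) by blast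
      show "excess (\<rho> i) (measure \<mu> UNIV) J f = 0" unfolding u unfolding J_def by (rule ex[OF i])
    qed assumption+
    moreover have "measure \<mu> B = ?F - measure (f i) B"
      using \<mu>(2)[OF B] i by (simp add: J_def sum_diff1)
    moreover have "measure \<mu> UNIV = ?R - \<rho> i" unfolding u using i by (simp add: J_def sum_diff1)
    ultimately show ?thesis by simp
  qed
  define F R q where "F = ?F" and "R = ?R" and "q = measure \<eta> B / m"
  have one': "F - measure (f i) B = (R - \<rho> i) * q" if "i \<in> {1..N}" for i
    using one[OF that] by (simp only: F_def R_def q_def times_divide_eq_left times_divide_eq_right)
  have "(\<Sum>i\<in>{1..N}. F - measure (f i) B) = (\<Sum>i\<in>{1..N}. R - \<rho> i) * q"
    unfolding sum_distrib_right by (intro sum.cong refl one')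
  moreover have "(\<Sum>i\<in>{1..N}. F - measure (f i) B) = (real N - 1) * F"
    by (simp only: sum_subtractf F_def[symmetric]) (simp add: left_diff_distrib)
  moreover have "(\<Sum>i\<in>{1..N}. R - \<rho> i) = (real N - 1) * R"
    by (simp only: sum_subtractf R_def[symmetric]) (simp add: left_diff_distrib)
  ultimately have "(real N - 1) * F = (real N - 1) * (R * q)" by (simp only: mult.assoc)
  moreover have "real N - 1 \<noteq> 0" using N by simp
  ultimately have "F = R * q" unfolding mult_cancel_left by blast
  then have "measure (f k) B = \<rho> k * q" using one'[OF k] by (simp add: left_diff_distrib)
  then show "measure (f k) B = \<rho> k / m * measure \<eta> B" by (simp add: q_def)
qed

lemma excess_cong: "(\<And>j. j \<in> J \<Longrightarrow> f j = g j) \<Longrightarrow> excess r s J f = excess r s J g"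
  unfolding excess_def by (simp cong: sum.cong)

text \<open>Needed to conclude from a vanishing expected excess that the excess vanishes almost surely.\<close>

lemma borel_measurable_excess:
  assumes \<kappa>: "\<And>j. j \<in> J \<Longrightarrow> (\<lambda>\<omega>. \<kappa> j \<omega>) \<in> P \<rightarrow>\<^sub>M action_space \<eta> (\<rho> j)"
  shows "(\<lambda>\<omega>. excess r s J (\<lambda>j. \<kappa> j \<omega>)) \<in> borel_measurable P"
proof -
  define u where "u \<omega> z t = (\<Sum>j\<in>J. measure (\<kappa> j \<omega>) (cball z (rad t)))" for \<omega> z t
  have "(\<lambda>(\<omega>, z, t). measure (\<kappa> j \<omega>) (cball z (rad t))) \<in> borel_measurable (P \<Otimes>\<^sub>M (borel \<Otimes>\<^sub>M borel))"
    if j: "j \<in> J" for j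
  proof (rule borel_measurable_measure_cball_rad)
    fix \<omega> assume "\<omega> \<in> space P"
    then have "\<kappa> j \<omega> \<in> space (action_space \<eta> (\<rho> j))" by (rule measurable_space[OF \<kappa>[OF j]])
    then show "finite_measure (\<kappa> j \<omega>) \<and> sets (\<kappa> j \<omega>) = sets borel" using space_action_space by blast
  next
    fix B :: "'a set" assume "B \<in> sets borel"
    from measurable_compose[OF \<kappa>[OF j] borel_measurable_measure_action[OF this]]
    show "(\<lambda>\<omega>. measure (\<kappa> j \<omega>) B) \<in> borel_measurable P" .
  qed
  then have "(\<lambda>p. \<Sum>j\<in>J. (\<lambda>(\<omega>, z, t). measure (\<kappa> j \<omega>) (cball z (rad t))) p) \<in> borel_measurable (P \<Otimes>\<^sub>M (borel \<Otimes>\<^sub>M borel))"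
    by (rule borel_measurable_sum)
  then have um: "(\<lambda>p. u (fst p) (fst (snd p)) (snd (snd p))) \<in> borel_measurable (P \<Otimes>\<^sub>M (borel \<Otimes>\<^sub>M borel))"
    by (simp add: u_def case_prod_unfold)
  have "(\<lambda>p. (fst (fst p), snd p, snd (fst p))) \<in> (P \<Otimes>\<^sub>M lborel) \<Otimes>\<^sub>M \<eta> \<rightarrow>\<^sub>M P \<Otimes>\<^sub>M (borel \<Otimes>\<^sub>M borel)"
  proof -
    have "snd \<in> (P \<Otimes>\<^sub>M lborel) \<Otimes>\<^sub>M \<eta> \<rightarrow>\<^sub>M borel"
      using measurable_snd[of "P \<Otimes>\<^sub>M lborel" \<eta>] by (simp only: measurable_cong_sets[OF refl sets_eq])
    then show ?thesis by measurable
  qed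
  from measurable_compose[OF this um]
  have [measurable]: "(\<lambda>p. u (fst (fst p)) (snd p) (snd (fst p))) \<in> borel_measurable ((P \<Otimes>\<^sub>M lborel) \<Otimes>\<^sub>M \<eta>)"
    by simp
  have "(\<lambda>(p, z). ennreal (r * exp (- (r * snd p)) * gap (u (fst p) z (snd p)) (s * snd p)))
      \<in> borel_measurable ((P \<Otimes>\<^sub>M lborel) \<Otimes>\<^sub>M \<eta>)"
    unfolding case_prod_unfold by measurable
  from borel_measurable_nn_integral[OF this]
  have [measurable]: "(\<lambda>p. \<integral>\<^sup>+z. ennreal (r * exp (- (r * snd p)) * gap (u (fst p) z (snd p)) (s * snd p)) \<partial>\<eta>)
      \<in> borel_measurable (P \<Otimes>\<^sub>M lborel)" .
  have "(\<lambda>(\<omega>, t). (\<integral>\<^sup>+z. ennreal (r * exp (- (r * t)) * gap (u \<omega> z t) (s * t)) \<partial>\<eta>) * indicator {0..1} t)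
      \<in> borel_measurable (P \<Otimes>\<^sub>M lborel)"
    unfolding case_prod_unfold by measurable
  from lborel.borel_measurable_nn_integral[OF this] show ?thesis unfolding excess_def u_def .
qed

end

lemma ennreal_le_of_sum_le:
  fixes a b :: "'i \<Rightarrow> ennreal"
  assumes fin: "finite I" and i: "i \<in> I" and ab: "\<And>j. j \<in> I \<Longrightarrow> a j \<le> b j" and le: "sum b I \<le> sum a I"
    and top: "\<And>j. j \<in> I \<Longrightarrow> a j < top"
  shows "b i \<le> a i"
proof -
  have "b i + sum a (I - {i}) \<le> b i + sum b (I - {i})" using ab by (intro add_left_mono sum_mono) simp
  also have "\<dots> \<le> a i + sum a (I - {i})" using le by (simp only: sum.remove[OF fin i])
  finally have "sum a (I - {i}) + b i \<le> sum a (I - {i}) + a i" by (simp only: add.commute)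
  moreover have "sum a (I - {i}) \<noteq> top" using top by (simp add: less_top[symmetric] fin)
  ultimately show ?thesis by (simp add: ennreal_add_left_cancel_le)
qed

theorem theorem12:
  fixes \<eta> :: "'a::polish_space measure" and N :: nat and \<rho> :: "nat \<Rightarrow> real"
    and G :: "('a \<Rightarrow> 'a) set"
  assumes "2 \<le> N"
    and "cox_hotelling_game \<eta> N \<rho>"
    and "compact (UNIV :: 'a set)"
    and "isometry_group G" and "acts_transitively G" and "invariant_under \<eta> G"
  shows "(\<forall>(P :: 'w measure) (S :: nat \<Rightarrow> 'm measure) M.
            prob_space P \<and> prob_space.indep_vars P S M {1..N} \<longrightarrow>
            nash_equilibrium \<eta> N \<rho> P S M (\<lambda>j _. uniform_action \<eta> (\<rho> j)))
       \<and> (\<forall>(P :: 'w measure) (S :: nat \<Rightarrow> 'm measure) M f.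
            nash_equilibrium \<eta> N \<rho> P S M f \<longrightarrow>
            (\<forall>j\<in>{1..N}. AE \<omega> in P. f j (M j \<omega>) = uniform_action \<eta> (\<rho> j)))"
proof (intro conjI allI impI)
  interpret homogeneous_space \<eta> by (rule homogeneous_space_of_game[OF assms(2-6)])
  have \<rho>: "0 < \<rho> j" if "j \<in> {1..N}" for j using assms(2) that by (simp add: cox_hotelling_game_def)
  have N1: "1 \<le> N" using assms(1) by simp
  have ge: "ennreal (share N \<rho> i) \<le> game_value \<eta> N f i"
    if "\<And>j. j \<in> {1..N} \<Longrightarrow> f j \<in> actions \<eta> (\<rho> j)" "i \<in> {1..N}" "f i = uniform_action \<eta> (\<rho> i)" for f i
    using game_value_uniform_ge[of N \<rho> f i, OF \<rho> that] by (metis add_increasing2 dual_order.trans le_iff_add order_refl zero_le)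
  {
    fix P :: "'w measure" and S :: "nat \<Rightarrow> 'm measure" and M
    assume P: "prob_space P \<and> prob_space.indep_vars P S M {1..N}"
    then interpret P: prob_space P by blast
    let ?u = "\<lambda>j. uniform_action \<eta> (\<rho> j)"
    have u: "?u j \<in> actions \<eta> (\<rho> j)" if "j \<in> {1..N}" for j by (rule uniform_action_in_actions[OF \<rho>[OF that]])
    \<comment> \<open>The other players keep at least their shares, and the shares exhaust the total value.\<close>
    have "game_value \<eta> N (?u(i := g)) i \<le> game_value \<eta> N ?u i"
      if i: "i \<in> {1..N}" and g: "g \<in> actions \<eta> (\<rho> i)" for i g
    proof -
      let ?f = "?u(i := g)"
      have f: "?f j \<in> actions \<eta> (\<rho> j)" if "j \<in> {1..N}" for j using u[OF that] g by simp
      let ?a = "\<lambda>j. ennreal (share N \<rho> j)"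
      have "game_value \<eta> N ?f i + sum ?a ({1..N} - {i}) \<le> game_value \<eta> N ?f i + (\<Sum>j\<in>{1..N} - {i}. game_value \<eta> N ?f j)"
        using f by (intro add_left_mono sum_mono ge) simp_all
      also have "\<dots> = (\<Sum>j\<in>{1..N}. game_value \<eta> N ?f j)"
        by (rule sum.remove[OF finite_atLeastAtMost i, symmetric])
      also have "\<dots> \<le> sum ?a {1..N}" by (rule sum_game_value_le_shares[OF \<rho> f N1])
      also have "\<dots> = ?a i + sum ?a ({1..N} - {i})" by (rule sum.remove[OF finite_atLeastAtMost i])
      finally have "sum ?a ({1..N} - {i}) + game_value \<eta> N ?f i \<le> sum ?a ({1..N} - {i}) + ?a i"
        by (simp only: add.commute)
      moreover have "sum ?a ({1..N} - {i}) \<noteq> top" by (simp add: less_top[symmetric])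
      ultimately have "game_value \<eta> N ?f i \<le> ?a i" by (simp add: ennreal_add_left_cancel_le)
      also have "\<dots> \<le> game_value \<eta> N ?u i" using u i by (intro ge) simp_all
      finally show ?thesis .
    qed
    then show "nash_equilibrium \<eta> N \<rho> P S M (\<lambda>j _. uniform_action \<eta> (\<rho> j))"
      unfolding nash_equilibrium_def independently_randomized_def
      using P uniform_action_in_space[OF \<rho>] by (auto simp: P.emeasure_space_1)
  }
  {
    fix P :: "'w measure" and S :: "nat \<Rightarrow> 'm measure" and M f
    assume nash: "nash_equilibrium \<eta> N \<rho> P S M f"
    then have ind: "independently_randomized \<eta> N \<rho> P S M f"
      and best: "\<And>i g. i \<in> {1..N} \<Longrightarrow> g \<in> actions \<eta> (\<rho> i) \<Longrightarrow>
        (\<integral>\<^sup>+\<omega>. game_value \<eta> N ((\<lambda>j. f j (M j \<omega>))(i := g)) i \<partial>P)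
          \<le> (\<integral>\<^sup>+\<omega>. game_value \<eta> N (\<lambda>j. f j (M j \<omega>)) i \<partial>P)"
      unfolding nash_equilibrium_def by blast+
    interpret P: prob_space P using ind by (simp add: independently_randomized_def)
    let ?F = "\<lambda>\<omega> j. f j (M j \<omega>)"
    have Fm: "(\<lambda>\<omega>. ?F \<omega> j) \<in> P \<rightarrow>\<^sub>M action_space \<eta> (\<rho> j)" if "j \<in> {1..N}" for j
    proof -
      have "M j \<in> P \<rightarrow>\<^sub>M S j" "f j \<in> S j \<rightarrow>\<^sub>M action_space \<eta> (\<rho> j)"
        using ind that by (simp_all add: independently_randomized_def P.indep_vars_def)
      then show ?thesis by (rule measurable_compose)
    qed
    have F: "?F \<omega> j \<in> actions \<eta> (\<rho> j)" if "\<omega> \<in> space P" "j \<in> {1..N}" for \<omega> j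
      using space_action_space(1) measurable_space[OF Fm[OF that(2)] that(1)] by blast
    let ?X = "\<lambda>i \<omega>. excess (\<rho> i) (\<Sum>j\<in>{1..N} - {i}. \<rho> j) ({1..N} - {i}) (?F \<omega>)"
    have Xm: "?X i \<in> borel_measurable P" for i
      by (rule borel_measurable_excess[where \<rho> = \<rho>]) (use Fm in simp)
    let ?a = "\<lambda>i. ennreal (share N \<rho> i)" and ?L = "\<lambda>i. \<integral>\<^sup>+\<omega>. game_value \<eta> N (?F \<omega>) i \<partial>P"
    \<comment> \<open>Deviating to the uniform action is unprofitable, and it would earn the share plus the excess.\<close>
    have L_ge: "?a i + (\<integral>\<^sup>+\<omega>. ?X i \<omega> \<partial>P) \<le> ?L i" if i: "i \<in> {1..N}" for i
    proof -
      let ?u = "uniform_action \<eta> (\<rho> i)"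
      have "?a i + (\<integral>\<^sup>+\<omega>. ?X i \<omega> \<partial>P) = (\<integral>\<^sup>+\<omega>. ?a i + ?X i \<omega> \<partial>P)"
        using Xm[of i] by (simp add: nn_integral_add P.emeasure_space_1)
      also have "\<dots> \<le> (\<integral>\<^sup>+\<omega>. game_value \<eta> N ((?F \<omega>)(i := ?u)) i \<partial>P)"
      proof (rule nn_integral_mono)
        fix \<omega> assume \<omega>: "\<omega> \<in> space P"
        have "?X i \<omega> = excess (\<rho> i) (\<Sum>j\<in>{1..N} - {i}. \<rho> j) ({1..N} - {i}) ((?F \<omega>)(i := ?u))"
          by (rule excess_cong) simp
        moreover have "((?F \<omega>)(i := ?u)) j \<in> actions \<eta> (\<rho> j)" if "j \<in> {1..N}" for j
          using F[OF \<omega> that] uniform_action_in_actions[OF \<rho>[OF i]] by simp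
        ultimately show "?a i + ?X i \<omega> \<le> game_value \<eta> N ((?F \<omega>)(i := ?u)) i"
          using game_value_uniform_ge[of N \<rho> "(?F \<omega>)(i := ?u)" i, OF \<rho>] i by simp
      qed
      also have "\<dots> \<le> ?L i" by (rule best[OF i uniform_action_in_actions[OF \<rho>[OF i]]])
      finally show ?thesis .
    qed
    have "(\<Sum>i\<in>{1..N}. ?L i) \<le> (\<integral>\<^sup>+\<omega>. (\<Sum>i\<in>{1..N}. game_value \<eta> N (?F \<omega>) i) \<partial>P)"
      by (rule sum_nn_integral_le) simp
    also have "\<dots> \<le> (\<integral>\<^sup>+\<omega>. sum ?a {1..N} \<partial>P)"
      by (intro nn_integral_mono sum_game_value_le_shares \<rho> F N1)
    also have "\<dots> = sum ?a {1..N}" by (simp add: P.emeasure_space_1)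
    finally have total: "(\<Sum>i\<in>{1..N}. ?L i) \<le> sum ?a {1..N}" .
    have "(\<integral>\<^sup>+\<omega>. ?X i \<omega> \<partial>P) = 0" if i: "i \<in> {1..N}" for i
    proof -
      have "?L i \<le> ?a i"
      proof (rule ennreal_le_of_sum_le[OF finite_atLeastAtMost i _ total])
        show "?a j \<le> ?L j" if "j \<in> {1..N}" for j
          using L_ge[OF that] by (rule order_trans[rotated]) simp
      qed simp
      from order_trans[OF L_ge[OF i] this]
      have "?a i + (\<integral>\<^sup>+\<omega>. ?X i \<omega> \<partial>P) \<le> ?a i + 0" by (simp only: add_0_right)
      moreover have "?a i \<noteq> top" by simp
      ultimately have "(\<integral>\<^sup>+\<omega>. ?X i \<omega> \<partial>P) \<le> 0"
        unfolding ennreal_add_left_cancel_le infinity_ennreal_def by blast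
      then show ?thesis by (simp only: le_zero_eq)
    qed
    then have "AE \<omega> in P. \<forall>i\<in>{1..N}. ?X i \<omega> = 0"
      using Xm by (intro AE_finite_allI) (simp_all add: nn_integral_0_iff_AE)
    with AE_space have "AE \<omega> in P. \<forall>j\<in>{1..N}. ?F \<omega> j = uniform_action \<eta> (\<rho> j)"
    proof eventually_elim
      case (elim \<omega>)
      show ?case
        using uniform_of_no_excess[of N \<rho> "?F \<omega>", OF assms(1) \<rho> F[OF elim(1)]] elim(2) by blast
    qed
    then show "\<forall>j\<in>{1..N}. AE \<omega> in P. f j (M j \<omega>) = uniform_action \<eta> (\<rho> j)"
      by (auto elim: eventually_mono)
  }
qed

end
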